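(* Let $(\gamma_+,\gamma_-)$ be an angularly regular parallel pair of cooriented frontal germs in $\mathbb{R}^2$ with common angular parameter $u$ near $0$: $\gamma_+'=\rho_+\mathbf e$, $\gamma_-'=-\rho_-\mathbf e$. Put $\Sigma_\rho=\rho_++\rho_-$, $\Delta_\gamma=\gamma_+-\gamma_-$, $\mathcal J_\rho=\rho_+\rho_-'-\rho_-\rho_+'$, and assume $$\det(\Delta_\gamma(0),\mathbf e(0))\neq0,\qquad \Sigma_\rho(0)\neq0 .$$ Let $S(u)=\gamma_-(u)+\frac{\rho_-(u)}{\Sigma_\rho(u)}\Delta_\gamma(u)$ be the local centre symmetry set branch. Then $S$ is regular at $0$ if and only if $\mathcal J_\rho(0)\neq0$. Moreover: (i) $S$ is a $3/2$-cusp at $0$ if and only if $\mathcal J_\rho(0)=0$ and $\mathcal J_\rho'(0)\ne0$; (ii) $S$ is a $4/3$-cusp at $0$ if and only if $\mathcal J_\rho(0)=\mathcal J_\rho'(0)=0$ and $\mathcal J_\rho''(0)\ne0$; (iii) if $\mathcal J_\rho(0)=\mathcal J_\rho'(0)=\mathcal J_\rho''(0)=0$ and $\mathcal J_\rho'''(0)\ne0$, then $S$ is $C^1$-equivalent to a $5/4$-cusp; (iv) under the conditions in (iii), put $Q_S=35\sigma_4^2-48\sigma_3\sigma_5+2400\sigma_3^2$, where $$\sigma=\frac{\mathcal J_\rho|\Delta_\gamma|^3}{\Sigma_\rho^3\det(\Delta_\gamma,\mathbf e)},\qquad \mathcal D_\varphi=\frac{|\Delta_\gamma|^2}{\Sigma_\rho\det(\Delta_\gamma,\mathbf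 e)}\frac{d}{du},\qquad \sigma_j=(\mathcal D_\varphi^j\sigma)(0).$$ Then $S$ is a $5/4$-cusp, a $(5/4;+7)$-cusp, or a $(5/4;-7)$-cusp according as $Q_S$ is zero, positive, or negative, respectively. Equivalently, wherever it is defined, the singular points of $S$ are the critical points of the projective ratio $[\rho_+:\rho_-]:(\mathbb R,0)\to\mathbb{RP}^1$.
   Context: All maps are $C^\infty$ germs unless stated otherwise. A smooth germ $\gamma:(\mathbb R,0)\to\mathbb R^2$ is a cooriented frontal if it has a smooth unit normal field $\mathbf n$ with $\gamma'\cdot\mathbf n=0$; choosing the unit tangent field $\mathbf e=(\cos\theta,\sin\theta)$ so that $(\mathbf e,\mathbf n)$ is positively oriented, $\gamma'=\ell\mathbf e$ with smooth $\ell,\theta$. It is angularly regular if $\theta'\neq0$. Angularly regular parallel pair: two angularly regular cooriented frontal germs $\gamma_\pm$ whose tangent lines at the base points are parallel, tangent lifts chosen opposite at the base points. Both are parametrised by a common angular parameter $u$ near $0$, with $\gamma_+'(u)=\rho_+(u)\mathbf e(u)$, $\gamma_-'(u)=-\rho_-(u)\mathbf e(u)$, where $\mathbf e(u)=(\cos(u+\theta_0),\sin(u+\theta_0))$ for a constant $\theta_0$, and $\rho_\pm$ are smooth (extended signed radii of curvature, possibly vanishing). Prime denotes $d/du$. The local centre symmetry set branch is the envelope of the chord lines $L(u,\lambda)=\gamma_-(u)+\lambda\Delta_\gamma(u)$, i.e. the set of critical values of $L$; under the stated assumptions it is parametrised by $S$. The operator $\mathcal D_\varphi$ is differentiation with respect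 to the chord angle $\varphi$ (the angle of $\Delta_\gamma$), and $\sigma=\pm|dS/d\varphi|$ is the signed speed of $S$ along $\Delta_\gamma/|\Delta_\gamma|$. Two germs $(\mathbb R,0)\to\mathbb R^2$ are $\mathcal A$-equivalent if they differ by smooth diffeomorphism germs in source and target, and $C^1$-equivalent if they differ by $C^1$ diffeomorphism germs. A $3/2$-, $4/3$-, $5/4$-, $(5/4;\pm7)$-cusp is a germ $\mathcal A$-equivalent to $t\mapsto(t^2,t^3)$, $(t^3,t^4)$, $(t^4,t^5)$, $(t^4,t^5\pm t^7)$, respectively; "$C^1$-equivalent to a $5/4$-cusp" means $C^1$-equivalent to $t\mapsto(t^4,t^5)$. *)

theory Defs
  imports "HOL-Analysis.Analysis" "HOL-Library.Extended_Nat"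
begin

section \<open>Germs of class C^k\<close>

text \<open>
  On open subsets of a Euclidean space this is the usual notion of n-fold continuous
  differentiability, expressed through iterated directional derivatives.
\<close>

primrec higher_differentiable_on ::
  "'a::euclidean_space set \<Rightarrow> ('a \<Rightarrow> 'b::real_normed_vector) \<Rightarrow> nat \<Rightarrow> bool" where
  "higher_differentiable_on U f 0 \<longleftrightarrow> continuous_on U f"
| "higher_differentiable_on U f (Suc n) \<longleftrightarrow>
     (\<forall>x\<in>U. f differentiable (at x)) \<and>
     (\<forall>v. higher_differentiable_on U (\<lambda>x. frechet_derivative f (at x) v) n)"

definition Ck_on :: "enat \<Rightarrow> 'a::euclidean_space set \<Rightarrow> ('a \<Rightarrow> 'b::real_normed_vector) \<Rightarrow> bool" where
  "Ck_on k U f \<longleftrightarrow> (\<forall>n. enat n \<le> k \<longrightarrow> higher_differentiable_on U f n)"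

text \<open>Germs are represented by total functions of which only the values near the base point matter.\<close>

definition smooth_germ :: "(real \<Rightarrow> 'b::real_normed_vector) \<Rightarrow> bool" where
  "smooth_germ f \<longleftrightarrow> (\<exists>U. open U \<and> 0 \<in> U \<and> Ck_on \<infinity> U f)"

definition diffeo_germ :: "enat \<Rightarrow> 'a::euclidean_space \<Rightarrow> ('a \<Rightarrow> 'a) \<Rightarrow> bool" where
  "diffeo_germ k p \<phi> \<longleftrightarrow>
     (\<exists>U V \<psi>. open U \<and> open V \<and> p \<in> U \<and> homeomorphism U V \<phi> \<psi> \<and> Ck_on k U \<phi> \<and> Ck_on k V \<psi>)"

text \<open>
  Equivalence of germs \<open>(\<real>, 0) \<rightarrow> \<real>\<^sup>2\<close> under C^k diffeomorphism germs in source and target;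
  the target diffeomorphism sends \<open>f 0\<close> to \<open>g 0\<close>, neither of which need be the origin.
\<close>

definition Ck_equivalent :: "enat \<Rightarrow> (real \<Rightarrow> real^2) \<Rightarrow> (real \<Rightarrow> real^2) \<Rightarrow> bool" where
  "Ck_equivalent k f g \<longleftrightarrow>
     (\<exists>\<phi> \<Phi>. diffeo_germ k 0 \<phi> \<and> \<phi> 0 = 0 \<and> diffeo_germ k (f 0) \<Phi> \<and>
        (\<forall>\<^sub>F t in nhds 0. \<Phi> (f t) = g (\<phi> t)))"

abbreviation A_equivalent :: "(real \<Rightarrow> real^2) \<Rightarrow> (real \<Rightarrow> real^2) \<Rightarrow> bool" where
  "A_equivalent \<equiv> Ck_equivalent \<infinity>"

definition cusp_3_2 :: "(real \<Rightarrow> real^2) \<Rightarrow> bool" where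
  "cusp_3_2 f \<longleftrightarrow> A_equivalent f (\<lambda>t. vector [t^2, t^3])"

definition cusp_4_3 :: "(real \<Rightarrow> real^2) \<Rightarrow> bool" where
  "cusp_4_3 f \<longleftrightarrow> A_equivalent f (\<lambda>t. vector [t^3, t^4])"

definition cusp_5_4 :: "(real \<Rightarrow> real^2) \<Rightarrow> bool" where
  "cusp_5_4 f \<longleftrightarrow> A_equivalent f (\<lambda>t. vector [t^4, t^5])"

definition cusp_5_4_plus_7 :: "(real \<Rightarrow> real^2) \<Rightarrow> bool" where
  "cusp_5_4_plus_7 f \<longleftrightarrow> A_equivalent f (\<lambda>t. vector [t^4, t^5 + t^7])"

definition cusp_5_4_minus_7 :: "(real \<Rightarrow> real^2) \<Rightarrow> bool" where
  "cusp_5_4_minus_7 f \<longleftrightarrow> A_equivalent f (\<lambda>t. vector [t^4, t^5 - t^7])"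

definition C1_cusp_5_4 :: "(real \<Rightarrow> real^2) \<Rightarrow> bool" where
  "C1_cusp_5_4 f \<longleftrightarrow> Ck_equivalent 1 f (\<lambda>t. vector [t^4, t^5])"

definition regular_at :: "(real \<Rightarrow> real^2) \<Rightarrow> real \<Rightarrow> bool" where
  "regular_at f t \<longleftrightarrow> (\<exists>v. v \<noteq> 0 \<and> (f has_vector_derivative v) (at t))"

definition singular_at :: "(real \<Rightarrow> real^2) \<Rightarrow> real \<Rightarrow> bool" where
  "singular_at f t \<longleftrightarrow> (f has_vector_derivative 0) (at t)"


section \<open>Cooriented frontals and parallel pairs\<close>

definition det2 :: "real^2 \<Rightarrow> real^2 \<Rightarrow> real" where
  "det2 v w = det (vector [v, w] :: real^2^2)"

definition unit_dir :: "real \<Rightarrow> real^2" where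
  "unit_dir a = vector [cos a, sin a]"

definition cooriented_frontal :: "(real \<Rightarrow> real^2) \<Rightarrow> (real \<Rightarrow> real^2) \<Rightarrow> bool" where
  "cooriented_frontal \<gamma> n \<longleftrightarrow>
     smooth_germ \<gamma> \<and> smooth_germ n \<and>
     (\<forall>\<^sub>F t in nhds 0. norm (n t) = 1 \<and> vector_derivative \<gamma> (at t) \<bullet> n t = 0)"

text \<open>\<open>e\<close> is the unit tangent field with \<open>(e, n)\<close> positively oriented, and \<open>\<gamma>' = l e\<close>.\<close>

definition tangent_lift ::
  "(real \<Rightarrow> real^2) \<Rightarrow> (real \<Rightarrow> real^2) \<Rightarrow> (real \<Rightarrow> real^2) \<Rightarrow> (real \<Rightarrow> real) \<Rightarrow> bool" where
  "tangent_lift \<gamma> n e l \<longleftrightarrow>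
     cooriented_frontal \<gamma> n \<and> smooth_germ e \<and> smooth_germ l \<and>
     (\<forall>\<^sub>F t in nhds 0. norm (e t) = 1 \<and> e t \<bullet> n t = 0 \<and> det2 (e t) (n t) > 0 \<and>
        (\<gamma> has_vector_derivative l t *\<^sub>R e t) (at t))"

definition angularly_regular :: "(real \<Rightarrow> real^2) \<Rightarrow> (real \<Rightarrow> real^2) \<Rightarrow> bool" where
  "angularly_regular \<gamma> n \<longleftrightarrow>
     (\<exists>\<theta> l. smooth_germ \<theta> \<and> tangent_lift \<gamma> n (\<lambda>t. unit_dir (\<theta> t)) l \<and> deriv \<theta> 0 \<noteq> 0)"

text \<open>
  The pair is parametrised by the common angular parameter \<open>u\<close>: the tangent lifts are
  \<open>e u = unit_dir (u + \<theta>\<^sub>0)\<close> and \<open>- e u\<close>, so that \<open>\<gamma>\<^sub>+' = \<rho>\<^sub>+ e\<close> and \<open>\<gamma>\<^sub>-' = - \<rho>\<^sub>- e\<close>.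
\<close>

definition angular_parallel_pair ::
  "real \<Rightarrow> (real \<Rightarrow> real) \<Rightarrow> (real \<Rightarrow> real) \<Rightarrow> (real \<Rightarrow> real^2) \<Rightarrow> (real \<Rightarrow> real^2) \<Rightarrow> bool" where
  "angular_parallel_pair \<theta>\<^sub>0 \<rho>p \<rho>m \<gamma>p \<gamma>m \<longleftrightarrow>
     (\<exists>np nm. angularly_regular \<gamma>p np \<and> angularly_regular \<gamma>m nm \<and>
        tangent_lift \<gamma>p np (\<lambda>u. unit_dir (u + \<theta>\<^sub>0)) \<rho>p \<and>
        tangent_lift \<gamma>m nm (\<lambda>u. - unit_dir (u + \<theta>\<^sub>0)) \<rho>m)"

definition radius_sum :: "(real \<Rightarrow> real) \<Rightarrow> (real \<Rightarrow> real) \<Rightarrow> real \<Rightarrow> real" where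
  "radius_sum \<rho>p \<rho>m u = \<rho>p u + \<rho>m u"

definition chord :: "(real \<Rightarrow> real^2) \<Rightarrow> (real \<Rightarrow> real^2) \<Rightarrow> real \<Rightarrow> real^2" where
  "chord \<gamma>p \<gamma>m u = \<gamma>p u - \<gamma>m u"

definition radius_jac :: "(real \<Rightarrow> real) \<Rightarrow> (real \<Rightarrow> real) \<Rightarrow> real \<Rightarrow> real" where
  "radius_jac \<rho>p \<rho>m u = \<rho>p u * deriv \<rho>m u - \<rho>m u * deriv \<rho>p u"

definition css ::
  "(real \<Rightarrow> real) \<Rightarrow> (real \<Rightarrow> real) \<Rightarrow> (real \<Rightarrow> real^2) \<Rightarrow> (real \<Rightarrow> real^2) \<Rightarrow> real \<Rightarrow> real^2" where
  "css \<rho>p \<rho>m \<gamma>p \<gamma>m u = \<gamma>m u + (\<rho>m u / radius_sum \<rho>p \<rho>m u) *\<^sub>R chord \<gamma>p \<gamma>m u"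

definition css_speed ::
  "real \<Rightarrow> (real \<Rightarrow> real) \<Rightarrow> (real \<Rightarrow> real) \<Rightarrow> (real \<Rightarrow> real^2) \<Rightarrow> (real \<Rightarrow> real^2) \<Rightarrow> real \<Rightarrow> real" where
  "css_speed \<theta>\<^sub>0 \<rho>p \<rho>m \<gamma>p \<gamma>m u =
     radius_jac \<rho>p \<rho>m u * norm (chord \<gamma>p \<gamma>m u) ^ 3 /
     (radius_sum \<rho>p \<rho>m u ^ 3 * det2 (chord \<gamma>p \<gamma>m u) (unit_dir (u + \<theta>\<^sub>0)))"

text \<open>Differentiation with respect to the angle of the chord.\<close>

definition D_phi ::
  "real \<Rightarrow> (real \<Rightarrow> real) \<Rightarrow> (real \<Rightarrow> real) \<Rightarrow> (real \<Rightarrow> real^2) \<Rightarrow> (real \<Rightarrow> real^2) \<Rightarrow>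
   (real \<Rightarrow> real) \<Rightarrow> real \<Rightarrow> real" where
  "D_phi \<theta>\<^sub>0 \<rho>p \<rho>m \<gamma>p \<gamma>m f u =
     (norm (chord \<gamma>p \<gamma>m u))\<^sup>2 /
     (radius_sum \<rho>p \<rho>m u * det2 (chord \<gamma>p \<gamma>m u) (unit_dir (u + \<theta>\<^sub>0))) * deriv f u"

definition css_sigma ::
  "real \<Rightarrow> (real \<Rightarrow> real) \<Rightarrow> (real \<Rightarrow> real) \<Rightarrow> (real \<Rightarrow> real^2) \<Rightarrow> (real \<Rightarrow> real^2) \<Rightarrow> nat \<Rightarrow> real" where
  "css_sigma \<theta>\<^sub>0 \<rho>p \<rho>m \<gamma>p \<gamma>m j =
     (D_phi \<theta>\<^sub>0 \<rho>p \<rho>m \<gamma>p \<gamma>m ^^ j) (css_speed \<theta>\<^sub>0 \<rho>p \<rho>m \<gamma>p \<gamma>m) 0"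

definition Q_S ::
  "real \<Rightarrow> (real \<Rightarrow> real) \<Rightarrow> (real \<Rightarrow> real) \<Rightarrow> (real \<Rightarrow> real^2) \<Rightarrow> (real \<Rightarrow> real^2) \<Rightarrow> real" where
  "Q_S \<theta>\<^sub>0 \<rho>p \<rho>m \<gamma>p \<gamma>m =
     (let \<sigma> = css_sigma \<theta>\<^sub>0 \<rho>p \<rho>m \<gamma>p \<gamma>m
      in 35 * (\<sigma> 4)\<^sup>2 - 48 * \<sigma> 3 * \<sigma> 5 + 2400 * (\<sigma> 3)\<^sup>2)"


section \<open>Maps into the real projective line\<close>

text \<open>
  Points of the projective line are the lines through the origin of \<open>\<real>\<^sup>2\<close>. The two affine charts
  are \<open>[1 : t] \<mapsto> t\<close>, on all lines but \<open>[0 : 1]\<close>, and \<open>[t : 1] \<mapsto> t\<close>, on all lines but \<open>[1 : 0]\<close>.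
  For \<open>x = y = 0\<close> the term \<open>proj_point x y\<close> is not a point of the projective line.
\<close>

definition proj_point :: "real \<Rightarrow> real \<Rightarrow> (real^2) set" where
  "proj_point x y = span {vector [x, y]}"

definition RP1 :: "(real^2) set set" where
  "RP1 = {proj_point x y |x y. x \<noteq> 0 \<or> y \<noteq> 0}"

definition RP1_charts :: "((real^2) set set \<times> ((real^2) set \<Rightarrow> real)) set" where
  "RP1_charts =
     {(RP1 - {proj_point 0 1}, \<lambda>L. THE t. vector [1, t] \<in> L),
      (RP1 - {proj_point 1 0}, \<lambda>L. THE t. vector [t, 1] \<in> L)}"

text \<open>
  A point of the source is critical if the derivative, read in an affine chart around the
  image point, vanishes; this does not depend on the chart.
\<close>

definition RP1_critical_point :: "(real \<Rightarrow> (real^2) set) \<Rightarrow> real \<Rightarrow> bool" where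
  "RP1_critical_point F u \<longleftrightarrow>
     (\<exists>(D, \<kappa>)\<in>RP1_charts. F u \<in> D \<and> ((\<lambda>t. \<kappa> (F t)) has_real_derivative 0) (at u))"

end

theory Submission
  imports Defs "HOL-Library.Landau_Symbols" "HOL-Computational_Algebra.Polynomial"
begin

text \<open>
  The velocity of the branch is \<open>S' = (J / \<Sigma>\<^sup>2) \<Delta>\<close>, so in terms of the chord angle \<open>\<phi>\<close> (in a frame
  with \<open>\<phi> = 0\<close> at the base point) \<open>dS/d\<phi> = \<sigma> (cos \<phi>, sin \<phi>)\<close>, and \<open>\<sigma>\<close> and \<open>J\<close> vanish to the same order.
  If this order is \<open>m - 1\<close>, then \<open>|S - S(0)|\<close> is comparable to \<open>|\<phi>|\<^sup>m\<close>; local bi-Lipschitz maps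
  preserve \<open>m\<close>, which gives the necessity of the conditions.

  For the sufficiency let \<open>N\<close> be the model cusp. A smooth function germ \<open>f\<close> of one variable is of the form
  \<open>F \<circ> N\<close> with \<open>F\<close> smooth as soon as finitely many linear conditions on its Taylor coefficients hold,
  one for each gap of the semigroup of \<open>N\<close>. Indeed, Borel's lemma provides smooth \<open>h\<^sub>j\<close> such that \<open>f\<close> and
  \<open>\<Sum>\<^sub>j t\<^bsup>e(j)\<^esup> h\<^sub>j(t\<^sup>m)\<close> have the same Taylor series, and a flat remainder remains smooth when it is
  rewritten as a function of \<open>t\<^sup>m\<close>. A polynomial reparametrisation makes both components of
  \<open>S\<close> satisfy these conditions, so that \<open>S = \<Psi> \<circ> N\<close>, where \<open>\<Psi>\<close> is a local diffeomorphism by the inverse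
  function theorem. For \<open>m = 4\<close> the coefficient \<open>\<epsilon>\<close> of \<open>t\<^sup>7\<close> in \<open>N = (t\<^sup>4, t\<^sup>5 + \<epsilon> t\<^sup>7)\<close> is forced and is a
  positive multiple of \<open>Q\<^sub>S\<close>; it can be rescaled to \<open>0\<close>, \<open>1\<close> or \<open>-1\<close>, and removed by a map of class C^1.
\<close>

subsection \<open>Maps of class C^k\<close>

text \<open>In the chosen frame \<open>y' = x' tan \<phi>\<close>, so \<open>y\<close> vanishes to
  exactly one order more than \<open>x\<close>. Two things follow. The linear part of
  \<open>\<Psi>\<close> is triangular with the two leading coefficients on the diagonal, hence
  invertible. And the gap conditions can be solved one after the other: in each gap one coefficient
  of the reparametrisation is spent on \<open>y\<close>, the next one on \<open>x\<close>. For
  \<open>m = 4\<close>, where the gaps are 1, 2, 3, 6, 7, 11, this fails once: in degree 7 the only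
  fresh coefficient acts on \<open>x\<close> alone, and what \<open>y\<close> retains there is
  \<open>\<epsilon>\<close>. The identity \<open>S = \<Psi> \<circ> N\<close>, up to the
  reparametrisation, is exact and not merely one of jets. Equivalence therefore follows from the
  inverse function theorem, without a determinacy theorem or the integration of vector fields. The
  price is Borel's lemma together with the analysis of flat functions, by which arbitrary Taylor
  series are realised and the difference is absorbed.\<close>

lemma higher_differentiable_on_cong:
  assumes "open U" "\<And>x. x \<in> U \<Longrightarrow> f x = g x"
  shows "higher_differentiable_on U f n \<Longrightarrow> higher_differentiable_on U g n"
  using assms(2)
proof (induction n arbitrary: f g)
  case 0
  then show ?case using continuous_on_cong by auto
next
  case (Suc n)
  have d: "(g has_derivative frechet_derivative f (at x)) (at x)" if "x \<in> U" for x
  proof (rule has_derivative_transform_within_open[OF _ assms(1) that])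
    show "(f has_derivative frechet_derivative f (at x)) (at x)"
      using Suc.prems(1) that by (simp add: frechet_derivative_works[symmetric])
  qed (use Suc.prems(2) in auto)
  then have fd: "frechet_derivative g (at x) = frechet_derivative f (at x)" if "x \<in> U" for x
    using frechet_derivative_at[OF d[OF that]] by simp
  show ?case
  proof (simp, intro conjI ballI allI)
    show "g differentiable at x" if "x \<in> U" for x
      using d[OF that] differentiable_def by blast
    show "higher_differentiable_on U (\<lambda>x. frechet_derivative g (at x) v) n" for v
      by (rule Suc.IH[of "\<lambda>x. frechet_derivative f (at x) v"]) (use Suc.prems fd in auto)
  qed
qed

text \<open>The recursive definition speaks of \<open>frechet_derivative\<close>, a choice operator.
  This rule admits any explicitly known derivative in its place, so that later arguments can exhibit
  derivatives by formula.\<close>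

lemma higher_differentiable_on_SucI:
  assumes "open U" "\<And>x. x \<in> U \<Longrightarrow> (f has_derivative f' x) (at x)"
    "\<And>v. higher_differentiable_on U (\<lambda>x. f' x v) n"
  shows "higher_differentiable_on U f (Suc n)"
proof (simp, intro conjI ballI allI)
  show "f differentiable at x" if "x \<in> U" for x
    using assms(2)[OF that] differentiable_def by blast
  show "higher_differentiable_on U (\<lambda>x. frechet_derivative f (at x) v) n" for v
    by (rule higher_differentiable_on_cong[OF assms(1) _ assms(3)])
      (simp add: frechet_derivative_at[OF assms(2), symmetric])
qed

lemma higher_differentiable_on_SucD:
  assumes "higher_differentiable_on U f (Suc n)"
  shows "x \<in> U \<Longrightarrow> (f has_derivative frechet_derivative f (at x)) (at x)"
    "higher_differentiable_on U (\<lambda>x. frechet_derivative f (at x) v) n"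
  using assms frechet_derivative_works by auto

lemma higher_differentiable_on_imp_continuous_on:
  "higher_differentiable_on U f n \<Longrightarrow> continuous_on U f"
proof (cases n)
  case (Suc m)
  assume "higher_differentiable_on U f n"
  with Suc have "\<forall>x\<in>U. isCont f x"
    by (simp add: differentiable_imp_continuous_within)
  then show ?thesis
    by (rule continuous_at_imp_continuous_on)
qed simp

lemma higher_differentiable_on_pred:
  "higher_differentiable_on U f (Suc n) \<Longrightarrow> higher_differentiable_on U f n"
proof (induction n arbitrary: f)
  case 0
  then show ?case using higher_differentiable_on_imp_continuous_on[OF "0"] by simp
next
  case (Suc n)
  then show ?case by (metis higher_differentiable_on.simps(2))
qed

lemma higher_differentiable_on_subset:
  "higher_differentiable_on U f n \<Longrightarrow> V \<subseteq> U \<Longrightarrow> higher_differentiable_on V f n"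
  by (induction n arbitrary: f) (auto intro: continuous_on_subset)

lemma higher_differentiable_on_const:
  "open U \<Longrightarrow> higher_differentiable_on U (\<lambda>x. c) n"
proof (induction n arbitrary: c)
  case (Suc n)
  then show ?case
    by (intro higher_differentiable_on_SucI[where f' = "\<lambda>x v. 0"]) auto
qed simp

lemma higher_differentiable_on_linear:
  assumes "open U" "bounded_linear f"
  shows "higher_differentiable_on U f n"
proof (cases n)
  case (Suc m)
  then show ?thesis
    using assms by (auto intro!: higher_differentiable_on_SucI[where f' = "\<lambda>x. f"]
        higher_differentiable_on_const bounded_linear_imp_has_derivative simp del: higher_differentiable_on.simps)
qed (use assms linear_continuous_on in auto)

lemma higher_differentiable_on_add:
  assumes "open U"
  shows "higher_differentiable_on U f n \<Longrightarrow> higher_differentiable_on U g n \<Longrightarrow>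
    higher_differentiable_on U (\<lambda>x. f x + g x) n"
proof (induction n arbitrary: f g)
  case (Suc n)
  note d = higher_differentiable_on_SucD[OF Suc.prems(1)] higher_differentiable_on_SucD[OF Suc.prems(2)]
  show ?case
    by (rule higher_differentiable_on_SucI[OF assms has_derivative_add[OF d(1) d(3)] Suc.IH[OF d(2) d(4)]])
qed (auto intro: continuous_on_add)

lemma higher_differentiable_on_bilinear:
  assumes "open U" "bounded_bilinear h"
  shows "higher_differentiable_on U f n \<Longrightarrow> higher_differentiable_on U g n \<Longrightarrow>
    higher_differentiable_on U (\<lambda>x. h (f x) (g x)) n"
proof (induction n arbitrary: f g)
  case 0
  then show ?case using bounded_bilinear.continuous_on[OF assms(2)] by auto
next
  case (Suc n)
  note d = higher_differentiable_on_SucD[OF Suc.prems(1)] higher_differentiable_on_SucD[OF Suc.prems(2)]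
  note p = higher_differentiable_on_pred[OF Suc.prems(1)] higher_differentiable_on_pred[OF Suc.prems(2)]
  show ?case
    by (rule higher_differentiable_on_SucI[OF assms(1) bounded_bilinear.FDERIV[OF assms(2) d(1) d(3)]
          higher_differentiable_on_add[OF assms(1) Suc.IH[OF p(1) d(4)] Suc.IH[OF d(2) p(2)]]])
qed

lemma higher_differentiable_on_sum:
  assumes "open U" "\<And>i. i \<in> I \<Longrightarrow> higher_differentiable_on U (f i) n"
  shows "higher_differentiable_on U (\<lambda>x. \<Sum>i\<in>I. f i x) n"
  using assms(2)
proof (induction I rule: infinite_finite_induct)
  case (insert i I)
  have "higher_differentiable_on U (f i) n" "higher_differentiable_on U (\<lambda>x. \<Sum>i\<in>I. f i x) n"
    using insert by auto
  from higher_differentiable_on_add[OF assms(1) this] show ?case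
    using insert.hyps by simp
qed (simp_all add: higher_differentiable_on_const[OF assms(1)])

lemma higher_differentiable_on_compose:
  fixes f :: "'a::euclidean_space \<Rightarrow> 'b::euclidean_space"
  assumes "open U" "open V" "f ` U \<subseteq> V"
  shows "higher_differentiable_on U f n \<Longrightarrow> higher_differentiable_on V g n \<Longrightarrow>
    higher_differentiable_on U (\<lambda>x. g (f x)) n"
proof (induction n arbitrary: g)
  case 0
  then show ?case using continuous_on_compose2[of V g U f] assms(3) by simp
next
  case (Suc n)
  note d = higher_differentiable_on_SucD[OF Suc.prems(1)] higher_differentiable_on_SucD[OF Suc.prems(2)]
  \<comment> \<open>In the chain rule both the point and the direction of the derivative of
    \<open>g\<close> vary with \<open>x\<close>, whereas the induction hypothesis covers fixed
    directions. Expanding the direction in the basis leaves a finite sum of products to which it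
    applies.\<close>
  have *: "frechet_derivative g (at (f x)) (frechet_derivative f (at x) v) =
      (\<Sum>b\<in>Basis. (frechet_derivative f (at x) v \<bullet> b) *\<^sub>R frechet_derivative g (at (f x)) b)"
    if "x \<in> U" for x v
  proof -
    have "linear (frechet_derivative g (at (f x)))"
      using d(3)[of "f x"] that assms(3) has_derivative_linear by blast
    then have "frechet_derivative g (at (f x)) (\<Sum>b\<in>Basis. (frechet_derivative f (at x) v \<bullet> b) *\<^sub>R b) =
      (\<Sum>b\<in>Basis. (frechet_derivative f (at x) v \<bullet> b) *\<^sub>R frechet_derivative g (at (f x)) b)"
      by (simp add: linear_sum linear_scale)
    then show ?thesis by (simp add: euclidean_representation)
  qed
  have hs: "higher_differentiable_on U (\<lambda>x. \<Sum>b\<in>Basis. (frechet_derivative f (at x) v \<bullet> b) *\<^sub>R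
      frechet_derivative g (at (f x)) b) n" for v
  proof (intro higher_differentiable_on_sum higher_differentiable_on_bilinear[OF _ bounded_bilinear_scaleR] assms(1))
    fix b :: 'b
    show "higher_differentiable_on U (\<lambda>x. frechet_derivative f (at x) v \<bullet> b) n"
      by (rule higher_differentiable_on_bilinear[OF assms(1) bounded_bilinear_inner d(2)
            higher_differentiable_on_const[OF assms(1)]])
    show "higher_differentiable_on U (\<lambda>x. frechet_derivative g (at (f x)) b) n"
      by (rule Suc.IH[OF higher_differentiable_on_pred[OF Suc.prems(1)] d(4)])
  qed
  show ?case
  proof (rule higher_differentiable_on_SucI[OF assms(1)])
    show "((\<lambda>x. g (f x)) has_derivative
        (\<lambda>v. frechet_derivative g (at (f x)) (frechet_derivative f (at x) v))) (at x)" if "x \<in> U" for x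
      using has_derivative_compose[OF d(1)[OF that] d(3)] that assms(3) by (auto simp: o_def)
    show "higher_differentiable_on U
        (\<lambda>x. frechet_derivative g (at (f x)) (frechet_derivative f (at x) v)) n" for v
      by (rule higher_differentiable_on_cong[OF assms(1) _ hs[of v]]) (simp add: *)
  qed
qed

text \<open>
  Bootstrapping for a map that solves an autonomous first-order equation \<open>Dg = H \<circ> g\<close>: reciprocals
  and local inverses are of this kind.
\<close>

lemma higher_differentiable_on_bootstrap:
  fixes g :: "'a::euclidean_space \<Rightarrow> 'b::euclidean_space"
  assumes "open U" "open V" "g ` U \<subseteq> V"
    and d: "\<And>x. x \<in> U \<Longrightarrow> (g has_derivative (\<lambda>v. H v (g x))) (at x)"
    and H: "\<And>v. higher_differentiable_on V (H v) n"
  shows "higher_differentiable_on U g (Suc n)"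
  using H
proof (induction n)
  case 0
  have c: "continuous_on U g"
    using d by (meson continuous_at_imp_continuous_on has_derivative_continuous)
  have "continuous_on U (\<lambda>x. H v (g x))" for v
    by (rule continuous_on_compose2[OF _ c assms(3)]) (use 0 in simp)
  then have h: "higher_differentiable_on U (\<lambda>x. H v (g x)) 0" for v
    by simp
  show ?case
    by (rule higher_differentiable_on_SucI[OF assms(1) d h])
next
  case (Suc n)
  have "higher_differentiable_on U g (Suc n)"
    by (rule Suc.IH) (rule higher_differentiable_on_pred[OF Suc.prems])
  then have h: "higher_differentiable_on U (\<lambda>x. H v (g x)) (Suc n)" for v
    using Suc.prems by (rule higher_differentiable_on_compose[OF assms(1-3)])
  show ?case
    by (rule higher_differentiable_on_SucI[OF assms(1) d h])
qed


subsection \<open>Germs\<close>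

text \<open>Ranges over base points and dimensions, since functions of the parameter, maps of the
  plane at the origin and functions on the line at arbitrary points are all treated as
  germs.\<close>

definition Ck_at :: "enat \<Rightarrow> 'a::euclidean_space \<Rightarrow> ('a \<Rightarrow> 'b::real_normed_vector) \<Rightarrow> bool" where
  "Ck_at k p f \<longleftrightarrow> (\<exists>U. open U \<and> p \<in> U \<and> Ck_on k U f)"

lemma smooth_germ_iff_Ck_at: "smooth_germ f \<longleftrightarrow> Ck_at \<infinity> 0 f"
  by (simp add: smooth_germ_def Ck_at_def)

lemma Ck_onD: "Ck_on k U f \<Longrightarrow> enat n \<le> k \<Longrightarrow> higher_differentiable_on U f n"
  by (simp add: Ck_on_def)

lemma Ck_on_subset: "Ck_on k U f \<Longrightarrow> V \<subseteq> U \<Longrightarrow> Ck_on k V f"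
  by (auto simp: Ck_on_def intro: higher_differentiable_on_subset)

lemma Ck_on_cong: "Ck_on k U f \<Longrightarrow> open U \<Longrightarrow> (\<And>x. x \<in> U \<Longrightarrow> f x = g x) \<Longrightarrow> Ck_on k U g"
  by (auto simp: Ck_on_def intro: higher_differentiable_on_cong)

lemma Ck_atI: "open U \<Longrightarrow> p \<in> U \<Longrightarrow> Ck_on k U f \<Longrightarrow> Ck_at k p f"
  by (auto simp: Ck_at_def)

lemma Ck_at_mono: "Ck_at k p f \<Longrightarrow> l \<le> k \<Longrightarrow> Ck_at l p f"
  by (auto simp: Ck_at_def Ck_on_def intro: order_trans)

lemma Ck_at_cong:
  assumes "Ck_at k p f" "\<forall>\<^sub>F x in nhds p. f x = g x"
  shows "Ck_at k p g"
proof -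
  obtain U where U: "open U" "p \<in> U" "Ck_on k U f"
    using assms(1) by (auto simp: Ck_at_def)
  obtain V where V: "open V" "p \<in> V" "\<And>x. x \<in> V \<Longrightarrow> f x = g x"
    using assms(2) unfolding eventually_nhds by auto
  have "Ck_on k (U \<inter> V) g"
    by (rule Ck_on_cong[of _ _ f]) (use U V Ck_on_subset[of k U f "U \<inter> V"] in auto)
  then show ?thesis using U V by (intro Ck_atI[of "U \<inter> V"]) auto
qed

lemma Ck_at_const: "Ck_at k p (\<lambda>x. c)"
  by (rule Ck_atI[of UNIV]) (simp_all add: Ck_on_def higher_differentiable_on_const)

lemma Ck_at_linear: "bounded_linear f \<Longrightarrow> Ck_at k p f"
  by (rule Ck_atI[of UNIV]) (simp_all add: Ck_on_def higher_differentiable_on_linear)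

lemma Ck_at_id: "Ck_at k p (\<lambda>x. x)"
  by (intro Ck_at_linear bounded_linear_ident)

lemma Ck_at_common_nhd:
  assumes "Ck_at k p f" "Ck_at k p g"
  obtains U where "open U" "p \<in> U" "Ck_on k U f" "Ck_on k U g"
proof -
  obtain U V where "open U" "p \<in> U" "Ck_on k U f" "open V" "p \<in> V" "Ck_on k V g"
    using assms by (auto simp: Ck_at_def)
  then show thesis
    by (intro that[of "U \<inter> V"]) (auto intro: Ck_on_subset)
qed

lemma Ck_at_bilinear:
  assumes "bounded_bilinear h" "Ck_at k p f" "Ck_at k p g"
  shows "Ck_at k p (\<lambda>x. h (f x) (g x))"
proof -
  obtain U where U: "open U" "p \<in> U" "Ck_on k U f" "Ck_on k U g"
    using Ck_at_common_nhd[OF assms(2,3)] .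
  have "Ck_on k U (\<lambda>x. h (f x) (g x))"
    using higher_differentiable_on_bilinear[OF U(1) assms(1)] U(3,4) by (simp add: Ck_on_def)
  then show ?thesis by (rule Ck_atI[OF U(1,2)])
qed

lemma Ck_at_add:
  assumes "Ck_at k p f" "Ck_at k p g"
  shows "Ck_at k p (\<lambda>x. f x + g x)"
proof -
  obtain U where U: "open U" "p \<in> U" "Ck_on k U f" "Ck_on k U g"
    using Ck_at_common_nhd[OF assms] .
  have "Ck_on k U (\<lambda>x. f x + g x)"
    unfolding Ck_on_def using higher_differentiable_on_add[OF U(1)] Ck_onD[OF U(3)] Ck_onD[OF U(4)] by blast
  then show ?thesis by (rule Ck_atI[OF U(1,2)])
qed

lemma Ck_at_compose:
  fixes f :: "'a::euclidean_space \<Rightarrow> 'b::euclidean_space"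
  assumes "Ck_at k (f p) g" "Ck_at k p f"
  shows "Ck_at k p (\<lambda>x. g (f x))"
proof -
  obtain U V where UV: "open U" "p \<in> U" "Ck_on k U f" "open V" "f p \<in> V" "Ck_on k V g"
    using assms by (auto simp: Ck_at_def)
  have "continuous_on U f"
    using Ck_onD[OF UV(3), of 0] by (simp add: enat_0)
  then obtain W where W: "open W" "W \<inter> U = f -` V \<inter> U"
    using UV(4) unfolding continuous_on_open_invariant by blast
  show ?thesis
  proof (rule Ck_atI[OF open_Int[OF W(1) UV(1)]])
    show "Ck_on k (W \<inter> U) (\<lambda>x. g (f x))"
      unfolding Ck_on_def
    proof (intro allI impI)
      fix n assume "enat n \<le> k"
      then have "higher_differentiable_on (W \<inter> U) f n" "higher_differentiable_on V g n"
        using higher_differentiable_on_subset Ck_onD UV by blast+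
      moreover have "open (W \<inter> U)"
        using W(1) UV(1) by (rule open_Int)
      moreover have "f ` (W \<inter> U) \<subseteq> V"
        using W(2) by blast
      ultimately show "higher_differentiable_on (W \<inter> U) (\<lambda>x. g (f x)) n"
        using higher_differentiable_on_compose[OF _ UV(4)] by blast
    qed
  qed (use UV W(2) in blast)
qed

lemma Ck_at_scaleR: "Ck_at k p f \<Longrightarrow> Ck_at k p g \<Longrightarrow> Ck_at k p (\<lambda>x. f x *\<^sub>R g x)"
  by (rule Ck_at_bilinear[OF bounded_bilinear_scaleR])

lemma Ck_at_inner: "Ck_at k p f \<Longrightarrow> Ck_at k p g \<Longrightarrow> Ck_at k p (\<lambda>x. f x \<bullet> g x)"
  by (rule Ck_at_bilinear[OF bounded_bilinear_inner])

lemma Ck_at_mult: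
  fixes f g :: "'a::euclidean_space \<Rightarrow> 'b::real_normed_algebra"
  shows "Ck_at k p f \<Longrightarrow> Ck_at k p g \<Longrightarrow> Ck_at k p (\<lambda>x. f x * g x)"
  by (rule Ck_at_bilinear[OF bounded_bilinear_mult])

lemma Ck_at_power:
  fixes f :: "'a::euclidean_space \<Rightarrow> 'b::{real_normed_algebra, monoid_mult}"
  shows "Ck_at k p f \<Longrightarrow> Ck_at k p (\<lambda>x. f x ^ n)"
  by (induction n) (simp_all add: Ck_at_const Ck_at_mult)

lemma Ck_at_minus: "Ck_at k p f \<Longrightarrow> Ck_at k p (\<lambda>x. - f x)"
  using Ck_at_scaleR[OF Ck_at_const, of k p f "-1"] by simp

lemma Ck_at_diff: "Ck_at k p f \<Longrightarrow> Ck_at k p g \<Longrightarrow> Ck_at k p (\<lambda>x. f x - g x)"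
  using Ck_at_add[of k p f "\<lambda>x. - g x"] Ck_at_minus[of k p g] by simp

lemma Ck_at_sum:
  "(\<And>i. i \<in> I \<Longrightarrow> Ck_at k p (f i)) \<Longrightarrow> Ck_at k p (\<lambda>x. \<Sum>i\<in>I. f i x)"
  by (induction I rule: infinite_finite_induct) (simp_all add: Ck_at_const Ck_at_add)

lemma Ck_on_inverse: "Ck_on k (- {0}) (inverse :: real \<Rightarrow> real)"
proof -
  have "higher_differentiable_on (- {0}) (inverse :: real \<Rightarrow> real) (Suc n)" for n
  \<comment> \<open>The equation behind this is \<open>(1/x)' = - (1/x)^2\<close>: the derivative is
    a polynomial in the value itself.\<close>
  proof (rule higher_differentiable_on_bootstrap[where V = UNIV and H = "\<lambda>v y. - (v * y * y)"])
    show "(inverse has_derivative (\<lambda>v. - (v * inverse x * inverse x))) (at x)"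
      if "x \<in> - {0}" for x :: real
      using that has_derivative_inverse'[of x UNIV] by (simp add: algebra_simps)
    show "higher_differentiable_on UNIV (\<lambda>y. - (v * y * y)) n" for v :: real
      using higher_differentiable_on_bilinear[OF open_UNIV bounded_bilinear_mult
          higher_differentiable_on_linear[OF open_UNIV, of "\<lambda>y. (- v) * y" n]
          higher_differentiable_on_linear[OF open_UNIV, of "\<lambda>y. y" n]]
      by (simp add: bounded_linear_mult_right bounded_linear_minus)
  qed auto
  then show ?thesis
    unfolding Ck_on_def using higher_differentiable_on_pred by blast
qed

lemma Ck_at_inverse:
  fixes f :: "'a::euclidean_space \<Rightarrow> real"
  assumes "Ck_at k p f" "f p \<noteq> 0"
  shows "Ck_at k p (\<lambda>x. inverse (f x))"
  by (rule Ck_at_compose[OF Ck_atI[OF _ _ Ck_on_inverse] assms(1)]) (use assms(2) in auto)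

lemma Ck_at_divide:
  fixes f :: "'a::euclidean_space \<Rightarrow> real"
  shows "Ck_at k p f \<Longrightarrow> Ck_at k p g \<Longrightarrow> g p \<noteq> 0 \<Longrightarrow> Ck_at k p (\<lambda>x. f x / g x)"
  unfolding divide_inverse by (intro Ck_at_mult Ck_at_inverse)

lemma Ck_at_vec_nth:
  fixes f :: "'a::euclidean_space \<Rightarrow> real^'n"
  shows "Ck_at k p f \<Longrightarrow> Ck_at k p (\<lambda>x. f x $ i)"
  using Ck_at_inner[OF _ Ck_at_const, of k p f "axis i 1"] by (simp add: inner_axis)

lemma Ck_at_vector_2:
  assumes "Ck_at k p f" "Ck_at k p g"
  shows "Ck_at k p (\<lambda>x. vector [f x, g x] :: real^2)"
proof -
  have "vector [f x, g x] = f x *\<^sub>R axis 1 1 + g x *\<^sub>R (axis 2 1 :: real^2)" for x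
    by (simp add: vec_eq_iff forall_2 axis_def)
  moreover have "Ck_at k p (\<lambda>x. f x *\<^sub>R axis 1 1 + g x *\<^sub>R (axis 2 1 :: real^2))"
    by (intro Ck_at_add Ck_at_scaleR assms Ck_at_const)
  ultimately show ?thesis by simp
qed

lemmas Ck_at_intros = Ck_at_const Ck_at_id Ck_at_add Ck_at_diff Ck_at_minus Ck_at_mult Ck_at_power
  Ck_at_scaleR Ck_at_inner Ck_at_vec_nth Ck_at_vector_2 Ck_at_divide Ck_at_inverse Ck_at_sum

lemma Ck_at_differentiable:
  assumes "Ck_at k p f" "1 \<le> k"
  shows "\<forall>\<^sub>F x in nhds p. f differentiable at x"
proof -
  obtain U where U: "open U" "p \<in> U" "Ck_on k U f"
    using assms(1) by (auto simp: Ck_at_def)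
  then have "higher_differentiable_on U f (Suc 0)"
    using assms(2) by (auto simp: Ck_on_def one_enat_def)
  then show ?thesis using U by (auto simp: eventually_nhds)
qed

section \<open>Smooth functions of one real variable\<close>

lemma higher_differentiable_on_real_SucI:
  fixes f :: "real \<Rightarrow> real"
  assumes "open U" "\<And>x. x \<in> U \<Longrightarrow> (f has_real_derivative f' x) (at x)" "higher_differentiable_on U f' n"
  shows "higher_differentiable_on U f (Suc n)"
proof (rule higher_differentiable_on_SucI[OF assms(1)])
  show "(f has_derivative (\<lambda>v. f' x * v)) (at x)" if "x \<in> U" for x
    using assms(2)[OF that] by (simp add: has_field_derivative_def)
  show "higher_differentiable_on U (\<lambda>x. f' x * v) n" for v
    by (rule higher_differentiable_on_bilinear[OF assms(1) bounded_bilinear_mult assms(3)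
          higher_differentiable_on_const[OF assms(1)]])
qed

lemma higher_differentiable_on_real_SucD:
  fixes f :: "real \<Rightarrow> real"
  assumes "open U" "higher_differentiable_on U f (Suc n)"
  shows "x \<in> U \<Longrightarrow> (f has_real_derivative deriv f x) (at x)"
    and "higher_differentiable_on U (deriv f) n"
proof -
  have d: "(f has_real_derivative deriv f x) (at x)" if "x \<in> U" for x
  proof -
    have "f differentiable (at x)" using assms(2) that by simp
    then show ?thesis
      by (simp add: DERIV_deriv_iff_real_differentiable)
  qed
  then show "x \<in> U \<Longrightarrow> (f has_real_derivative deriv f x) (at x)" .
  have eq: "frechet_derivative f (at x) 1 = deriv f x" if "x \<in> U" for x
    using fun_cong[OF frechet_derivative_at[OF d[OF that, unfolded has_field_derivative_def]], of 1]
    by simp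
  have "higher_differentiable_on U (\<lambda>x. frechet_derivative f (at x) 1) n"
    by (rule higher_differentiable_on_SucD(2)[OF assms(2)])
  then show "higher_differentiable_on U (deriv f) n"
    by (rule higher_differentiable_on_cong[OF assms(1), rotated]) (rule eq)
qed

text \<open>Smoothness by coinduction: a family in which every member has its derivative in the
  family again can be differentiated indefinitely. It serves for sine and cosine, for the functions
  \<open>exp_cutoff p\<close> and for the differentiated series in Borel's lemma.\<close>

lemma Ck_on_infty_coinduct:
  fixes f :: "real \<Rightarrow> real"
  assumes "open U" "f \<in> C"
    and step: "\<And>f. f \<in> C \<Longrightarrow> \<exists>f'\<in>C. \<forall>x\<in>U. (f has_real_derivative f' x) (at x)"
  shows "Ck_on \<infinity> U f"
proof -
  have "higher_differentiable_on U f n" if "f \<in> C" for f n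
    using that
  proof (induction n arbitrary: f)
    case 0
    then show ?case
      using step[OF 0] by (auto intro!: continuous_at_imp_continuous_on DERIV_isCont)
  next
    case (Suc n)
    obtain f' where "f' \<in> C" "\<forall>x\<in>U. (f has_real_derivative f' x) (at x)"
      using step[OF Suc.prems] by blast
    then show ?case
      using Suc.IH higher_differentiable_on_real_SucI[OF assms(1)] by blast
  qed
  then show ?thesis using assms(2) by (simp add: Ck_on_def)
qed

lemma Ck_on_infty_of_deriv:
  fixes f :: "real \<Rightarrow> real"
  assumes "open U" "\<And>x. x \<in> U \<Longrightarrow> (f has_real_derivative f' x) (at x)" "Ck_on \<infinity> U f'"
  shows "Ck_on \<infinity> U f"
proof -
  have "higher_differentiable_on U f (Suc n)" for n
    by (rule higher_differentiable_on_real_SucI[OF assms(1,2)]) (use assms(3) in \<open>simp_all add: Ck_on_def\<close>)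
  then show ?thesis
    unfolding Ck_on_def using higher_differentiable_on_pred by blast
qed

lemma Ck_on_infty_deriv:
  fixes f :: "real \<Rightarrow> real"
  assumes "open U" "Ck_on \<infinity> U f"
  shows "x \<in> U \<Longrightarrow> (f has_real_derivative deriv f x) (at x)" "Ck_on \<infinity> U (deriv f)"
proof -
  have h: "higher_differentiable_on U f (Suc n)" for n
    by (rule Ck_onD[OF assms(2)]) simp
  show "x \<in> U \<Longrightarrow> (f has_real_derivative deriv f x) (at x)"
    by (rule higher_differentiable_on_real_SucD(1)[OF assms(1) h])
  show "Ck_on \<infinity> U (deriv f)"
    unfolding Ck_on_def using higher_differentiable_on_real_SucD(2)[OF assms(1) h] by blast
qed

lemma Ck_on_infty_funpow_deriv:
  fixes f :: "real \<Rightarrow> real"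
  assumes "open U" "Ck_on \<infinity> U f"
  shows "Ck_on \<infinity> U ((deriv ^^ n) f)"
  by (induction n) (use assms Ck_on_infty_deriv(2) in auto)

lemma Ck_on_infty_funpow_deriv_has_derivative:
  fixes f :: "real \<Rightarrow> real"
  assumes "open U" "Ck_on \<infinity> U f" "x \<in> U"
  shows "((deriv ^^ n) f has_real_derivative (deriv ^^ Suc n) f x) (at x)"
  using Ck_on_infty_deriv(1)[OF assms(1) Ck_on_infty_funpow_deriv[OF assms(1,2)] assms(3)] by simp

lemma Ck_at_infty_of_deriv:
  fixes f :: "real \<Rightarrow> real"
  assumes "\<forall>\<^sub>F x in nhds p. (f has_real_derivative f' x) (at x)" "Ck_at \<infinity> p f'"
  shows "Ck_at \<infinity> p f"
proof -
  obtain U where U: "open U" "p \<in> U" "Ck_on \<infinity> U f'"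
    using assms(2) unfolding Ck_at_def by blast
  obtain V where V: "open V" "p \<in> V" "\<And>x. x \<in> V \<Longrightarrow> (f has_real_derivative f' x) (at x)"
    using assms(1) unfolding eventually_nhds by blast
  have "Ck_on \<infinity> (U \<inter> V) f"
    by (rule Ck_on_infty_of_deriv[OF _ _ Ck_on_subset[OF U(3)]]) (use U V in auto)
  then show ?thesis
    by (rule Ck_atI[rotated 2]) (use U V in auto)
qed

lemma Ck_at_infty_sin_cos: "Ck_at \<infinity> p (sin :: real \<Rightarrow> real)" "Ck_at \<infinity> p (cos :: real \<Rightarrow> real)"
proof -
  define C :: "(real \<Rightarrow> real) set" where "C = {sin, cos, \<lambda>x. - sin x, \<lambda>x. - cos x}"
  have *: "\<exists>f'\<in>C. \<forall>x\<in>UNIV. (f has_real_derivative f' x) (at x)" if "f \<in> C" for f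
    using that unfolding C_def by (auto intro!: derivative_eq_intros)
  have "Ck_on \<infinity> UNIV f" if "f \<in> C" for f
    by (rule Ck_on_infty_coinduct[OF open_UNIV that *])
  then show "Ck_at \<infinity> p (sin :: real \<Rightarrow> real)" "Ck_at \<infinity> p (cos :: real \<Rightarrow> real)"
    by (auto intro!: Ck_atI[OF open_UNIV] simp: C_def)
qed

lemma Ck_at_infty_arctan: "Ck_at \<infinity> p arctan"
proof (rule Ck_at_infty_of_deriv)
  show "\<forall>\<^sub>F x in nhds p. (arctan has_real_derivative inverse (1 + x\<^sup>2)) (at x)"
    by (intro always_eventually allI DERIV_arctan)
  show "Ck_at \<infinity> p (\<lambda>x. inverse (1 + x\<^sup>2))"
    by (intro Ck_at_intros) (metis add_pos_nonneg less_numeral_extra(1) less_numeral_extra(3) zero_le_power2)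
qed

subsection \<open>Taylor expansion of germs\<close>

lemma smooth_germD:
  fixes f :: "real \<Rightarrow> real"
  assumes "smooth_germ f"
  obtains r where "r > 0" "Ck_on \<infinity> (ball 0 r) f"
proof -
  obtain U where "open U" "0 \<in> U" "Ck_on \<infinity> U f"
    using assms unfolding smooth_germ_def by blast
  then obtain r where "r > 0" "ball 0 r \<subseteq> U"
    using open_contains_ball by blast
  then show thesis using that Ck_on_subset \<open>Ck_on \<infinity> U f\<close> by blast
qed

lemma smooth_germ_deriv:
  fixes f :: "real \<Rightarrow> real"
  assumes "smooth_germ f"
  shows "smooth_germ (deriv f)" "\<forall>\<^sub>F x in nhds 0. (f has_real_derivative deriv f x) (at x)"
proof -
  obtain U where U: "open U" "0 \<in> U" "Ck_on \<infinity> U f"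
    using assms unfolding smooth_germ_def by blast
  show "smooth_germ (deriv f)"
    unfolding smooth_germ_def using U Ck_on_infty_deriv(2) by blast
  show "\<forall>\<^sub>F x in nhds 0. (f has_real_derivative deriv f x) (at x)"
    unfolding eventually_nhds using U Ck_on_infty_deriv(1) by blast
qed

text \<open>Equality near \<open>p\<close> is equality near every point close to \<open>p\<close>,
  which is what differentiation at those points requires. Keeping the conclusion eventual allows
  iteration.\<close>

lemma eventually_deriv_eq:
  fixes f g :: "real \<Rightarrow> real"
  assumes "\<forall>\<^sub>F x in nhds p. f x = g x"
  shows "\<forall>\<^sub>F x in nhds p. deriv f x = deriv g x"
proof -
  have "\<forall>\<^sub>F x in nhds p. \<forall>\<^sub>F y in nhds x. f y = g y"
    using assms by (simp add: eventually_eventually)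
  then show ?thesis
    by (rule eventually_mono) (rule deriv_cong_ev, auto)
qed

lemma eventually_funpow_deriv_eq:
  fixes f g :: "real \<Rightarrow> real"
  assumes "\<forall>\<^sub>F x in nhds p. f x = g x"
  shows "\<forall>\<^sub>F x in nhds p. (deriv ^^ n) f x = (deriv ^^ n) g x"
  using assms by (induction n) (auto intro: eventually_deriv_eq)

definition taylor_coeff :: "(real \<Rightarrow> real) \<Rightarrow> nat \<Rightarrow> real" where
  "taylor_coeff f k = (deriv ^^ k) f 0 / fact k"

lemma taylor_coeff_cong:
  "\<forall>\<^sub>F x in nhds 0. f x = g x \<Longrightarrow> taylor_coeff f k = taylor_coeff g k"
  using eventually_nhds_x_imp_x[OF eventually_funpow_deriv_eq] unfolding taylor_coeff_def by metis

lemma isCont_imp_bigo_1: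
  fixes f :: "real \<Rightarrow> real"
  assumes "isCont f 0"
  shows "f \<in> O[nhds 0](\<lambda>_. 1)"
proof -
  have "(f \<longlongrightarrow> f 0) (nhds 0)"
    using assms by (simp add: tendsto_at_iff_tendsto_nhds isCont_def)
  then have "\<forall>\<^sub>F t in nhds 0. norm (f t - f 0) < 1"
    using tendstoD[of f "f 0" "nhds 0" 1] by (simp add: dist_norm)
  then show ?thesis
    by (intro bigoI[of _ "1 + norm (f 0)"]) (auto elim!: eventually_mono)
qed

text \<open>Lagrange's remainder together with the local boundedness of the n-th derivative. The
  filter is \<open>nhds 0\<close> and not \<open>at 0\<close>: the estimate includes the point 0, so
  for \<open>n > 0\<close> membership in this class forces the value 0 there.\<close>

lemma smooth_germ_taylor:
  fixes f :: "real \<Rightarrow> real"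
  assumes "smooth_germ f"
  shows "(\<lambda>t. f t - (\<Sum>k<n. taylor_coeff f k * t ^ k)) \<in> O[nhds 0](\<lambda>t. t ^ n)"
proof -
  obtain r where r: "r > 0" "Ck_on \<infinity> (ball 0 r) f"
    using smooth_germD[OF assms] .
  note d = Ck_on_infty_funpow_deriv_has_derivative[OF open_ball r(2)]
  have "isCont ((deriv ^^ n) f) 0"
    by (rule DERIV_isCont[OF d]) (use r in auto)
  then have "(deriv ^^ n) f \<in> O[nhds 0](\<lambda>_. 1)"
    by (rule isCont_imp_bigo_1)
  then obtain c where c: "\<forall>\<^sub>F t in nhds 0. norm ((deriv ^^ n) f t) \<le> c"
    by (auto elim!: landau_o.bigE)
  then obtain s where s: "s > 0" "\<And>t. \<bar>t\<bar> < s \<Longrightarrow> norm ((deriv ^^ n) f t) \<le> c"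
    unfolding eventually_nhds_metric by (auto simp: dist_norm)
  have "norm (f t - (\<Sum>k<n. taylor_coeff f k * t ^ k)) \<le> c / fact n * norm (t ^ n)"
    if "\<bar>t\<bar> < min r s" for t
  proof -
    have "\<forall>m u. m < n \<and> \<bar>u\<bar> \<le> \<bar>t\<bar> \<longrightarrow> ((deriv ^^ m) f has_real_derivative (deriv ^^ Suc m) f u) (at u)"
      using that by (auto intro!: d[simplified])
    then obtain u where u: "\<bar>u\<bar> \<le> \<bar>t\<bar>"
      "f t = (\<Sum>m<n. (deriv ^^ m) f 0 / fact m * t ^ m) + (deriv ^^ n) f u / fact n * t ^ n"
      using Maclaurin_bi_le[where diff = "\<lambda>n. (deriv ^^ n) f" and f = f and n = n and x = t] by auto
    have "norm ((deriv ^^ n) f u) \<le> c"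
      using s(2) u(1) that by simp
    then have "norm ((deriv ^^ n) f u / fact n * t ^ n) \<le> c / fact n * norm (t ^ n)"
      unfolding norm_mult norm_divide by (intro mult_right_mono) (auto simp: divide_right_mono)
    then show ?thesis
      using u(2) by (simp add: taylor_coeff_def)
  qed
  then show ?thesis
    by (intro bigoI[of _ "c / fact n"])
      (auto simp: eventually_nhds_metric dist_norm intro!: exI[of _ "min r s"] simp: r s)
qed

lemma bigo_power_le:
  assumes "m \<le> n"
  shows "(\<lambda>t::real. t ^ n) \<in> O[nhds 0](\<lambda>t. t ^ m)"
proof -
  have "\<forall>\<^sub>F t in nhds (0::real). \<bar>t\<bar> < 1"
    unfolding eventually_nhds_metric by (auto simp: dist_norm intro!: exI[of _ 1])
  then show ?thesis
    by (intro bigoI[of _ 1])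
      (auto elim!: eventually_mono simp: power_abs intro!: power_decreasing assms)
qed

text \<open>The coefficients below the top one vanish by induction. For the top one, dividing by
  \<open>t ^ n\<close> along positive \<open>t\<close> leaves
  \<open>\<bar>c n\<bar> \<le> C * t\<close>, and the bound tends to 0.\<close>

lemma polynomial_bigo_imp_0:
  assumes "(\<lambda>t::real. \<Sum>k<n. c k * t ^ k) \<in> O[nhds 0](\<lambda>t. t ^ n)" "k < n"
  shows "c k = 0"
  using assms
proof (induction n arbitrary: k)
  case (Suc n)
  have le: "(\<lambda>t. \<Sum>k<Suc n. c k * t ^ k) \<in> O[nhds 0](\<lambda>t::real. t ^ n)"
    using Suc.prems(1) bigo_power_le[of n "Suc n"] landau_o.big_trans by fastforce
  have "(\<lambda>t. (\<Sum>k<Suc n. c k * t ^ k) - c n * t ^ n) \<in> O[nhds 0](\<lambda>t::real. t ^ n)"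
    by (rule sum_in_bigo(2)[OF le]) simp
  then have z: "c k = 0" if "k < n" for k
    using Suc.IH that by simp
  then have "(\<lambda>t. c n * t ^ n) \<in> O[nhds 0](\<lambda>t::real. t ^ Suc n)"
    using Suc.prems(1) by simp
  then obtain C where C: "C > 0" "\<forall>\<^sub>F t in nhds 0. norm (c n * t ^ n) \<le> C * norm (t ^ Suc n)"
    by (rule landau_o.bigE)
  have "\<forall>\<^sub>F t in at_right 0. \<bar>c n\<bar> \<le> C * t"
  proof -
    have "\<forall>\<^sub>F t in at_right 0. norm (c n * t ^ n) \<le> C * norm (t ^ Suc n)"
      using C(2) by (simp add: eventually_nhds_conv_at eventually_at_split)
    with eventually_at_right_less[of 0] show ?thesis
      by eventually_elim (simp add: abs_mult mult.assoc[symmetric] mult_le_cancel_right)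
  qed
  moreover have "((\<lambda>t. C * t) \<longlongrightarrow> C * 0) (at_right 0)"
    by (intro tendsto_intros)
  ultimately have "\<bar>c n\<bar> \<le> C * 0"
    using tendsto_lowerbound trivial_limit_at_right_real by blast
  then show ?case
    using z Suc.prems(2) by (cases "k = n") auto
next
  case 0
  from 0(2) show ?case by simp
qed

text \<open>Coefficients of sums, products, powers and compositions are found below by comparing
  expansions up to \<open>O(t^n)\<close> through this uniqueness, so that no iterated derivative of
  a product or a composition has to be computed.\<close>

lemma taylor_coeff_unique:
  assumes "smooth_germ f" "(\<lambda>t. f t - (\<Sum>k<n. a k * t ^ k)) \<in> O[nhds 0](\<lambda>t. t ^ n)" "k < n"
  shows "taylor_coeff f k = a k"
proof -
  have eq: "(\<lambda>t. (f t - (\<Sum>k<n. a k * t ^ k)) - (f t - (\<Sum>k<n. taylor_coeff f k * t ^ k)))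
      = (\<lambda>t. \<Sum>k<n. (taylor_coeff f k - a k) * t ^ k)"
    by (rule ext) (simp add: sum_subtractf left_diff_distrib)
  have "taylor_coeff f k - a k = 0"
    using sum_in_bigo(2)[OF assms(2) smooth_germ_taylor[OF assms(1), of n]] assms(3)
    unfolding eq by (rule polynomial_bigo_imp_0)
  then show ?thesis by simp
qed

lemma smooth_germ_bigo_iff:
  assumes "smooth_germ f"
  shows "f \<in> O[nhds 0](\<lambda>t. t ^ n) \<longleftrightarrow> (\<forall>k<n. taylor_coeff f k = 0)"
proof
  assume "f \<in> O[nhds 0](\<lambda>t. t ^ n)"
  then show "\<forall>k<n. taylor_coeff f k = 0"
    using taylor_coeff_unique[OF assms, where a = "\<lambda>_. 0" and n = n] by simp
next
  assume "\<forall>k<n. taylor_coeff f k = 0"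
  then show "f \<in> O[nhds 0](\<lambda>t. t ^ n)"
    using smooth_germ_taylor[OF assms, of n] by simp
qed

lemma taylor_coeff_deriv: "taylor_coeff (deriv f) k = real (Suc k) * taylor_coeff f (Suc k)"
  by (simp add: taylor_coeff_def funpow_swap1 del: of_nat_Suc)

text \<open>A growth bound on a function says nothing about its derivative in general; for smooth
  germs both sides are statements about Taylor coefficients, shifted by one.\<close>

lemma smooth_germ_bigo_Suc_iff:
  assumes "smooth_germ f"
  shows "f \<in> O[nhds 0](\<lambda>t. t ^ Suc n) \<longleftrightarrow> f 0 = 0 \<and> deriv f \<in> O[nhds 0](\<lambda>t. t ^ n)"
  unfolding smooth_germ_bigo_iff[OF assms] smooth_germ_bigo_iff[OF smooth_germ_deriv(1)[OF assms]]
    taylor_coeff_deriv All_less_Suc2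
  by (simp add: taylor_coeff_def del: of_nat_Suc)

subsection \<open>Borel's lemma\<close>

text \<open>The function \<open>p(1/x) exp(-1/x)\<close>, continued by 0. The polynomial is carried
  along because differentiation maps this family to itself: it replaces \<open>p(X)\<close> by
  \<open>X^2 (p(X) - p'(X))\<close>.\<close>

definition exp_cutoff :: "real poly \<Rightarrow> real \<Rightarrow> real" where
  "exp_cutoff p x = (if x > 0 then poly p (inverse x) / exp (inverse x) else 0)"

lemma poly_div_exp_tendsto_0: "((\<lambda>x. poly p x / exp x) \<longlongrightarrow> 0) at_top" for p :: "real poly"
proof -
  have "((\<lambda>x. \<Sum>i\<le>degree p. coeff p i * (x ^ i / exp x)) \<longlongrightarrow> (\<Sum>i\<le>degree p. coeff p i * 0)) at_top"
    by (intro tendsto_intros tendsto_power_div_exp_0)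
  then show ?thesis
    by (simp add: poly_altdef sum_divide_distrib)
qed

lemma exp_cutoff_has_derivative:
  "(exp_cutoff p has_real_derivative exp_cutoff ([:0, 0, 1:] * (p - pderiv p)) x) (at x)"
proof -
  consider "x < 0" | "x = 0" | "x > 0" by linarith
  then show ?thesis
  proof cases
    case 1
    have "((\<lambda>x. 0) has_real_derivative 0) (at x)" by simp
    then have "(exp_cutoff p has_real_derivative 0) (at x)"
      by (rule has_field_derivative_transform_within_open[where S = "{..<0}"])
        (use 1 in \<open>auto simp: exp_cutoff_def\<close>)
    then show ?thesis using 1 by (simp add: exp_cutoff_def)
  next
    case 3
    have "((\<lambda>x. poly p (inverse x) / exp (inverse x)) has_real_derivative
        (poly p (inverse x) - poly (pderiv p) (inverse x)) * (inverse x * inverse x) / exp (inverse x)) (at x)"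
      using 3 by (auto intro!: derivative_eq_intros poly_DERIV[THEN DERIV_chain2] simp: field_simps power2_eq_square)
    then have "(exp_cutoff p has_real_derivative
        (poly p (inverse x) - poly (pderiv p) (inverse x)) * (inverse x * inverse x) / exp (inverse x)) (at x)"
      by (rule has_field_derivative_transform_within_open[where S = "{0<..}"])
        (use 3 in \<open>auto simp: exp_cutoff_def\<close>)
    then show ?thesis using 3 by (simp add: exp_cutoff_def algebra_simps)
  next
    \<comment> \<open>At 0 the difference quotient belongs to the same family, as division by
      \<open>h\<close> multiplies \<open>p\<close> by \<open>X\<close>; exponential decay beats
      every polynomial.\<close>
    case 2
    have "((\<lambda>h. poly ([:0, 1:] * p) (inverse h) / exp (inverse h)) \<longlongrightarrow> 0) (at_right 0)"
      by (rule filterlim_compose[OF poly_div_exp_tendsto_0 filterlim_inverse_at_top_right])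
    then have "((\<lambda>h. exp_cutoff p h / h) \<longlongrightarrow> 0) (at_right 0)"
      by (rule Lim_transform_eventually)
        (auto simp: exp_cutoff_def eventually_at_right_less field_simps intro!: eventually_mono[OF eventually_at_right_less[of 0]])
    moreover have "((\<lambda>h. exp_cutoff p h / h) \<longlongrightarrow> 0) (at_left 0)"
      by (rule Lim_transform_eventually[OF tendsto_const])
        (auto simp: exp_cutoff_def eventually_at_filter)
    ultimately have "((\<lambda>h. exp_cutoff p h / h) \<longlongrightarrow> 0) (at 0)"
      by (rule filterlim_split_at[rotated])
    then show ?thesis using 2 by (simp add: DERIV_def exp_cutoff_def)
  qed
qed

lemma Ck_on_UNIV_infty:
  fixes f :: "real \<Rightarrow> real"
  assumes "\<And>x. Ck_at \<infinity> x f"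
  shows "Ck_on \<infinity> UNIV f"
proof (rule Ck_on_infty_coinduct[where C = "{f. \<forall>x. Ck_at \<infinity> x f}"])
  fix f :: "real \<Rightarrow> real" assume f: "f \<in> {f. \<forall>x. Ck_at \<infinity> x f}"
  have "Ck_at \<infinity> x (deriv f) \<and> (f has_real_derivative deriv f x) (at x)" for x
  proof -
    obtain U where U: "open U" "x \<in> U" "Ck_on \<infinity> U f"
      using f unfolding Ck_at_def by blast
    then show ?thesis
      using Ck_on_infty_deriv[OF U(1,3)] Ck_atI[OF U(1,2)] by blast
  qed
  then show "\<exists>f'\<in>{f. \<forall>x. Ck_at \<infinity> x f}. \<forall>x\<in>UNIV. (f has_real_derivative f' x) (at x)"
    by blast
qed (use assms in auto)

lemma smooth_bump:
  obtains \<eta> :: "real \<Rightarrow> real" where "Ck_on \<infinity> UNIV \<eta>"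
    "\<And>x. \<bar>x\<bar> \<le> 1 \<Longrightarrow> \<eta> x = 1" "\<And>x. \<bar>x\<bar> \<ge> 2 \<Longrightarrow> \<eta> x = 0"
proof -
  define b where "b = exp_cutoff 1"
  have "Ck_on \<infinity> UNIV b"
    by (rule Ck_on_infty_coinduct[where C = "range exp_cutoff"])
      (auto simp: b_def intro!: exp_cutoff_has_derivative)
  then have b: "Ck_at \<infinity> x b" for x
    by (rule Ck_atI[rotated 2]) auto
  have pos: "b y > 0" if "y > 0" for y using that by (simp add: b_def exp_cutoff_def)
  have b0: "b y = 0" if "y \<le> 0" for y using that by (simp add: b_def exp_cutoff_def)
  have nn: "b y \<ge> 0" for y using pos[of y] b0[of y] by (cases "y > 0") auto
  \<comment> \<open>A smooth step, 0 for \<open>y \<le> 0\<close> and 1 for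
    \<open>y \<ge> 1\<close>; the denominator is positive since \<open>y\<close> and
    \<open>1 - y\<close> are not both nonpositive. The product of a rising and a falling step is
    then the bump.\<close>
  define h where "h y = b y / (b y + b (1 - y))" for y
  have den: "b y + b (1 - y) \<noteq> 0" for y
    using pos[of y] pos[of "1 - y"] nn[of y] nn[of "1 - y"] by (cases "y > 0") (auto simp: add_nonneg_pos add_pos_nonneg)
  have h: "Ck_at \<infinity> x h" for x
    unfolding h_def
    by (intro Ck_at_divide Ck_at_add b Ck_at_compose[of _ "\<lambda>y. 1 - y" _ b] Ck_at_diff Ck_at_const Ck_at_id den)
  define \<eta> where "\<eta> x = h (2 + x) * h (2 - x)" for x
  have "Ck_at \<infinity> x \<eta>" for x
    unfolding \<eta>_def
    by (intro Ck_at_mult Ck_at_compose[of _ "\<lambda>y. 2 + y" _ h] Ck_at_compose[of _ "\<lambda>y. 2 - y" _ h] h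
        Ck_at_diff Ck_at_add Ck_at_const Ck_at_id)
  then have "Ck_on \<infinity> UNIV \<eta>" by (rule Ck_on_UNIV_infty)
  moreover have "h y = 1" if "y \<ge> 1" for y
    using that b0[of "1 - y"] pos[of y] by (simp add: h_def)
  then have "\<eta> x = 1" if "\<bar>x\<bar> \<le> 1" for x using that by (simp add: \<eta>_def)
  moreover have "h y = 0" if "y \<le> 0" for y using that b0[of y] by (simp add: h_def)
  then have "\<eta> x = 0" if "\<bar>x\<bar> \<ge> 2" for x using that by (cases "x > 0") (auto simp: \<eta>_def)
  ultimately show thesis using that by blast
qed

lemma taylor_coeff_power: "taylor_coeff (\<lambda>t. t ^ n) k = (if k = n then 1 else 0)"
proof (rule taylor_coeff_unique)
  show "smooth_germ (\<lambda>t::real. t ^ n)"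
    unfolding smooth_germ_iff_Ck_at by (intro Ck_at_intros)
  have "(\<Sum>k<Suc (max n k). (if k = n then 1 else 0) * t ^ k) = t ^ n" for t :: real
    by (subst sum.mono_neutral_right[where S = "{n}"]) auto
  then show "(\<lambda>t. t ^ n - (\<Sum>k<Suc (max n k). (if k = n then 1 else 0) * t ^ k))
      \<in> O[nhds 0](\<lambda>t::real. t ^ Suc (max n k))"
    by simp
qed simp

lemma compactly_supported_derivs_bounded:
  fixes f :: "real \<Rightarrow> real"
  assumes "Ck_on \<infinity> UNIV f" "\<And>x. \<bar>x\<bar> \<ge> 2 \<Longrightarrow> f x = 0"
  shows "\<exists>M. \<forall>x. \<bar>(deriv ^^ k) f x\<bar> \<le> M"
proof -
  have c: "continuous_on UNIV ((deriv ^^ k) f)"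
    using Ck_on_infty_funpow_deriv_has_derivative[OF open_UNIV assms(1)]
    by (auto intro!: continuous_at_imp_continuous_on DERIV_isCont simp del: funpow.simps)
  have "compact ((deriv ^^ k) f ` cball 0 2)"
    by (intro compact_continuous_image continuous_on_subset[OF c]) auto
  from compact_imp_bounded[OF this] obtain B where "\<forall>y\<in>(deriv ^^ k) f ` cball 0 2. norm y \<le> B"
    unfolding bounded_iff by (rule exE)
  then have B: "\<bar>(deriv ^^ k) f x\<bar> \<le> B" if "\<bar>x\<bar> \<le> 2" for x
    using that by (auto simp: dist_norm)
  have z: "(deriv ^^ k) (\<lambda>_. 0 :: real) = (\<lambda>_. 0)"
    by (induction k) auto
  have "(deriv ^^ k) f x = 0" if "\<bar>x\<bar> > 2" for x
  proof -
    have "\<forall>\<^sub>F y in nhds x. \<bar>y\<bar> > 2"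
      by (rule eventually_nhds[THEN iffD2, OF exI[of _ "{y. \<bar>y\<bar> > 2}"]])
        (use that in \<open>auto intro!: open_Collect_less continuous_intros\<close>)
    then have "\<forall>\<^sub>F y in nhds x. f y = 0"
      by eventually_elim (simp add: assms(2))
    from eventually_nhds_x_imp_x[OF eventually_funpow_deriv_eq[OF this, of k]] show ?thesis
      by (simp add: z)
  qed
  then have "\<bar>(deriv ^^ k) f x\<bar> \<le> max B 0" for x
    using B[of x] by (cases "\<bar>x\<bar> \<le> 2") (auto simp: not_le le_max_iff_disj)
  then show ?thesis by blast
qed

text \<open>The n-th summand is the cut-off monomial \<open>a n * x ^ n * \<eta> (L n * x)\<close>,
  supported in \<open>\<bar>x\<bar> \<le> 2 / L n\<close>. A large scale \<open>L n\<close> makes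
  its derivatives of order below \<open>n\<close> small, so the series may be differentiated term by
  term. Near 0 the cut-off is 1, so only the k-th summand contributes to the k-th derivative at
  0.\<close>

theorem Borel_lemma:
  obtains f where "Ck_on \<infinity> UNIV f" "\<And>n. taylor_coeff f n = a n"
proof -
  obtain \<eta> :: "real \<Rightarrow> real" where \<eta>: "Ck_on \<infinity> UNIV \<eta>"
    "\<And>x. \<bar>x\<bar> \<le> 1 \<Longrightarrow> \<eta> x = 1" "\<And>x. \<bar>x\<bar> \<ge> 2 \<Longrightarrow> \<eta> x = 0"
    using smooth_bump by blast
  define \<psi> where "\<psi> n y = y ^ n * \<eta> y" for n y
  define D where "D n k = (deriv ^^ k) (\<psi> n)" for n k
  have "Ck_at \<infinity> x \<eta>" for x by (rule Ck_atI[OF _ _ \<eta>(1)]) auto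
  then have \<psi>: "Ck_on \<infinity> UNIV (\<psi> n)" for n
    unfolding \<psi>_def by (intro Ck_on_UNIV_infty Ck_at_intros)
  have dD: "(D n k has_real_derivative D n (Suc k) x) (at x)" for n k x
    using Ck_on_infty_funpow_deriv_has_derivative[OF open_UNIV \<psi>] unfolding D_def by blast
  have D0: "D n k 0 = (if k = n then fact k else 0)" for n k
  proof -
    have "\<forall>\<^sub>F x in nhds 0. \<psi> n x = x ^ n"
      unfolding eventually_nhds_metric by (rule exI[of _ 1]) (auto simp: \<psi>_def \<eta>(2) dist_norm)
    from taylor_coeff_cong[OF this, of k] have "taylor_coeff (\<psi> n) k = (if k = n then 1 else 0)"
      by (simp add: taylor_coeff_power)
    then show ?thesis by (simp add: taylor_coeff_def D_def field_simps split: if_splits)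
  qed
  have "\<forall>n k. \<exists>M. \<forall>x. \<bar>D n k x\<bar> \<le> M"
    unfolding D_def by (intro allI compactly_supported_derivs_bounded \<psi>) (simp add: \<psi>_def \<eta>(3))
  then obtain M where M: "\<And>n k x. \<bar>D n k x\<bar> \<le> M n k" by metis
  have M0: "M n k \<ge> 0" for n k using M[of n k 0] by linarith
  \<comment> \<open>Two demands are met at once: \<open>L n \<ge> 1\<close>, which gives
    \<open>L n ^ k / L n ^ n \<le> 1 / L n\<close> for \<open>k < n\<close>, and
    \<open>L n \<ge> 2 ^ n * \<bar>a n\<bar> * M n k\<close> for every \<open>k < n\<close>.\<close>
  define L where "L n = 1 + 2 ^ n * \<bar>a n\<bar> * (\<Sum>k<n. M n k)" for n
  have L1: "L n \<ge> 1" for n by (simp add: L_def M0 sum_nonneg)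
  have L2: "2 ^ n * (\<bar>a n\<bar> * M n k) \<le> L n" if "k < n" for n k
  proof -
    have "M n k \<le> (\<Sum>k<n. M n k)"
      using that by (intro member_le_sum) (auto simp: M0)
    then have "2 ^ n * \<bar>a n\<bar> * M n k \<le> 2 ^ n * \<bar>a n\<bar> * (\<Sum>k<n. M n k)"
      by (intro mult_left_mono) auto
    then show ?thesis by (simp only: L_def mult.assoc)
  qed
  \<comment> \<open>\<open>F k n\<close> is the k-th derivative of the n-th summand.\<close>
  define F where "F k n x = a n * (L n ^ k / L n ^ n) * D n k (L n * x)" for k n x
  have dF: "(F k n has_real_derivative F (Suc k) n x) (at x)" for k n x
  proof -
    have "((\<lambda>x. D n k (L n * x)) has_real_derivative D n (Suc k) (L n * x) * L n) (at x)"
      by (rule DERIV_chain2[OF dD]) (auto intro!: derivative_eq_intros)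
    from DERIV_cmult[OF this, of "a n * (L n ^ k / L n ^ n)"] show ?thesis
      unfolding F_def by (simp add: algebra_simps)
  qed
  have bound: "norm (F k n x) \<le> (1 / 2) ^ n" if "k < n" for k n x
  proof -
    have "L n ^ Suc k \<le> L n ^ n" by (intro power_increasing L1) (use that in auto)
    then have q: "L n ^ k / L n ^ n \<le> 1 / L n"
      using L1[of n] by (simp add: field_simps)
    have "norm (F k n x) = (L n ^ k / L n ^ n) * (\<bar>a n\<bar> * \<bar>D n k (L n * x)\<bar>)"
      using L1[of n] by (simp add: F_def abs_mult)
    also have "\<dots> \<le> 1 / L n * (\<bar>a n\<bar> * M n k)"
      by (intro mult_mono q M) (use L1[of n] in auto)
    also have "\<dots> \<le> (1 / 2) ^ n"
      using L2[OF that] L1[of n] by (simp add: field_simps)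
    finally show ?thesis .
  qed
  define g where "g k x = (\<Sum>n. F k n x)" for k x
  \<comment> \<open>For a given order \<open>k\<close> the geometric bound is available only for
    \<open>n > k\<close>, hence the eventual form of the Weierstrass test.\<close>
  have ev: "\<forall>\<^sub>F n in sequentially. \<forall>x\<in>UNIV. norm (F k n x) \<le> (1 / 2) ^ n" for k
    using eventually_gt_at_top[of k] by eventually_elim (use bound in blast)
  have summ: "summable (\<lambda>n. (1 / 2 :: real) ^ n)" by (intro summable_geometric) auto
  have uc: "uniformly_convergent_on UNIV (\<lambda>N x. \<Sum>n<N. F k n x)" for k
    using Weierstrass_m_test_ev[OF ev summ] uniformly_convergent_on_def by blast
  have sF: "summable (\<lambda>n. F k n x)" for k x
    by (rule summable_comparison_test_ev[OF _ summ]) (use ev[of k] in \<open>auto elim: eventually_mono\<close>)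
  have dg: "(g k has_real_derivative g (Suc k) x) (at x)" for k x
    unfolding g_def
    by (rule has_field_derivative_series'(2)[where S = UNIV and f = "F k" and f' = "F (Suc k)" and ?x0.0 = 0])
      (simp_all add: uc sF dF)
  have gk: "(deriv ^^ k) (g 0) = g k" for k
    by (induction k) (auto intro!: DERIV_imp_deriv dg)
  have "Ck_on \<infinity> UNIV (g 0)"
    by (rule Ck_on_infty_coinduct[where C = "range g"]) (auto intro!: dg)
  moreover have "taylor_coeff (g 0) k = a k" for k
  proof -
    have "F k n 0 = (if n = k then a n * fact n else 0)" for n
      using L1[of n] by (auto simp: F_def D0)
    then have "(\<lambda>n. F k n 0) sums (a k * fact k)"
      using sums_single[of k "\<lambda>n. a n * fact n"] by simp
    then show ?thesis by (simp add: taylor_coeff_def gk g_def sums_iff)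
  qed
  ultimately show thesis using that by blast
qed

subsection \<open>Flat germs\<close>

definition flat_germ :: "(real \<Rightarrow> real) \<Rightarrow> bool" where
  "flat_germ r \<longleftrightarrow> smooth_germ r \<and> (\<forall>n. r \<in> O[nhds 0](\<lambda>t. t ^ n))"

lemma flat_germ_iff: "flat_germ r \<longleftrightarrow> smooth_germ r \<and> (\<forall>n. taylor_coeff r n = 0)"
  unfolding flat_germ_def using smooth_germ_bigo_iff by blast

text \<open>The function \<open>r(t) / t^k\<close>, \<open>t > 0\<close>, in the variable
  \<open>s = t^m\<close>. The division by \<open>t^k\<close> is built in because each
  differentiation in \<open>s\<close> produces further negative powers of \<open>t\<close>; a flat
  \<open>r\<close> absorbs them all, and then the value 0 for \<open>s \<le> 0\<close> is a smooth
  continuation.\<close>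

definition root_pullback :: "nat \<Rightarrow> (real \<Rightarrow> real) \<Rightarrow> nat \<Rightarrow> real \<Rightarrow> real" where
  "root_pullback m r k s = (if s > 0 then r (root m s) / root m s ^ k else 0)"

lemma root_pullback_power:
  "m > 0 \<Longrightarrow> t > 0 \<Longrightarrow> root_pullback m r k (t ^ m) = r t / t ^ k"
  by (simp add: root_pullback_def real_root_power_cancel)

text \<open>A flat \<open>r\<close> is \<open>O(t^(k + m n))\<close>, and division by
  \<open>t^k\<close> leaves \<open>(t^m)^n = s^n\<close>.\<close>

lemma root_pullback_bigo:
  assumes "m > 0" "flat_germ r"
  shows "root_pullback m r k \<in> O[nhds 0](\<lambda>s. s ^ n)"
proof -
  have "r \<in> O[nhds 0](\<lambda>t. t ^ (k + m * n))"
    using assms(2) by (simp add: flat_germ_def)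
  then obtain c where c: "c > 0" "\<forall>\<^sub>F t in nhds 0. norm (r t) \<le> c * norm (t ^ (k + m * n))"
    by (rule landau_o.bigE)
  then obtain d where d: "d > 0" "\<And>t. \<bar>t\<bar> < d \<Longrightarrow> \<bar>r t\<bar> \<le> c * \<bar>t ^ (k + m * n)\<bar>"
    unfolding eventually_nhds_metric by (auto simp: dist_norm)
  have "norm (root_pullback m r k s) \<le> c * norm (s ^ n)" if "\<bar>s\<bar> < d ^ m" for s
  proof (cases "s > 0")
    case True
    define t where "t = root m s"
    have t: "t > 0" "s = t ^ m" using True assms(1) by (auto simp: t_def)
    have "t < d"
      using that t d(1) assms(1) by (metis abs_of_pos power_less_imp_less_base less_imp_le True)
    have "\<bar>r t\<bar> \<le> c * (t ^ k * (t ^ m) ^ n)"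
      using d(2)[of t] t(1) \<open>t < d\<close> by (simp add: power_add power_mult)
    then have "\<bar>r t\<bar> / t ^ k \<le> c * (t ^ m) ^ n"
      using t(1) by (simp add: pos_divide_le_eq mult_ac)
    then show ?thesis
      using t assms(1) by (simp add: root_pullback_power)
  qed (use c in \<open>auto simp: root_pullback_def\<close>)
  moreover have "d ^ m > 0" using d(1) by simp
  ultimately show ?thesis
    by (intro bigoI[of _ c]) (auto simp: eventually_nhds_metric dist_norm)
qed

lemma bigo_square_imp_DERIV_0:
  fixes f :: "real \<Rightarrow> real"
  assumes "f \<in> O[nhds 0](\<lambda>t. t ^ 2)"
  shows "(f has_real_derivative 0) (at 0)"
proof -
  obtain c where c: "c > 0" "\<forall>\<^sub>F t in nhds 0. norm (f t) \<le> c * norm (t ^ 2)"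
    using assms by (rule landau_o.bigE)
  have f0: "f 0 = 0" using eventually_nhds_x_imp_x[OF c(2)] by simp
  have "((\<lambda>h. f h / h) \<longlongrightarrow> 0) (at 0)"
  proof (rule Lim_null_comparison)
    show "\<forall>\<^sub>F h in at 0. norm (f h / h) \<le> c * \<bar>h\<bar>"
      using c(2) by (auto simp: eventually_at_filter field_simps power2_eq_square elim!: eventually_mono)
    show "((\<lambda>h. c * \<bar>h\<bar>) \<longlongrightarrow> 0) (at 0)"
      by (auto intro!: tendsto_eq_intros)
  qed
  then show ?thesis by (simp add: DERIV_def f0)
qed

text \<open>Since \<open>d/ds = (1 / (m t^(m-1))) d/dt\<close>, the derivative is again a
  combination of pullbacks, one of \<open>deriv r\<close> and one of \<open>r\<close>. At
  \<open>s = 0\<close> flatness gives a quadratic bound and hence derivative 0.\<close>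

lemma root_pullback_has_derivative:
  assumes "m > 0" "Ck_on \<infinity> (ball 0 d) r" "flat_germ r" "d > 0" "\<bar>s\<bar> < d ^ m"
  shows "(root_pullback m r k has_real_derivative
    (1 / m) * root_pullback m (deriv r) (k + m - 1) s + (- (k / m)) * root_pullback m r (k + m) s) (at s)"
proof -
  consider "s < 0" | "s = 0" | "s > 0" by linarith
  then show ?thesis
  proof cases
    case 1
    have "((\<lambda>x. 0) has_real_derivative 0) (at s)" by simp
    then have "(root_pullback m r k has_real_derivative 0) (at s)"
      by (rule has_field_derivative_transform_within_open[where S = "{..<0}"])
        (use 1 in \<open>auto simp: root_pullback_def\<close>)
    then show ?thesis using 1 by (simp add: root_pullback_def)
  next
    case 2
    then show ?thesis
      using bigo_square_imp_DERIV_0[OF root_pullback_bigo[OF assms(1,3)]]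
      by (simp add: root_pullback_def)
  next
    case 3
    define t where "t = root m s"
    have t: "t > 0" "s = t ^ m" using 3 assms(1) by (auto simp: t_def)
    have "t < d"
      using assms(1,4,5) t 3 by (metis abs_of_pos power_less_imp_less_base less_imp_le)
    then have dr: "(r has_real_derivative deriv r t) (at t)"
      using Ck_on_infty_deriv(1)[OF open_ball assms(2)] t(1) by simp
    have droot: "(root m has_real_derivative inverse (m * t ^ (m - Suc 0))) (at s)"
      using DERIV_real_root[OF assms(1) 3] by (simp add: t_def)
    have "((\<lambda>s. r (root m s) / root m s ^ k) has_real_derivative
       ((deriv r t * inverse (m * t ^ (m - Suc 0))) * t ^ k - r t * (real k * inverse (m * t ^ (m - Suc 0)) * t ^ (k - Suc 0)))
          / (t ^ k * t ^ k)) (at s)"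
      using DERIV_divide[OF DERIV_chain2[OF dr[unfolded t_def] droot] DERIV_power[OF droot, of k]] t(1)
      by (simp add: t_def mult_ac)
    also have "((deriv r t * inverse (m * t ^ (m - Suc 0))) * t ^ k - r t * (real k * inverse (m * t ^ (m - Suc 0)) * t ^ (k - Suc 0)))
          / (t ^ k * t ^ k) = (1 / m) * (deriv r t / t ^ (k + m - 1)) + (- (k / m)) * (r t / t ^ (k + m))"
    proof -
      obtain j where j: "m = Suc j" using assms(1) by (cases m) auto
      show ?thesis
      proof (cases k)
        case (Suc i)
        have pw: "t ^ (k + m - 1) = t * t ^ i * t ^ j" "t ^ (k + m) = t * t ^ i * (t * t ^ j)"
          "t ^ k = t * t ^ i" "t ^ (m - Suc 0) = t ^ j" "t ^ (k - Suc 0) = t ^ i"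
          by (simp_all add: Suc j power_add)
        have *: "((A * inverse (q * w)) * (t * p) - B * (c * inverse (q * w) * p)) / ((t * p) * (t * p))
            = (1 / q) * (A / (t * p * w)) + (- (c / q)) * (B / (t * p * (t * w)))"
          if "q \<noteq> 0" "w \<noteq> 0" "p \<noteq> 0" for A B c q w p :: real
          using that t(1) by (simp add: divide_simps) (simp add: algebra_simps)
        show ?thesis
          unfolding pw by (rule *) (use t(1) assms(1) in auto)
      qed (use t(1) j in \<open>simp add: field_simps\<close>)
    qed
    finally have "(root_pullback m r k has_real_derivative
        (1 / m) * (deriv r t / t ^ (k + m - 1)) + (- (k / m)) * (r t / t ^ (k + m))) (at s)"
      by (rule has_field_derivative_transform_within_open[where S = "{0<..}"])
        (use 3 in \<open>auto simp: root_pullback_def\<close>)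
    then show ?thesis using 3 by (simp add: root_pullback_def t_def)
  qed
qed

lemma flat_germ_root_pullback:
  assumes "m > 0" "flat_germ r"
  shows "flat_germ (root_pullback m r k)"
proof -
  obtain d where d: "d > 0" "Ck_on \<infinity> (ball 0 d) r"
    using assms(2) smooth_germD unfolding flat_germ_def by blast
  \<comment> \<open>The induction runs over all flat \<open>r\<close> that are smooth on one fixed
    ball and over all exponents \<open>k\<close>, because the derivative of a pullback involves two
    other such pairs.\<close>
  have "higher_differentiable_on (ball 0 (d ^ m)) (root_pullback m r k) n"
    if "Ck_on \<infinity> (ball 0 d) r" "flat_germ r" for n r k
    using that
  proof (induction n arbitrary: r k)
    case 0
    show ?case
      using root_pullback_has_derivative[OF assms(1) 0 d(1)]
      by (force intro!: continuous_at_imp_continuous_on DERIV_isCont simp: dist_norm)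
  next
    case (Suc n)
    have r': "Ck_on \<infinity> (ball 0 d) (deriv r)"
      using Suc.prems(1) by (rule Ck_on_infty_deriv(2)[OF open_ball])
    have "flat_germ (deriv r)"
      using Suc.prems(2) unfolding flat_germ_iff taylor_coeff_deriv by (auto intro: smooth_germ_deriv)
    note hd = Suc.IH[OF r' this, of "k + m - 1"] Suc.IH[OF Suc.prems, of "k + m"]
    note c = higher_differentiable_on_const[OF open_ball]
    show ?case
    proof (rule higher_differentiable_on_real_SucI[OF open_ball])
      show "(root_pullback m r k has_real_derivative (1 / m) * root_pullback m (deriv r) (k + m - 1) s
          + (- (k / m)) * root_pullback m r (k + m) s) (at s)" if "s \<in> ball 0 (d ^ m)" for s
        using that by (intro root_pullback_has_derivative[OF assms(1) Suc.prems d(1)]) simp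
      show "higher_differentiable_on (ball 0 (d ^ m)) (\<lambda>s. (1 / m) * root_pullback m (deriv r) (k + m - 1) s
          + (- (k / m)) * root_pullback m r (k + m) s) n"
        by (rule higher_differentiable_on_add[OF open_ball
              higher_differentiable_on_bilinear[OF open_ball bounded_bilinear_mult c hd(1)]
              higher_differentiable_on_bilinear[OF open_ball bounded_bilinear_mult c hd(2)]])
    qed
  qed
  then have "Ck_on \<infinity> (ball 0 (d ^ m)) (root_pullback m r k)"
    using d(2) assms(2) unfolding Ck_on_def by blast
  moreover have "d ^ m > 0" using d(1) by simp
  ultimately have "smooth_germ (root_pullback m r k)"
    unfolding smooth_germ_def using open_ball centre_in_ball by blast
  then show ?thesis
    unfolding flat_germ_def using root_pullback_bigo[OF assms] by blast
qed

subsection \<open>Division with respect to a power of the parameter\<close>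

lemma bigo_power_compose:
  assumes "f \<in> O[nhds 0](\<lambda>s::real. s ^ n)" "m > 0"
  shows "(\<lambda>t. f (t ^ m)) \<in> O[nhds 0](\<lambda>t::real. t ^ (m * n))"
proof -
  have "filterlim (\<lambda>t::real. t ^ m) (nhds 0) (nhds 0)"
    using tendsto_power[of "\<lambda>x. x" "0::real" "nhds 0" m, OF filterlim_ident] assms(2)
    by (simp add: power_0_left)
  from landau_o.big.compose[OF assms(1) this] show ?thesis
    by (simp add: power_mult)
qed

lemma bigo_uminus_compose:
  assumes "f \<in> O[nhds 0](\<lambda>s::real. s ^ n)"
  shows "(\<lambda>t. f (- t)) \<in> O[nhds 0](\<lambda>t::real. t ^ n)"
proof -
  have "filterlim (\<lambda>t::real. - t) (nhds 0) (nhds 0)"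
    using tendsto_minus[OF filterlim_ident, of "0 :: real"] by simp
  from landau_o.big.compose[OF assms this]
  have "(\<lambda>t. f (- t)) \<in> O[nhds 0](\<lambda>t::real. (- t) ^ n)" .
  also have "(\<lambda>t::real. (- t) ^ n) \<in> O[nhds 0](\<lambda>t. t ^ n)"
    by (intro bigoI[of _ 1] always_eventually allI) (simp add: power_abs)
  finally show ?thesis .
qed

section \<open>Sums, multiples and the substitution of a power of the parameter\<close>

lemma smooth_germ_compose:
  fixes f g :: "real \<Rightarrow> real"
  assumes "smooth_germ g" "smooth_germ f" "f 0 = 0"
  shows "smooth_germ (\<lambda>t. g (f t))"
  unfolding smooth_germ_iff_Ck_at
  by (rule Ck_at_compose[where f = f and g = g]) (use assms in \<open>simp_all add: smooth_germ_iff_Ck_at\<close>)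

lemma smooth_germ_cmult:
  fixes f :: "real \<Rightarrow> real"
  shows "smooth_germ f \<Longrightarrow> smooth_germ (\<lambda>t. c * f t)"
  unfolding smooth_germ_iff_Ck_at by (intro Ck_at_mult Ck_at_const)

lemma smooth_germ_add:
  fixes f g :: "real \<Rightarrow> real"
  shows "smooth_germ f \<Longrightarrow> smooth_germ g \<Longrightarrow> smooth_germ (\<lambda>t. f t + g t)"
  unfolding smooth_germ_iff_Ck_at by (rule Ck_at_add)

lemma smooth_germ_sum:
  fixes f :: "'i \<Rightarrow> real \<Rightarrow> real"
  shows "(\<And>i. i \<in> I \<Longrightarrow> smooth_germ (f i)) \<Longrightarrow> smooth_germ (\<lambda>t. \<Sum>i\<in>I. f i t)"
  unfolding smooth_germ_iff_Ck_at by (rule Ck_at_sum)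

lemma smooth_germ_const: "smooth_germ (\<lambda>t. c :: real)"
  unfolding smooth_germ_iff_Ck_at by (rule Ck_at_const)

lemma taylor_coeff_add:
  assumes "smooth_germ f" "smooth_germ g"
  shows "taylor_coeff (\<lambda>t. f t + g t) k = taylor_coeff f k + taylor_coeff g k"
proof (rule taylor_coeff_unique[OF smooth_germ_add[OF assms], where n = "Suc k"
      and a = "\<lambda>k. taylor_coeff f k + taylor_coeff g k"])
  have "(\<lambda>t. (f t - (\<Sum>j<Suc k. taylor_coeff f j * t ^ j)) + (g t - (\<Sum>j<Suc k. taylor_coeff g j * t ^ j)))
      \<in> O[nhds 0](\<lambda>t. t ^ Suc k)"
    by (rule sum_in_bigo(1)[OF smooth_germ_taylor[OF assms(1)] smooth_germ_taylor[OF assms(2)]])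
  moreover have "(f t - (\<Sum>j<Suc k. taylor_coeff f j * t ^ j)) + (g t - (\<Sum>j<Suc k. taylor_coeff g j * t ^ j))
      = f t + g t - (\<Sum>j<Suc k. (taylor_coeff f j + taylor_coeff g j) * t ^ j)" for t
    by (simp only: distrib_right sum.distrib)
  ultimately show "(\<lambda>t. f t + g t - (\<Sum>j<Suc k. (taylor_coeff f j + taylor_coeff g j) * t ^ j))
      \<in> O[nhds 0](\<lambda>t. t ^ Suc k)"
    by (simp only:)
qed simp

lemma taylor_coeff_cmult:
  assumes "smooth_germ f"
  shows "taylor_coeff (\<lambda>t. c * f t) k = c * taylor_coeff f k"
proof (rule taylor_coeff_unique[OF smooth_germ_cmult[OF assms], where n = "Suc k"
      and a = "\<lambda>k. c * taylor_coeff f k"])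
  have "(\<lambda>t. c * (f t - (\<Sum>j<Suc k. taylor_coeff f j * t ^ j))) \<in> O[nhds 0](\<lambda>t. t ^ Suc k)"
    using landau_o.big.mult[OF bigo_const[of c] smooth_germ_taylor[OF assms, of "Suc k"]]
    by (simp only: mult_1_left)
  moreover have "c * (f t - (\<Sum>j<Suc k. taylor_coeff f j * t ^ j))
      = c * f t - (\<Sum>j<Suc k. (c * taylor_coeff f j) * t ^ j)" for t
    by (simp only: right_diff_distrib sum_distrib_left mult.assoc)
  ultimately show "(\<lambda>t. c * f t - (\<Sum>j<Suc k. (c * taylor_coeff f j) * t ^ j)) \<in> O[nhds 0](\<lambda>t. t ^ Suc k)"
    by (simp only:)
qed simp

lemma taylor_coeff_0: "taylor_coeff f 0 = f 0"
  by (simp add: taylor_coeff_def)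

lemma taylor_coeff_zero: "taylor_coeff (\<lambda>t. 0) k = 0"
  using taylor_coeff_cmult[OF smooth_germ_const[of 0], of 0] by simp

lemma taylor_coeff_sum:
  assumes "\<And>i. i \<in> I \<Longrightarrow> smooth_germ (f i)"
  shows "taylor_coeff (\<lambda>t. \<Sum>i\<in>I. f i t) k = (\<Sum>i\<in>I. taylor_coeff (f i) k)"
  using assms
proof (induction I rule: infinite_finite_induct)
  case (insert i I)
  then show ?case
    using taylor_coeff_add[of "f i" "\<lambda>t. \<Sum>i\<in>I. f i t" k] smooth_germ_sum[of I f] by simp
qed (simp_all add: taylor_coeff_zero)

lemma smooth_germ_monomial_mult_compose_power:
  assumes "smooth_germ b" "m > 0"
  shows "smooth_germ (\<lambda>t. t ^ e * b (t ^ m))"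
proof -
  have "smooth_germ (\<lambda>t. b (t ^ m))"
    by (rule smooth_germ_compose[where f = "\<lambda>t. t ^ m", OF assms(1)])
      (use assms(2) in \<open>simp_all add: smooth_germ_iff_Ck_at Ck_at_power[OF Ck_at_id] power_0_left\<close>)
  then show ?thesis
    unfolding smooth_germ_iff_Ck_at by (intro Ck_at_intros)
qed

lemma taylor_coeff_monomial_mult_compose_power:
  assumes "smooth_germ b" "m > 0"
  shows "taylor_coeff (\<lambda>t. t ^ e * b (t ^ m)) n =
    (if e \<le> n \<and> m dvd n - e then taylor_coeff b ((n - e) div m) else 0)"
proof -
  \<comment> \<open>With \<open>Suc n\<close> terms of \<open>b\<close> the remainder has order
    \<open>m * Suc n + e\<close>, which exceeds \<open>n\<close>.\<close>
  define N where "N = Suc n"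
  define d where "d n = (if e \<le> n \<and> m dvd n - e then taylor_coeff b ((n - e) div m) else 0)" for n
  have n: "n < m * N + e" using assms(2) by (cases m) (auto simp: N_def)
  have "(\<lambda>t. t ^ e * (b (t ^ m) - (\<Sum>i<N. taylor_coeff b i * (t ^ m) ^ i)))
      \<in> O[nhds 0](\<lambda>t. t ^ e * t ^ (m * N))"
    by (intro landau_o.big.mult bigo_power_compose[OF smooth_germ_taylor[OF assms(1)] assms(2)]) simp
  moreover have "t ^ e * (b (t ^ m) - (\<Sum>i<N. taylor_coeff b i * (t ^ m) ^ i))
      = t ^ e * b (t ^ m) - (\<Sum>n<m * N + e. d n * t ^ n)" for t
  proof -
    have inj: "inj_on (\<lambda>i. m * i + e) {..<N}" using assms(2) by (auto simp: inj_on_def)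
    have "(\<Sum>n<m * N + e. d n * t ^ n) = (\<Sum>n\<in>(\<lambda>i. m * i + e) ` {..<N}. d n * t ^ n)"
    proof (rule sum.mono_neutral_right)
      show "(\<lambda>i. m * i + e) ` {..<N} \<subseteq> {..<m * N + e}"
        using assms(2) by auto
      show "\<forall>n\<in>{..<m * N + e} - (\<lambda>i. m * i + e) ` {..<N}. d n * t ^ n = 0"
      proof
        fix n assume n: "n \<in> {..<m * N + e} - (\<lambda>i. m * i + e) ` {..<N}"
        have "\<not> (e \<le> n \<and> m dvd n - e)"
        proof
          assume "e \<le> n \<and> m dvd n - e"
          then obtain i where "n - e = m * i" "e \<le> n" by (auto elim: dvdE)
          then have i: "n = m * i + e" by simp
          then have "i < N" using n assms(2) by simp
          then show False using n i by blast
        qed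
        then have "d n = 0" unfolding d_def by (rule if_not_P)
        then show "d n * t ^ n = 0" by simp
      qed
    qed simp
    also have "\<dots> = (\<Sum>i<N. taylor_coeff b i * t ^ (m * i + e))"
      using assms(2) by (simp add: sum.reindex[OF inj] d_def)
    finally show ?thesis
      by (simp add: right_diff_distrib sum_distrib_left power_add power_mult[symmetric] mult_ac)
  qed
  ultimately have "(\<lambda>t. t ^ e * b (t ^ m) - (\<Sum>n<m * N + e. d n * t ^ n)) \<in> O[nhds 0](\<lambda>t. t ^ (m * N + e))"
    by (simp add: power_add mult.commute)
  then have "taylor_coeff (\<lambda>t. t ^ e * b (t ^ m)) n = d n"
    by (rule taylor_coeff_unique[OF smooth_germ_monomial_mult_compose_power[OF assms] _ n])
  then show ?thesis by (simp add: d_def)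
qed

lemma flat_germ_uminus:
  assumes "flat_germ r"
  shows "flat_germ (\<lambda>t. r (- t))"
proof -
  have "smooth_germ (\<lambda>t. r (- t))"
    by (rule smooth_germ_compose[where f = uminus])
      (use assms in \<open>simp_all add: flat_germ_def smooth_germ_iff_Ck_at Ck_at_minus[OF Ck_at_id]\<close>)
  moreover have "(\<lambda>t. r (- t)) \<in> O[nhds 0](\<lambda>t. t ^ n)" for n
    by (rule bigo_uminus_compose) (use assms in \<open>simp add: flat_germ_def\<close>)
  ultimately show ?thesis by (simp add: flat_germ_def)
qed

lemma flat_germ_add: "flat_germ r \<Longrightarrow> flat_germ q \<Longrightarrow> flat_germ (\<lambda>t. r t + q t)"
  unfolding flat_germ_def by (blast intro: smooth_germ_add sum_in_bigo(1))

lemma flat_germ_cmult: "flat_germ r \<Longrightarrow> flat_germ (\<lambda>t. c * r t)"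
  unfolding flat_germ_iff by (simp add: smooth_germ_cmult taylor_coeff_cmult)

lemma flat_germ_zero: "flat_germ (\<lambda>t. 0)"
  unfolding flat_germ_iff by (simp add: smooth_germ_const taylor_coeff_zero)

lemma flat_germ_at_0: "flat_germ r \<Longrightarrow> r 0 = 0"
  unfolding flat_germ_iff by (metis taylor_coeff_0)

text \<open>For odd \<open>m\<close> the map \<open>t \<mapsto> t^m\<close> is a bijection, so
  \<open>r\<close> is a function of \<open>t^m\<close> alone, and flatness makes that function
  smooth at 0. For even \<open>m\<close> the sign of \<open>t\<close> is lost: the even part of
  \<open>r\<close> goes into \<open>a\<close>, the odd part, divided by the odd monomial
  \<open>t^e\<close>, into \<open>b\<close>.\<close>

lemma flat_germ_power_division:
  assumes "flat_germ r" "m > 0" "even m \<Longrightarrow> odd e"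
  obtains a b where "flat_germ a" "flat_germ b" "\<And>t. r t = a (t ^ m) + t ^ e * b (t ^ m)"
proof (cases "even m")
  case False
  \<comment> \<open>The second summand carries the values of \<open>r\<close> on the negative axis;
    each summand is 0 on the half-line of the other.\<close>
  define a where "a s = root_pullback m r 0 s + root_pullback m (\<lambda>t. r (- t)) 0 (- s)" for s
  have "flat_germ a"
    unfolding a_def by (intro flat_germ_add flat_germ_uminus flat_germ_root_pullback assms)
  moreover have "r t = a (t ^ m)" for t
  proof -
    consider "t < 0" | "t = 0" | "t > 0" by linarith
    then show ?thesis
    proof cases
      case 1
      then have "root_pullback m (\<lambda>t. r (- t)) 0 ((- t) ^ m) = r t"
        by (subst root_pullback_power) (use assms(2) in auto)
      moreover have "root_pullback m r 0 (t ^ m) = 0"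
        unfolding root_pullback_def using 1 False assms(2) by (intro if_not_P) (simp add: not_less power_le_zero_eq)
      ultimately show ?thesis using False by (simp add: a_def)
    next
      case 2
      then show ?thesis using assms(2) flat_germ_at_0[OF assms(1)]
        by (simp add: a_def root_pullback_def power_0_left)
    next
      case 3
      then have "root_pullback m r 0 (t ^ m) = r t"
        by (subst root_pullback_power) (use assms(2) in auto)
      then show ?thesis using 3 by (simp add: a_def root_pullback_def)
    qed
  qed
  ultimately show thesis
    using that[OF _ flat_germ_zero, of a] by simp
next
  case True
  define a where "a = root_pullback m (\<lambda>t. (1/2) * (r t + r (- t))) 0"
  define b where "b = root_pullback m (\<lambda>t. (1/2) * (r t + (-1) * r (- t))) e"
  have "flat_germ a" "flat_germ b"
    unfolding a_def b_def
    by (intro flat_germ_root_pullback flat_germ_cmult flat_germ_add flat_germ_uminus assms)+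
  moreover have "r t = a (t ^ m) + t ^ e * b (t ^ m)" for t
  proof -
    consider "t < 0" | "t = 0" | "t > 0" by linarith
    then show ?thesis
    proof cases
      case 1
      have tm: "t ^ m = (- t) ^ m" using True by simp
      have te: "t ^ e = - ((- t) ^ e)" using assms(3)[OF True] by simp
      have "a (t ^ m) = (1/2) * (r (- t) + r t)"
        unfolding a_def tm by (subst root_pullback_power) (use assms(2) 1 in auto)
      moreover have "b (t ^ m) = (1/2) * (r (- t) + (-1) * r t) / (- t) ^ e"
        unfolding b_def tm by (subst root_pullback_power) (use assms(2) 1 in auto)
      ultimately show ?thesis unfolding te using 1 by (simp add: field_simps)
    next
      case 2
      then show ?thesis using assms(2) flat_germ_at_0[OF assms(1)]
        by (simp add: a_def b_def root_pullback_def power_0_left)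
    next
      case 3
      have "a (t ^ m) = (1/2) * (r t + r (- t))"
        unfolding a_def by (subst root_pullback_power) (use assms(2) 3 in auto)
      moreover have "b (t ^ m) = (1/2) * (r t + (-1) * r (- t)) / t ^ e"
        unfolding b_def by (subst root_pullback_power) (use assms(2) 3 in auto)
      ultimately show ?thesis using 3 by (simp add: field_simps)
    qed
  qed
  ultimately show thesis using that by blast
qed

text \<open>Here \<open>e j\<close> is the least exponent used in the residue class of
  \<open>j\<close> modulo \<open>m\<close>; for \<open>(t^2, t^3)\<close> these are 0, 3 and for
  \<open>(t^3, t^4)\<close> they are 0, 4, 8. Sorting the Taylor coefficients of \<open>f\<close> by
  residue class prescribes the series of each \<open>h j\<close>, and nothing is left out because
  \<open>f\<close> has no coefficient below \<open>e j\<close> in its class.\<close>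

theorem smooth_germ_power_division:
  assumes f: "smooth_germ f" and m: "m \<ge> 2"
    and e: "\<And>j. j < m \<Longrightarrow> e j mod m = j" "e 0 = 0"
    and gaps: "\<And>n. n < e (n mod m) \<Longrightarrow> taylor_coeff f n = 0"
  obtains h where "\<And>j. j < m \<Longrightarrow> smooth_germ (h j)"
    "\<And>j i. j < m \<Longrightarrow> taylor_coeff (h j) i = taylor_coeff f (m * i + e j)"
    "\<And>t. f t = (\<Sum>j<m. t ^ e j * h j (t ^ m))"
proof -
  have m0: "m > 0" using m by simp
  have "\<forall>j. \<exists>B. smooth_germ B \<and> (\<forall>i. taylor_coeff B i = taylor_coeff f (m * i + e j))"
  proof
    fix j
    obtain B where "Ck_on \<infinity> UNIV B" "\<And>i. taylor_coeff B i = taylor_coeff f (m * i + e j)"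
      using Borel_lemma[of "\<lambda>i. taylor_coeff f (m * i + e j)"] by blast
    then show "\<exists>B. smooth_germ B \<and> (\<forall>i. taylor_coeff B i = taylor_coeff f (m * i + e j))"
      unfolding smooth_germ_def using open_UNIV by blast
  qed
  then obtain B where B: "\<And>j. smooth_germ (B j)" "\<And>i j. taylor_coeff (B j) i = taylor_coeff f (m * i + e j)"
    by metis
  define r where "r t = f t + (-1) * (\<Sum>j<m. t ^ e j * B j (t ^ m))" for t
  have s: "smooth_germ (\<lambda>t. \<Sum>j<m. t ^ e j * B j (t ^ m))"
    by (intro smooth_germ_sum smooth_germ_monomial_mult_compose_power B m0)
  have "taylor_coeff r n = 0" for n
  proof -
    have 1: "(e j \<le> n \<and> m dvd n - e j) \<longleftrightarrow> j = n mod m \<and> e j \<le> n" if "j < m" for j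
      using e(1)[OF that] that by (metis mod_eq_dvd_iff_nat)
    have 2: "taylor_coeff (B j) ((n - e j) div m) = taylor_coeff f n"
      if "e j \<le> n" "m dvd n - e j" for j
      using that by (simp add: B(2))
    have "taylor_coeff (\<lambda>t. \<Sum>j<m. t ^ e j * B j (t ^ m)) n =
        (\<Sum>j<m. if e j \<le> n \<and> m dvd n - e j then taylor_coeff (B j) ((n - e j) div m) else 0)"
      by (simp add: taylor_coeff_sum smooth_germ_monomial_mult_compose_power
          taylor_coeff_monomial_mult_compose_power B(1) m0)
    also have "\<dots> = (\<Sum>j<m. if j = n mod m then (if e j \<le> n then taylor_coeff f n else 0) else 0)"
      by (intro sum.cong refl) (use 1 2 in auto)
    also have "\<dots> = (if e (n mod m) \<le> n then taylor_coeff f n else 0)"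
      using m0 by (simp add: sum.delta)
    also have "\<dots> = taylor_coeff f n"
      using gaps[of n] by auto
    finally show ?thesis
      unfolding r_def by (simp only: taylor_coeff_add[OF f smooth_germ_cmult[OF s]] taylor_coeff_cmult[OF s])
  qed
  moreover have "smooth_germ r"
    unfolding r_def by (intro smooth_germ_add f smooth_germ_cmult s)
  ultimately have "flat_germ r" by (simp add: flat_germ_iff)
  moreover have "odd (e 1)" if "even m"
  proof -
    have "e 1 mod m = 1" using e(1)[of 1] m by simp
    then show ?thesis using that by (metis dvd_mod_iff odd_one)
  qed
  ultimately obtain a b where ab: "flat_germ a" "flat_germ b" "\<And>t. r t = a (t ^ m) + t ^ e 1 * b (t ^ m)"
    using flat_germ_power_division[OF _ m0] by metis
  \<comment> \<open>Indices 0 and 1 suffice for the flat remainder: \<open>e 0 = 0\<close>, and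
    \<open>e 1\<close>, being 1 modulo \<open>m\<close>, is odd when \<open>m\<close> is even. A
    flat summand leaves the prescribed coefficients unchanged.\<close>
  define q where "q j = (if j = 0 then a else if j = 1 then b else (\<lambda>_. 0))" for j :: nat
  have q: "flat_germ (q j)" for j
    by (simp add: q_def ab flat_germ_zero)
  define h where "h j s = B j s + q j s" for j s
  show thesis
  proof (rule that[of h])
    show "smooth_germ (h j)" for j
      unfolding h_def using q[of j] B(1)[of j] by (intro smooth_germ_add) (auto simp: flat_germ_def)
    show "taylor_coeff (h j) i = taylor_coeff f (m * i + e j)" for j i
      unfolding h_def using q[of j] B by (simp add: taylor_coeff_add flat_germ_iff)
    show "f t = (\<Sum>j<m. t ^ e j * h j (t ^ m))" for t
    proof -
      have "(\<Sum>j<m. t ^ e j * q j (t ^ m)) = (\<Sum>j\<in>{0, 1}. t ^ e j * q j (t ^ m))"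
        by (rule sum.mono_neutral_right) (use m in \<open>auto simp: q_def\<close>)
      also have "\<dots> = r t"
        by (simp add: q_def ab(3) e(2))
      finally show ?thesis
        by (simp add: h_def distrib_left sum.distrib r_def)
    qed
  qed
qed

subsection \<open>Local inverses\<close>

text \<open>\<open>G v x\<close> stands for the inverse derivative of \<open>f\<close> at
  \<open>x\<close>, applied to \<open>v\<close>. The local inverse satisfies
  \<open>Dg(y) v = G v (g y)\<close>, an equation in \<open>g\<close> alone, so bootstrapping lifts
  it to the class of \<open>f\<close>. The neighbourhood \<open>V\<close> is the same for all
  \<open>n\<close>, which makes the result applicable to smooth maps.\<close>

lemma higher_differentiable_on_local_inverse:
  fixes f :: "'a::euclidean_space \<Rightarrow> 'a" and G :: "'a \<Rightarrow> 'a \<Rightarrow> 'a"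
  assumes U: "open U" "p \<in> U" and f: "higher_differentiable_on U f (Suc 0)"
    and G1: "\<And>x v. x \<in> U \<Longrightarrow> frechet_derivative f (at x) (G v x) = v"
    and G2: "\<And>x v. x \<in> U \<Longrightarrow> G (frechet_derivative f (at x) v) x = v"
    and G: "\<And>n v. higher_differentiable_on U f (Suc n) \<Longrightarrow> higher_differentiable_on U (G v) n"
  obtains U' V g where "open U'" "U' \<subseteq> U" "p \<in> U'" "open V" "homeomorphism U' V f g"
    "\<And>n. higher_differentiable_on U f n \<Longrightarrow> higher_differentiable_on V g n"
proof -
  define D where "D x = frechet_derivative f (at x)" for x
  have dD: "(f has_derivative D x) (at x)" if "x \<in> U" for x
    unfolding D_def using higher_differentiable_on_SucD(1)[OF f that] .
  define f' where "f' x = Blinfun (D x)" for x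
  have ap: "blinfun_apply (f' x) = D x" if "x \<in> U" for x
    unfolding f'_def using dD[OF that] by (intro bounded_linear_Blinfun_apply has_derivative_bounded_linear)
  have derf: "(f has_derivative blinfun_apply (f' x)) (at x)" if "x \<in> U" for x
    using dD[OF that] ap[OF that] by simp
  have inj: "inj (D x)" if "x \<in> U" for x
    using G2[OF that] unfolding D_def by (metis injI)
  have cont: "continuous_on U f'"
  proof (rule continuous_on_blinfun_componentwise)
    fix i :: 'a
    have "continuous_on U (\<lambda>x. D x i)"
      using higher_differentiable_on_SucD(2)[OF f, of i] unfolding D_def by simp
    then show "continuous_on U (\<lambda>x. blinfun_apply (f' x) i)"
      by (rule continuous_on_eq) (simp add: ap)
  qed
  \<comment> \<open>The inverse function theorem asks for a left inverse of the derivative at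
    \<open>p\<close>; injectivity, which \<open>G\<close> provides, yields one.\<close>
  obtain h where h: "linear h" "h \<circ> D p = id"
    using linear_injective_left_inverse[OF has_derivative_linear[OF dD[OF U(2)]] inj[OF U(2)]] by blast
  have inv: "Blinfun h o\<^sub>L f' p = id_blinfun"
  proof (rule blinfun_eqI)
    fix i
    have "blinfun_apply (Blinfun h) = h"
      using h(1) by (intro bounded_linear_Blinfun_apply linear_conv_bounded_linear[THEN iffD1])
    then show "blinfun_apply (Blinfun h o\<^sub>L f' p) i = blinfun_apply id_blinfun i"
      using fun_cong[OF h(2), of i] by (simp add: ap[OF U(2)])
  qed
  obtain U' V g g' where g: "open U'" "U' \<subseteq> U" "p \<in> U'" "open V" "f p \<in> V" "homeomorphism U' V f g"
    "\<And>y. y \<in> V \<Longrightarrow> (g has_derivative (g' y)) (at y)"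
    "\<And>y. y \<in> V \<Longrightarrow> g' y = inv (blinfun_apply (f' (g y)))"
    "\<And>y. y \<in> V \<Longrightarrow> bij (blinfun_apply (f' (g y)))"
    by (rule inverse_function_theorem[OF U(1) derf cont U(2) inv]) (assumption | rule that)+
  have gV: "g ` V \<subseteq> U" using g(2,6) by (auto simp: homeomorphism_def)
  have g': "g' y v = G v (g y)" if "y \<in> V" for y v
  proof -
    have gy: "g y \<in> U" using gV that by blast
    have "g' y v = inv (D (g y)) v" by (simp add: g(8)[OF that] ap[OF gy])
    also have "\<dots> = G v (g y)"
      by (rule inv_f_eq[OF inj[OF gy]]) (use G1[OF gy] in \<open>simp add: D_def\<close>)
    finally show ?thesis .
  qed
  have "higher_differentiable_on V g n" if "higher_differentiable_on U f n" for n
  proof (cases n)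
    case 0
    then show ?thesis using g(6) by (simp add: homeomorphism_def)
  next
    case (Suc m)
    have "(g has_derivative (\<lambda>v. G v (g y))) (at y)" if "y \<in> V" for y
    proof -
      have "g' y = (\<lambda>v. G v (g y))" by (rule ext) (rule g'[OF that])
      then show ?thesis using g(7)[OF that] by simp
    qed
    then show ?thesis
      unfolding Suc
      by (rule higher_differentiable_on_bootstrap[OF g(4) U(1) gV]) (use that G Suc in blast)+
  qed
  then show thesis using that g by blast
qed

lemma higher_differentiable_on_divide:
  fixes f g :: "'a::euclidean_space \<Rightarrow> real"
  assumes "open U" "higher_differentiable_on U f n" "higher_differentiable_on U g n"
    "\<And>x. x \<in> U \<Longrightarrow> g x \<noteq> 0"
  shows "higher_differentiable_on U (\<lambda>x. f x / g x) n"
proof -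
  have "higher_differentiable_on (- {0}) (inverse :: real \<Rightarrow> real) n"
    by (rule Ck_onD[OF Ck_on_inverse[of \<infinity>]]) simp
  then have "higher_differentiable_on U (\<lambda>x. inverse (g x)) n"
    by (rule higher_differentiable_on_compose[OF assms(1) _ _ assms(3), rotated 2]) (use assms(4) in auto)
  then show ?thesis
    unfolding divide_inverse
    by (rule higher_differentiable_on_bilinear[OF assms(1) bounded_bilinear_mult assms(2)])
qed

text \<open>The neighbourhood is shrunk to the set where the Jacobian determinant does not vanish.
  There the entries of the inverse matrix are quotients of expressions in first derivatives of
  \<open>f\<close>, hence just one class below \<open>f\<close>, as is required of
  \<open>G\<close>.\<close>

lemma Ck_at_local_inverse_plane:
  fixes f :: "real^2 \<Rightarrow> real^2"
  assumes f: "Ck_at k p f" "1 \<le> k" and P: "(f has_derivative P) (at p)"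
    and nz: "P (axis 1 1) $ 1 * P (axis 2 1) $ 2 - P (axis 1 1) $ 2 * P (axis 2 1) $ 1 \<noteq> 0"
  obtains U V g where "open U" "open V" "p \<in> U" "homeomorphism U V f g" "Ck_on k U f" "Ck_on k V g"
proof -
  obtain W where W: "open W" "p \<in> W" "Ck_on k W f"
    using f(1) unfolding Ck_at_def by blast
  have f1: "higher_differentiable_on W f (Suc 0)"
    by (rule Ck_onD[OF W(3)]) (use f(2) in \<open>simp add: one_enat_def\<close>)
  define a where "a x = frechet_derivative f (at x) (axis 1 1)" for x
  define b where "b x = frechet_derivative f (at x) (axis 2 1)" for x
  define \<delta> where "\<delta> x = a x $ 1 * b x $ 2 - a x $ 2 * b x $ 1" for x
  have "continuous_on W a" "continuous_on W b"
    unfolding a_def b_def using higher_differentiable_on_SucD(2)[OF f1] by simp_all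
  then have c: "continuous_on W \<delta>"
    unfolding \<delta>_def by (intro continuous_intros)
  have P': "P = frechet_derivative f (at p)" by (rule frechet_derivative_at[OF P])
  have "\<delta> p \<noteq> 0" using nz by (simp add: \<delta>_def a_def b_def P')
  define U where "U = W \<inter> \<delta> -` (- {0})"
  have U: "open U" "p \<in> U" "U \<subseteq> W"
    using continuous_open_preimage[OF c W(1), of "- {0}"] W(2) \<open>\<delta> p \<noteq> 0\<close> by (auto simp: U_def)
  have lin: "frechet_derivative f (at x) v = v $ 1 *\<^sub>R a x + v $ 2 *\<^sub>R b x" if "x \<in> U" for x v
  proof -
    have "linear (frechet_derivative f (at x))"
      using higher_differentiable_on_SucD(1)[OF f1, of x] U(3) that has_derivative_linear by blast
    then have "frechet_derivative f (at x) (v $ 1 *\<^sub>R axis 1 1 + v $ 2 *\<^sub>R axis 2 1) = v $ 1 *\<^sub>R a x + v $ 2 *\<^sub>R b x"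
      unfolding a_def b_def by (simp add: linear_add linear_scale)
    moreover have "v $ 1 *\<^sub>R axis 1 1 + v $ 2 *\<^sub>R axis 2 1 = v"
      by (simp add: vec_eq_iff forall_2 axis_def)
    ultimately show ?thesis by simp
  qed
  have nz: "\<delta> x \<noteq> 0" if "x \<in> U" for x using that by (simp add: U_def)
  \<comment> \<open>the inverse of the Jacobian matrix, by Cramer's rule\<close>
  define G :: "real^2 \<Rightarrow> real^2 \<Rightarrow> real^2" where
    "G v x = vector [(v $ 1 * b x $ 2 - v $ 2 * b x $ 1) / \<delta> x, (a x $ 1 * v $ 2 - a x $ 2 * v $ 1) / \<delta> x]" for v x
  have G_alt: "G v x = ((v $ 1 * b x $ 2 - v $ 2 * b x $ 1) / \<delta> x) *\<^sub>R axis 1 1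
      + ((a x $ 1 * v $ 2 - a x $ 2 * v $ 1) / \<delta> x) *\<^sub>R axis 2 1" for v x
    by (simp add: G_def vec_eq_iff forall_2 axis_def)
  obtain U' V g where g: "open U'" "U' \<subseteq> U" "p \<in> U'" "open V" "homeomorphism U' V f g"
    "\<And>n. higher_differentiable_on U f n \<Longrightarrow> higher_differentiable_on V g n"
  proof (rule higher_differentiable_on_local_inverse[OF U(1,2), of f G])
    show "higher_differentiable_on U f (Suc 0)"
      by (rule higher_differentiable_on_subset[OF f1 U(3)])
    show "frechet_derivative f (at x) (G v x) = v" if "x \<in> U" for x v
      using nz[OF that] unfolding lin[OF that]
      by (simp add: G_def vec_eq_iff forall_2 divide_simps) (simp add: \<delta>_def algebra_simps)
    show "G (frechet_derivative f (at x) v) x = v" if "x \<in> U" for x v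
      using nz[OF that] unfolding lin[OF that]
      by (simp add: G_def vec_eq_iff forall_2 divide_simps) (simp add: \<delta>_def algebra_simps)
    show "higher_differentiable_on U (G v) n" if "higher_differentiable_on U f (Suc n)" for n v
    proof -
      note m = higher_differentiable_on_bilinear[OF U(1) bounded_bilinear_mult]
      note c = higher_differentiable_on_const[OF U(1)]
      have lin': "bounded_linear (\<lambda>v::real^2. v $ i)" for i by (rule bounded_linear_vec_nth)
      have nth: "higher_differentiable_on U (\<lambda>x. h x $ i) n" if "higher_differentiable_on U h n"
        for h :: "real^2 \<Rightarrow> real^2" and i
        using higher_differentiable_on_bilinear[OF U(1) bounded_bilinear_inner that c[of "axis i 1"]]
        by (simp add: inner_axis)
      have ab: "higher_differentiable_on U a n" "higher_differentiable_on U b n"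
        unfolding a_def b_def by (rule higher_differentiable_on_SucD(2)[OF that])+
      have diff: "higher_differentiable_on U (\<lambda>x. h x - k x) n"
        if "higher_differentiable_on U h n" "higher_differentiable_on U k n" for h k :: "real^2 \<Rightarrow> real"
        using higher_differentiable_on_add[OF U(1) that(1) m[OF c[of "-1"] that(2)]] by simp
      have d: "higher_differentiable_on U \<delta> n"
        unfolding \<delta>_def by (rule diff[OF m[OF nth nth] m[OF nth nth]]) (rule ab)+
      note dv = higher_differentiable_on_divide[OF U(1) _ d nz]
      note sc = higher_differentiable_on_bilinear[OF U(1) bounded_bilinear_scaleR _ c]
      have "higher_differentiable_on U (\<lambda>x. ((v $ 1 * b x $ 2 - v $ 2 * b x $ 1) / \<delta> x) *\<^sub>R axis 1 1
      + ((a x $ 1 * v $ 2 - a x $ 2 * v $ 1) / \<delta> x) *\<^sub>R (axis 2 1 :: real^2)) n"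
        by (rule higher_differentiable_on_add[OF U(1) sc[OF dv[OF diff[OF m[OF c nth] m[OF c nth]]]]
              sc[OF dv[OF diff[OF m[OF nth c] m[OF nth c]]]]]) (rule ab | assumption)+
      then show ?thesis
        unfolding G_alt[abs_def] .
    qed
  qed (rule that, assumption+)
  have "Ck_on k U f" by (rule Ck_on_subset[OF W(3) U(3)])
  then have "Ck_on k V g" "Ck_on k U' f"
    using g(6) Ck_on_subset[OF _ g(2)] unfolding Ck_on_def by blast+
  then show thesis using that g by blast
qed

lemma Ck_at_local_inverse_real:
  fixes f :: "real \<Rightarrow> real"
  assumes f: "Ck_at k p f" "1 \<le> k" and P: "(f has_real_derivative d) (at p)" and nz: "d \<noteq> 0"
  obtains U V g where "open U" "open V" "p \<in> U" "homeomorphism U V f g" "Ck_on k U f" "Ck_on k V g"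
proof -
  obtain W where W: "open W" "p \<in> W" "Ck_on k W f"
    using f(1) unfolding Ck_at_def by blast
  have f1: "higher_differentiable_on W f (Suc 0)"
    by (rule Ck_onD[OF W(3)]) (use f(2) in \<open>simp add: one_enat_def\<close>)
  note D = higher_differentiable_on_real_SucD[OF W(1) f1]
  have c: "continuous_on W (deriv f)" using D(2) by simp
  define U where "U = W \<inter> deriv f -` (- {0})"
  have "deriv f p \<noteq> 0" using DERIV_imp_deriv[OF P] nz by simp
  then have U: "open U" "p \<in> U" "U \<subseteq> W"
    using continuous_open_preimage[OF c W(1), of "- {0}"] W(2) by (auto simp: U_def)
  have nz: "deriv f x \<noteq> 0" if "x \<in> U" for x using that by (simp add: U_def)
  have lin: "frechet_derivative f (at x) = (\<lambda>v. deriv f x * v)" if "x \<in> U" for x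
    by (rule frechet_derivative_at[symmetric]) (use D(1) U(3) that in \<open>auto simp: has_field_derivative_def\<close>)
  obtain U' V g where g: "open U'" "U' \<subseteq> U" "p \<in> U'" "open V" "homeomorphism U' V f g"
    "\<And>n. higher_differentiable_on U f n \<Longrightarrow> higher_differentiable_on V g n"
  proof (rule higher_differentiable_on_local_inverse[OF U(1,2), of f "\<lambda>v x. v / deriv f x"])
    show "higher_differentiable_on U f (Suc 0)"
      by (rule higher_differentiable_on_subset[OF f1 U(3)])
    show "frechet_derivative f (at x) (v / deriv f x) = v" if "x \<in> U" for x v
      using nz[OF that] by (simp add: lin[OF that])
    show "frechet_derivative f (at x) v / deriv f x = v" if "x \<in> U" for x v
      using nz[OF that] by (simp add: lin[OF that])
    show "higher_differentiable_on U (\<lambda>x. v / deriv f x) n" if "higher_differentiable_on U f (Suc n)" for n v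
      by (rule higher_differentiable_on_divide[OF U(1) higher_differentiable_on_const[OF U(1)]
            higher_differentiable_on_real_SucD(2)[OF U(1) that] nz])
  qed (rule that, assumption+)
  have "Ck_on k U f" by (rule Ck_on_subset[OF W(3) U(3)])
  then have "Ck_on k V g" "Ck_on k U' f"
    using g(6) Ck_on_subset[OF _ g(2)] unfolding Ck_on_def by blast+
  then show thesis using that g by blast
qed

text \<open>The constructions below end in a factorisation
  \<open>f \<circ> \<tau> = \<Psi> \<circ> N\<close>; the definition of equivalence has the
  diffeomorphisms on the opposite sides. Passing to the local inverses of \<open>\<tau>\<close> and
  \<open>\<Psi>\<close> mediates, and their invertibility is read off from the derivatives at
  0.\<close>

theorem Ck_equivalentI:
  fixes f N :: "real \<Rightarrow> real^2" and \<Psi> :: "real^2 \<Rightarrow> real^2"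
  assumes k: "1 \<le> k" and \<tau>: "Ck_at k 0 \<tau>" "\<tau> 0 = 0" "(\<tau> has_real_derivative d) (at 0)" "d \<noteq> 0"
    and N: "isCont N 0" "N 0 = 0"
    and \<Psi>: "Ck_at k 0 \<Psi>" "(\<Psi> has_derivative P) (at 0)"
      "P (axis 1 1) $ 1 * P (axis 2 1) $ 2 - P (axis 1 1) $ 2 * P (axis 2 1) $ 1 \<noteq> 0"
    and eq: "\<forall>\<^sub>F t in nhds 0. f (\<tau> t) = \<Psi> (N t)"
  shows "Ck_equivalent k f N"
proof -
  obtain U V \<phi> where 1: "open U" "open V" "0 \<in> U" "homeomorphism U V \<tau> \<phi>" "Ck_on k U \<tau>" "Ck_on k V \<phi>"
    using Ck_at_local_inverse_real[OF \<tau>(1) k \<tau>(3,4)] .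
  obtain U' V' \<Phi> where 2: "open U'" "open V'" "0 \<in> U'" "homeomorphism U' V' \<Psi> \<Phi>" "Ck_on k U' \<Psi>" "Ck_on k V' \<Phi>"
    using Ck_at_local_inverse_plane[OF \<Psi>(1) k \<Psi>(2,3)] .
  have 0: "0 \<in> V" "\<phi> 0 = 0"
    using 1(3,4) \<tau>(2) by (force simp: homeomorphism_def)+
  have f0: "f 0 = \<Psi> 0" using eventually_nhds_x_imp_x[OF eq] \<tau>(2) N(2) by simp
  then have f0V: "f 0 \<in> V'"
    using 2(3,4) by (auto simp: homeomorphism_def)
  have "diffeo_germ k 0 \<phi>"
    unfolding diffeo_germ_def using 1 0 homeomorphism_symD by blast
  moreover have "diffeo_germ k (f 0) \<Phi>"
    unfolding diffeo_germ_def using 2 f0V homeomorphism_symD by blast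
  moreover have "\<forall>\<^sub>F s in nhds 0. \<Phi> (f s) = N (\<phi> s)"
  proof -
    have "continuous_on V \<phi>" using 1(4) by (simp add: homeomorphism_def)
    then have "isCont \<phi> 0" using 1(2) 0(1) by (simp add: continuous_on_eq_continuous_at)
    then have "(\<phi> \<longlongrightarrow> \<phi> 0) (nhds 0)"
      unfolding isCont_def tendsto_at_iff_tendsto_nhds .
    then have lim: "filterlim \<phi> (nhds 0) (nhds 0)"
      using 0(2) by simp
    have "(N \<longlongrightarrow> N 0) (nhds 0)"
      using N(1) unfolding isCont_def tendsto_at_iff_tendsto_nhds .
    then have "(N \<longlongrightarrow> 0) (nhds 0)"
      using N(2) by simp
    then have "\<forall>\<^sub>F t in nhds 0. N t \<in> U'"
      using 2(1,3) by (rule topological_tendstoD)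
    with eq have "\<forall>\<^sub>F t in nhds 0. \<Phi> (f (\<tau> t)) = N t"
      by eventually_elim (use 2(4) in \<open>auto simp: homeomorphism_def\<close>)
    then have "\<forall>\<^sub>F s in nhds 0. \<Phi> (f (\<tau> (\<phi> s))) = N (\<phi> s)"
      using lim by (rule eventually_compose_filterlim)
    moreover have "\<forall>\<^sub>F s in nhds 0. s \<in> V"
      using 1(2) 0(1) by (rule eventually_nhds_in_open)
    ultimately show ?thesis
      by eventually_elim (use 1(4) in \<open>auto simp: homeomorphism_def\<close>)
  qed
  ultimately show ?thesis
    unfolding Ck_equivalent_def using 0(2) by blast
qed

subsection \<open>Taylor coefficients of products and compositions\<close>

lemma isCont_power_mult_bigo:
  fixes R :: "real \<Rightarrow> real"
  assumes "isCont R 0"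
  shows "(\<lambda>t. t ^ n * R t) \<in> O[nhds 0](\<lambda>t. t ^ n)"
  using landau_o.big.mult[OF landau_o.big_refl[of "\<lambda>t. t ^ n"] isCont_imp_bigo_1[OF assms]]
  by (simp only: mult_1_right)

lemma smooth_germ_isCont: "smooth_germ f \<Longrightarrow> isCont f 0" for f :: "real \<Rightarrow> real"
  using smooth_germ_deriv(2) eventually_nhds_x_imp_x DERIV_isCont by blast

lemma smooth_germ_filterlim:
  fixes p :: "real \<Rightarrow> real"
  assumes "smooth_germ p" "p 0 = 0"
  shows "filterlim p (nhds 0) (nhds 0)"
proof -
  have "(p \<longlongrightarrow> p 0) (nhds 0)"
    using smooth_germ_isCont[OF assms(1)] unfolding isCont_def tendsto_at_iff_tendsto_nhds .
  then show ?thesis by (simp only: assms(2))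
qed

lemma bigo_compose_germ:
  assumes "f \<in> O[nhds 0](\<lambda>t::real. t ^ n)" "smooth_germ p" "p 0 = 0"
  shows "(\<lambda>t. f (p t)) \<in> O[nhds 0](\<lambda>t. t ^ n)"
proof -
  have "p \<in> O[nhds 0](\<lambda>t. t ^ 1)"
    unfolding smooth_germ_bigo_iff[OF assms(2)] by (simp add: taylor_coeff_0 assms(3))
  then have "(\<lambda>t. p t ^ n) \<in> O[nhds 0](\<lambda>t. t ^ n)"
    using landau_o.big_power[of p _ "\<lambda>t. t" n] by simp
  with landau_o.big.compose[OF assms(1) smooth_germ_filterlim[OF assms(2,3)]] show ?thesis
    by (rule landau_o.big_trans)
qed

lemma smooth_germ_mult:
  fixes f g :: "real \<Rightarrow> real"
  shows "smooth_germ f \<Longrightarrow> smooth_germ g \<Longrightarrow> smooth_germ (\<lambda>t. f t * g t)"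
  unfolding smooth_germ_iff_Ck_at by (rule Ck_at_mult)

lemma taylor_coeff_mult:
  assumes f: "smooth_germ f" and g: "smooth_germ g"
  shows "taylor_coeff (\<lambda>t. f t * g t) n = (\<Sum>i\<le>n. taylor_coeff f i * taylor_coeff g (n - i))"
proof -
  define p where "p = (\<Sum>i<Suc n. monom (taylor_coeff f i) i)"
  define q where "q = (\<Sum>i<Suc n. monom (taylor_coeff g i) i)"
  \<comment> \<open>The part of \<open>p * q\<close> in degrees above \<open>n\<close>; it is
    divisible by \<open>X^(n+1)\<close> and thus contributes only \<open>O(t^(n+1))\<close>.\<close>
  define r where "r = p * q - (\<Sum>i<Suc n. monom (coeff (p * q) i) i)"
  have "coeff r k = 0" if "k < Suc n" for k
    using that by (simp add: r_def coeff_sum if_distrib cong: if_cong)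
  then have "monom 1 (Suc n) dvd r"
    by (subst monom_1_dvd_iff') auto
  then obtain s where s: "r = monom 1 (Suc n) * s" by (auto elim: dvdE)
  have pt: "poly p t = (\<Sum>i<Suc n. taylor_coeff f i * t ^ i)"
    and qt: "poly q t = (\<Sum>i<Suc n. taylor_coeff g i * t ^ i)" for t
    by (simp_all only: p_def q_def poly_sum poly_monom)
  have rt: "poly p t * poly q t - (\<Sum>i<Suc n. coeff (p * q) i * t ^ i) = t ^ Suc n * poly s t" for t
    using arg_cong[OF s, of "\<lambda>r. poly r t"] by (simp add: r_def poly_sum poly_monom del: sum.lessThan_Suc)
  have 1: "(\<lambda>t. (f t - poly p t) * g t) \<in> O[nhds 0](\<lambda>t. t ^ Suc n)"
    using landau_o.big.mult[OF smooth_germ_taylor[OF f, of "Suc n"] isCont_imp_bigo_1[OF smooth_germ_isCont[OF g]]]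
    by (simp only: pt mult_1_right)
  have 2: "(\<lambda>t. poly p t * (g t - poly q t)) \<in> O[nhds 0](\<lambda>t. t ^ Suc n)"
    using landau_o.big.mult[OF isCont_imp_bigo_1[OF poly_isCont] smooth_germ_taylor[OF g, of "Suc n"]]
    by (simp only: qt mult_1_left)
  have 3: "(\<lambda>t. t ^ Suc n * poly s t) \<in> O[nhds 0](\<lambda>t. t ^ Suc n)"
    by (rule isCont_power_mult_bigo[OF poly_isCont])
  have eq: "(f t - poly p t) * g t + poly p t * (g t - poly q t) + t ^ Suc n * poly s t
      = f t * g t - (\<Sum>i<Suc n. coeff (p * q) i * t ^ i)" for t
    unfolding rt[symmetric] by (simp add: algebra_simps del: sum.lessThan_Suc)
  have "taylor_coeff (\<lambda>t. f t * g t) n = coeff (p * q) n"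
    by (rule taylor_coeff_unique[OF smooth_germ_mult[OF f g], where n = "Suc n"])
      (use sum_in_bigo(1)[OF sum_in_bigo(1)[OF 1 2] 3] in \<open>simp_all only: eq lessI\<close>)
  moreover have "coeff p i = taylor_coeff f i" "coeff q i = taylor_coeff g i" if "i \<le> n" for i
    using that by (simp_all add: p_def q_def coeff_sum if_distrib cong: if_cong)
  ultimately show ?thesis
    by (simp add: coeff_mult)
qed

text \<open>\<open>c k j\<close> is the coefficient of \<open>t^j\<close> in \<open>p(t)^k\<close>.
  Such an expansion, with the tail written as \<open>t^n\<close> times a continuous factor, is asked
  for just those \<open>k\<close> whose coefficient in \<open>f\<close> is nonzero, so for a germ of
  high order the low powers of \<open>p\<close> are never expanded.\<close>

lemma taylor_coeff_compose_jet:
  assumes f: "smooth_germ f" and p: "smooth_germ p" "p 0 = 0" and j: "j < n"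
    and pk: "\<And>k. k < n \<Longrightarrow> taylor_coeff f k \<noteq> 0 \<Longrightarrow>
      \<exists>R. isCont R 0 \<and> (\<forall>t. p t ^ k = (\<Sum>j<n. c k j * t ^ j) + t ^ n * R t)"
  shows "taylor_coeff (\<lambda>t. f (p t)) j = (\<Sum>k<n. taylor_coeff f k * c k j)"
proof -
  \<comment> \<open>Multiplying by the coefficient of \<open>f\<close> first makes a remainder exist
    for every \<open>k < n\<close>: where the coefficient is 0, the remainder 0 does.\<close>
  have "\<forall>k. \<exists>R. k < n \<longrightarrow> isCont R 0 \<and>
      (\<forall>t. taylor_coeff f k * p t ^ k = (\<Sum>j<n. taylor_coeff f k * c k j * t ^ j) + t ^ n * R t)"
  proof
    fix k
    show "\<exists>R. k < n \<longrightarrow> isCont R 0 \<and>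
      (\<forall>t. taylor_coeff f k * p t ^ k = (\<Sum>j<n. taylor_coeff f k * c k j * t ^ j) + t ^ n * R t)"
    proof (cases "k < n \<and> taylor_coeff f k \<noteq> 0")
      case True
      then obtain R where R: "isCont R 0" "\<And>t. p t ^ k = (\<Sum>j<n. c k j * t ^ j) + t ^ n * R t"
        using pk by blast
      have "taylor_coeff f k * p t ^ k
          = (\<Sum>j<n. taylor_coeff f k * c k j * t ^ j) + t ^ n * (taylor_coeff f k * R t)" for t
        unfolding R(2) by (simp add: distrib_left sum_distrib_left mult_ac)
      moreover have "isCont (\<lambda>t. taylor_coeff f k * R t) 0" using R(1) by simp
      ultimately show ?thesis by blast
    qed (auto intro!: exI[of _ "\<lambda>_. 0"])
  qed
  then obtain R where "\<forall>k. k < n \<longrightarrow> isCont (R k) 0 \<and>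
      (\<forall>t. taylor_coeff f k * p t ^ k = (\<Sum>j<n. taylor_coeff f k * c k j * t ^ j) + t ^ n * R k t)"
    unfolding choice_iff by (rule exE)
  then have R: "\<And>k. k < n \<Longrightarrow> isCont (R k) 0"
      "\<And>k t. k < n \<Longrightarrow> taylor_coeff f k * p t ^ k = (\<Sum>j<n. taylor_coeff f k * c k j * t ^ j) + t ^ n * R k t"
    by blast+
  have s: "smooth_germ (\<lambda>t. f (p t))"
    by (rule smooth_germ_compose[OF f p])
  have 1: "(\<lambda>t. f (p t) - (\<Sum>k<n. taylor_coeff f k * p t ^ k)) \<in> O[nhds 0](\<lambda>t. t ^ n)"
    by (rule bigo_compose_germ[OF smooth_germ_taylor[OF f, of n] p])
  have 2: "(\<lambda>t. t ^ n * (\<Sum>k<n. R k t)) \<in> O[nhds 0](\<lambda>t. t ^ n)"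
    by (rule isCont_power_mult_bigo) (intro continuous_intros, use R(1) in simp)
  have eq: "f (p t) - (\<Sum>k<n. taylor_coeff f k * p t ^ k) + t ^ n * (\<Sum>k<n. R k t)
      = f (p t) - (\<Sum>j<n. (\<Sum>k<n. taylor_coeff f k * c k j) * t ^ j)" for t
  proof -
    have "(\<Sum>k<n. taylor_coeff f k * p t ^ k)
        = (\<Sum>k<n. (\<Sum>j<n. taylor_coeff f k * c k j * t ^ j) + t ^ n * R k t)"
      by (intro sum.cong refl) (use R(2) in simp)
    also have "\<dots> = (\<Sum>j<n. (\<Sum>k<n. taylor_coeff f k * c k j) * t ^ j) + t ^ n * (\<Sum>k<n. R k t)"
      unfolding sum.distrib sum_distrib_left sum_distrib_right by (subst sum.swap) (rule refl)
    finally show ?thesis by simp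
  qed
  show ?thesis
    by (rule taylor_coeff_unique[OF s _ j, where a = "\<lambda>j. \<Sum>k<n. taylor_coeff f k * c k j"])
      (use sum_in_bigo(1)[OF 1 2] in \<open>simp only: eq\<close>)
qed

lemma taylor_coeff_monomial: "taylor_coeff (\<lambda>t. c * t ^ n) k = (if k = n then c else 0)"
proof -
  have "smooth_germ (\<lambda>t::real. t ^ n)"
    unfolding smooth_germ_iff_Ck_at by (intro Ck_at_intros)
  from taylor_coeff_cmult[OF this, of c k] show ?thesis
    by (simp add: taylor_coeff_power)
qed

subsection \<open>Germs factoring through a cusp\<close>

text \<open>Of \<open>F\<close> only the gradient \<open>(a, b)\<close> at 0 is recorded: two such
  factorisations, one for each component of a curve, form a local diffeomorphism as soon as the
  determinant of the two gradients is nonzero.\<close>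

definition factors_through :: "(real \<Rightarrow> real^2) \<Rightarrow> real \<Rightarrow> real \<Rightarrow> (real \<Rightarrow> real) \<Rightarrow> bool" where
  "factors_through N a b f \<longleftrightarrow> (\<exists>F. Ck_at \<infinity> 0 F \<and>
     (F has_derivative (\<lambda>v. a * v $ 1 + b * v $ 2)) (at 0) \<and> (\<forall>\<^sub>F t in nhds 0. f t = F (N t)))"

lemma smooth_germ_compose_coordinate:
  fixes h :: "real \<Rightarrow> real"
  assumes "smooth_germ h"
  shows "Ck_at \<infinity> (0 :: real^2) (\<lambda>v. h (v $ i))"
    and "((\<lambda>v. h (v $ i)) has_derivative (\<lambda>v. taylor_coeff h 1 * v $ i)) (at (0 :: real^2))"
proof -
  show "Ck_at \<infinity> (0 :: real^2) (\<lambda>v. h (v $ i))"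
    by (rule Ck_at_compose[where f = "\<lambda>v. v $ i"])
      (use assms in \<open>simp_all add: smooth_germ_iff_Ck_at Ck_at_vec_nth[OF Ck_at_id]\<close>)
  have "(h has_derivative (\<lambda>x. taylor_coeff h 1 * x)) (at ((0 :: real^2) $ i))"
    using eventually_nhds_x_imp_x[OF smooth_germ_deriv(2)[OF assms]]
    by (simp add: has_field_derivative_def taylor_coeff_def)
  from has_derivative_compose[OF bounded_linear.has_derivative[OF bounded_linear_vec_nth has_derivative_ident] this]
  show "((\<lambda>v. h (v $ i)) has_derivative (\<lambda>v. taylor_coeff h 1 * v $ i)) (at (0 :: real^2))" .
qed

text \<open>At a zero of \<open>W\<close> the product rule loses the term with the derivative of
  \<open>A\<close>, so of that factor only the value enters and no formula for its
  derivative.\<close>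

lemma has_derivative_mult_at_zero:
  fixes A W :: "'a::real_normed_vector \<Rightarrow> real"
  assumes "A differentiable (at p)" "(W has_derivative W') (at p)" "W p = 0" "A p = a"
  shows "((\<lambda>v. A v * W v) has_derivative (\<lambda>v. a * W' v)) (at p)"
proof -
  obtain A' where "(A has_derivative A') (at p)"
    using assms(1) unfolding differentiable_def by blast
  from has_derivative_mult[OF this assms(2)] show ?thesis
    by (simp add: assms(3,4))
qed

lemma Ck_at_infty_differentiable:
  "Ck_at \<infinity> p f \<Longrightarrow> f differentiable (at p)"
  using eventually_nhds_x_imp_x[OF Ck_at_differentiable[of \<infinity> p f]] by simp

lemma has_derivative_coordinate: "((\<lambda>v::real^2. v $ i) has_derivative (\<lambda>v. v $ i)) (at p)"
  by (intro bounded_linear.has_derivative[OF bounded_linear_vec_nth] has_derivative_ident)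

text \<open>The semigroup generated by 2 and 3 has the single gap 1, and the factor map is
  \<open>h 0 X + h 1 X * Y\<close>.\<close>

lemma factors_through_cusp_3_2:
  assumes f: "smooth_germ f" and c: "taylor_coeff f 1 = 0"
  shows "factors_through (\<lambda>t. vector [t ^ 2, t ^ 3]) (taylor_coeff f 2) (taylor_coeff f 3) f"
proof -
  have ex: "j = 0 \<or> j = 1" if "j < 2" for j :: nat using that by auto
  obtain h where h: "\<And>j. j < 2 \<Longrightarrow> smooth_germ (h j)"
    "\<And>j i. j < 2 \<Longrightarrow> taylor_coeff (h j) i = taylor_coeff f (2 * i + (\<lambda>j. 3 * j) j)"
    "\<And>t. f t = (\<Sum>j<2. t ^ (\<lambda>j. 3 * j) j * h j (t ^ 2))"
  proof (rule smooth_germ_power_division[OF f, of 2 "\<lambda>j. 3 * j"])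
    show "taylor_coeff f n = 0" if "n < 3 * (n mod 2)" for n
      using that c by (cases "n = 1") (auto, presburger)
  qed (auto dest: ex)
  define F :: "real^2 \<Rightarrow> real" where "F v = h 0 (v $ 1) + h 1 (v $ 1) * v $ 2" for v
  note s = smooth_germ_compose_coordinate[OF h(1)]
  have "Ck_at \<infinity> 0 F"
    unfolding F_def by (intro Ck_at_add Ck_at_mult Ck_at_vec_nth Ck_at_id s(1)) auto
  moreover have "(F has_derivative (\<lambda>v. taylor_coeff f 2 * v $ 1 + taylor_coeff f 3 * v $ 2)) (at 0)"
    unfolding F_def
    by (intro has_derivative_add has_derivative_mult_at_zero[OF Ck_at_infty_differentiable has_derivative_coordinate] s(1))
      (use s(2)[of 0 1] h(2)[of 0 1] h(2)[of 1 0] in \<open>simp_all add: taylor_coeff_0 eval_nat_numeral\<close>)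
  moreover have "f t = F (vector [t ^ 2, t ^ 3])" for t
    by (simp add: h(3) F_def eval_nat_numeral mult_ac)
  ultimately show ?thesis
    unfolding factors_through_def by (intro exI[of _ F]) simp
qed

text \<open>The semigroup generated by 3 and 4 has the gaps 1, 2, 5; the least elements 0, 4, 8 of
  the residue classes modulo 3 are the degrees of 1, \<open>Y\<close> and
  \<open>Y^2\<close>.\<close>

lemma factors_through_cusp_4_3:
  assumes f: "smooth_germ f" and c: "taylor_coeff f 1 = 0" "taylor_coeff f 2 = 0" "taylor_coeff f 5 = 0"
  shows "factors_through (\<lambda>t. vector [t ^ 3, t ^ 4]) (taylor_coeff f 3) (taylor_coeff f 4) f"
proof -
  have ex: "j = 0 \<or> j = 1 \<or> j = 2" if "j < 3" for j :: nat using that by auto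
  obtain h where h: "\<And>j. j < 3 \<Longrightarrow> smooth_germ (h j)"
    "\<And>j i. j < 3 \<Longrightarrow> taylor_coeff (h j) i = taylor_coeff f (3 * i + (\<lambda>j. 4 * j) j)"
    "\<And>t. f t = (\<Sum>j<3. t ^ (\<lambda>j. 4 * j) j * h j (t ^ 3))"
  proof (rule smooth_germ_power_division[OF f, of 3 "\<lambda>j. 4 * j"])
    show "taylor_coeff f n = 0" if "n < 4 * (n mod 3)" for n
    proof -
      have "n = 1 \<or> n = 2 \<or> n = 5" using that by presburger
      then show ?thesis using c by auto
    qed
  qed (auto dest: ex)
  define F :: "real^2 \<Rightarrow> real" where "F v = h 0 (v $ 1) + (h 1 (v $ 1) + h 2 (v $ 1) * v $ 2) * v $ 2" for v
  note s = smooth_germ_compose_coordinate[OF h(1)]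
  have "Ck_at \<infinity> 0 F"
    unfolding F_def by (intro Ck_at_add Ck_at_mult Ck_at_vec_nth Ck_at_id s(1)) auto
  moreover have "(F has_derivative (\<lambda>v. taylor_coeff f 3 * v $ 1 + taylor_coeff f 4 * v $ 2)) (at 0)"
    unfolding F_def
    by (intro has_derivative_add has_derivative_mult_at_zero[OF Ck_at_infty_differentiable has_derivative_coordinate]
          Ck_at_add Ck_at_mult Ck_at_vec_nth Ck_at_id s(1))
      (use s(2)[of 0 1] h(2)[of 0 1] h(2)[of 1 0] in \<open>simp_all add: taylor_coeff_0 eval_nat_numeral\<close>)
  moreover have "f t = F (vector [t ^ 3, t ^ 4])" for t
    by (simp add: h(3) F_def eval_nat_numeral algebra_simps)
  ultimately show ?thesis
    unfolding factors_through_def by (intro exI[of _ F]) simp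
qed

text \<open>The semigroup generated by 4 and 5 has the gaps 1, 2, 3, 6, 7, 11. For
  \<open>Y = t^5 + \<epsilon> t^7\<close> the functions \<open>Y\<close> and \<open>X Y\<close>
  carry \<open>t^7\<close> and \<open>t^11\<close> along with \<open>t^5\<close> and
  \<open>t^9\<close>, so in degrees 7 and 11 the conditions are relations instead of
  vanishing.\<close>

lemma factors_through_cusp_5_4:
  assumes f: "smooth_germ f"
    and c: "taylor_coeff f 1 = 0" "taylor_coeff f 2 = 0" "taylor_coeff f 3 = 0" "taylor_coeff f 6 = 0"
      "taylor_coeff f 7 = \<epsilon> * taylor_coeff f 5" "taylor_coeff f 11 = \<epsilon> * taylor_coeff f 9"
  shows "factors_through (\<lambda>t. vector [t ^ 4, t ^ 5 + \<epsilon> * t ^ 7]) (taylor_coeff f 4) (taylor_coeff f 5) f"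
proof -
  define c5 c9 where "c5 = taylor_coeff f 5" and "c9 = taylor_coeff f 9"
  \<comment> \<open>This is \<open>- (c5 + c9 X) Y\<close> written in \<open>t\<close>. Adding it
    clears the degrees 5, 7, 9 and 11 at once, so that in the residue classes of 1 and 3 modulo 4
    only degrees from 13 and 15 on remain.\<close>
  define P where "P t = - c5 * t ^ 5 + (- \<epsilon> * c5) * t ^ 7 + (- c9) * t ^ 9 + (- \<epsilon> * c9) * t ^ 11" for t :: real
  define g where "g t = f t + P t" for t
  have mono: "smooth_germ (\<lambda>t::real. a * t ^ n)" for a n
    unfolding smooth_germ_iff_Ck_at by (intro Ck_at_intros)
  have P: "smooth_germ P"
    unfolding P_def by (intro smooth_germ_add mono)
  have g: "smooth_germ g"
    unfolding g_def by (intro smooth_germ_add f P)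
  have tg: "taylor_coeff g n = taylor_coeff f n + ((if n = 5 then - c5 else 0) + (if n = 7 then - \<epsilon> * c5 else 0)
      + (if n = 9 then - c9 else 0) + (if n = 11 then - \<epsilon> * c9 else 0))" for n
    unfolding g_def taylor_coeff_add[OF f P]
    unfolding P_def[abs_def] by (simp only: taylor_coeff_add smooth_germ_add mono taylor_coeff_monomial)
  \<comment> \<open>\<open>g\<close> has no Taylor coefficient of degree \<open>n < e (n mod 4)\<close>\<close>
  define e where "e = (!) [0, 13, 10, 15 :: nat]"
  have ex: "j = 0 \<or> j = 1 \<or> j = 2 \<or> j = 3" if "j < 4" for j :: nat using that by auto
  obtain h where h: "\<And>j. j < 4 \<Longrightarrow> smooth_germ (h j)"
    "\<And>j i. j < 4 \<Longrightarrow> taylor_coeff (h j) i = taylor_coeff g (4 * i + e j)"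
    "\<And>t. g t = (\<Sum>j<4. t ^ e j * h j (t ^ 4))"
  proof (rule smooth_germ_power_division[OF g, of 4 e])
    show "e j mod 4 = j" if "j < 4" for j
      using ex[OF that] by (auto simp: e_def)
    show "taylor_coeff g n = 0" if "n < e (n mod 4)" for n
    proof -
      have "n mod 4 = 0 \<or> n mod 4 = 1 \<or> n mod 4 = 2 \<or> n mod 4 = 3" by presburger
      then have "(n mod 4 = 1 \<and> n < 13) \<or> (n mod 4 = 2 \<and> n < 10) \<or> (n mod 4 = 3 \<and> n < 15)"
        using that by (auto simp: e_def)
      then have "n \<in> {1, 5, 9, 2, 6, 3, 7, 11}" by simp presburger
      then show ?thesis
        using c by (auto simp: tg c5_def c9_def)
    qed
  qed (auto simp: e_def)
  define A2 A1 A3 where "A2 v = h 2 (v $ 1) / (1 + \<epsilon>\<^sup>2 * v $ 1)"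
    and "A1 v = h 1 (v $ 1) / (1 - \<epsilon> ^ 4 * (v $ 1)\<^sup>2)"
    and "A3 v = h 3 (v $ 1) / (1 - \<epsilon> ^ 4 * (v $ 1)\<^sup>2)" for v :: "real^2"
  \<comment> \<open>With \<open>X = t\<^sup>4\<close> and \<open>Y = t\<^sup>5 + \<epsilon> t\<^sup>7\<close>, the factors of \<open>A2\<close>, \<open>A1\<close>, \<open>A3\<close> solve the linear system that
    expresses \<open>Y\<close>, \<open>Y\<^sup>2\<close>, \<open>Y\<^sup>3\<close> through \<open>t\<close>, \<open>t\<^sup>2\<close>, \<open>t\<^sup>3\<close> over functions of \<open>X\<close>; they equal
    \<open>t\<^sup>1\<^sup>0\<close>, \<open>t\<^sup>1\<^sup>3\<close>, \<open>t\<^sup>1\<^sup>5\<close> up to the denominators.\<close>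
  define F :: "real^2 \<Rightarrow> real" where "F v = h 0 (v $ 1) + (c5 + c9 * v $ 1) * v $ 2
      + A2 v * ((v $ 2)\<^sup>2 - 2 * \<epsilon> * (v $ 1) ^ 3)
      + A1 v * ((1 + 3 * \<epsilon>\<^sup>2 * v $ 1) * (v $ 1)\<^sup>2 * v $ 2 - \<epsilon> * (v $ 2) ^ 3)
      + A3 v * ((v $ 2) ^ 3 - (3 * \<epsilon> * v $ 1 + \<epsilon> ^ 3 * (v $ 1)\<^sup>2) * (v $ 1)\<^sup>2 * v $ 2)" for v
  note s = smooth_germ_compose_coordinate[OF h(1)]
  have A: "Ck_at \<infinity> 0 A1" "Ck_at \<infinity> 0 A2" "Ck_at \<infinity> 0 A3"
    unfolding A1_def A2_def A3_def
    by (intro Ck_at_divide Ck_at_add Ck_at_diff Ck_at_mult Ck_at_power Ck_at_vec_nth Ck_at_id Ck_at_const s(1); simp)+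
  have "Ck_at \<infinity> 0 F"
    unfolding F_def
    by (intro Ck_at_add Ck_at_diff Ck_at_mult Ck_at_power Ck_at_vec_nth Ck_at_id Ck_at_const s(1) A) auto
  moreover have "(F has_derivative (\<lambda>v. taylor_coeff f 4 * v $ 1 + c5 * v $ 2 + A2 0 * 0 + A1 0 * 0 + A3 0 * 0)) (at 0)"
    unfolding F_def
  proof (intro has_derivative_add)
    show "((\<lambda>v. h 0 (v $ 1)) has_derivative (\<lambda>v. taylor_coeff f 4 * v $ 1)) (at (0 :: real^2))"
      using s(2)[of 0 1] h(2)[of 0 1] by (simp add: e_def tg)
    show "((\<lambda>v. (c5 + c9 * v $ 1) * v $ 2) has_derivative (\<lambda>v. c5 * v $ 2)) (at (0 :: real^2))"
      by (rule has_derivative_mult_at_zero[OF Ck_at_infty_differentiable has_derivative_coordinate])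
        (auto intro!: Ck_at_intros)
    show "((\<lambda>v. A2 v * ((v $ 2)\<^sup>2 - 2 * \<epsilon> * (v $ 1) ^ 3)) has_derivative (\<lambda>v. A2 0 * 0)) (at 0)"
      by (rule has_derivative_mult_at_zero[OF Ck_at_infty_differentiable[OF A(2)]])
        (auto intro!: derivative_eq_intros has_derivative_coordinate)
    show "((\<lambda>v. A1 v * ((1 + 3 * \<epsilon>\<^sup>2 * v $ 1) * (v $ 1)\<^sup>2 * v $ 2 - \<epsilon> * (v $ 2) ^ 3)) has_derivative (\<lambda>v. A1 0 * 0)) (at 0)"
      by (rule has_derivative_mult_at_zero[OF Ck_at_infty_differentiable[OF A(1)]])
        (auto intro!: derivative_eq_intros has_derivative_coordinate)
    show "((\<lambda>v. A3 v * ((v $ 2) ^ 3 - (3 * \<epsilon> * v $ 1 + \<epsilon> ^ 3 * (v $ 1)\<^sup>2) * (v $ 1)\<^sup>2 * v $ 2)) has_derivative (\<lambda>v. A3 0 * 0)) (at 0)"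
      by (rule has_derivative_mult_at_zero[OF Ck_at_infty_differentiable[OF A(3)]])
        (auto intro!: derivative_eq_intros has_derivative_coordinate)
  qed
  then have "(F has_derivative (\<lambda>v. taylor_coeff f 4 * v $ 1 + taylor_coeff f 5 * v $ 2)) (at 0)"
    by (simp add: c5_def)
  moreover have "\<forall>\<^sub>F t in nhds 0. f t = F (vector [t ^ 4, t ^ 5 + \<epsilon> * t ^ 7])"
  proof -
    have "((\<lambda>t::real. 1 + \<epsilon>\<^sup>2 * t ^ 4) \<longlongrightarrow> 1 + \<epsilon>\<^sup>2 * 0 ^ 4) (nhds 0)"
      "((\<lambda>t::real. 1 - \<epsilon> ^ 4 * (t ^ 4)\<^sup>2) \<longlongrightarrow> 1 - \<epsilon> ^ 4 * (0 ^ 4)\<^sup>2) (nhds 0)"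
      by (intro tendsto_intros filterlim_ident)+
    from this[THEN tendsto_imp_eventually_ne, of 0]
    have "\<forall>\<^sub>F t in nhds 0. 1 + \<epsilon>\<^sup>2 * t ^ 4 \<noteq> 0" "\<forall>\<^sub>F t in nhds 0. 1 - \<epsilon> ^ 4 * (t ^ 4)\<^sup>2 \<noteq> 0"
      by simp_all
    then show ?thesis
    proof eventually_elim
      case (elim t)
      define X Y where "X = t ^ 4" and "Y = t ^ 5 + \<epsilon> * t ^ 7"
      have nz: "1 + \<epsilon>\<^sup>2 * X \<noteq> 0" "1 - \<epsilon> ^ 4 * X\<^sup>2 \<noteq> 0"
        using elim by (simp_all add: X_def)
      have "Y\<^sup>2 - 2 * \<epsilon> * X ^ 3 = t ^ 10 * (1 + \<epsilon>\<^sup>2 * X)"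
        "(1 + 3 * \<epsilon>\<^sup>2 * X) * X\<^sup>2 * Y - \<epsilon> * Y ^ 3 = t ^ 13 * (1 - \<epsilon> ^ 4 * X\<^sup>2)"
        "Y ^ 3 - (3 * \<epsilon> * X + \<epsilon> ^ 3 * X\<^sup>2) * X\<^sup>2 * Y = t ^ 15 * (1 - \<epsilon> ^ 4 * X\<^sup>2)"
        unfolding X_def Y_def by algebra+
      then have "F (vector [X, Y]) = h 0 X + (c5 + c9 * X) * Y + t ^ 10 * h 2 X + t ^ 13 * h 1 X + t ^ 15 * h 3 X"
        using nz by (simp add: F_def A1_def A2_def A3_def)
      moreover have "f t = g t + (c5 + c9 * X) * Y"
        unfolding g_def P_def X_def Y_def by algebra
      moreover have "g t = h 0 X + t ^ 13 * h 1 X + t ^ 10 * h 2 X + t ^ 15 * h 3 X"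
        by (simp add: h(3) e_def X_def lessThan_nat_numeral lessThan_Suc eval_nat_numeral(2-))
      ultimately show ?case
        by (simp add: X_def Y_def)
    qed
  qed
  ultimately show ?thesis
    unfolding factors_through_def by blast
qed

text \<open>The components in the frame \<open>e\<^sub>1\<close>, \<open>e\<^sub>2\<close> become
  the coordinates of a map of the plane whose Jacobian at 0 is the product of the two determinants
  assumed nonzero. The map \<open>K\<close>, tangent to the identity, leaves room for a change of
  model that is merely of class C^1.\<close>

lemma Ck_equivalent_of_factors_through:
  fixes S N N\<^sub>0 :: "real \<Rightarrow> real^2"
  assumes k: "1 \<le> k" and \<tau>: "smooth_germ \<tau>" "\<tau> 0 = 0" "(\<tau> has_real_derivative d) (at 0)" "d \<noteq> 0"
    and S: "\<forall>\<^sub>F t in nhds 0. S (\<tau> t) = S\<^sub>0 + x t *\<^sub>R e\<^sub>1 + y t *\<^sub>R e\<^sub>2"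
    and e: "e\<^sub>1 $ 1 * e\<^sub>2 $ 2 - e\<^sub>1 $ 2 * e\<^sub>2 $ 1 \<noteq> 0"
    and xy: "factors_through N a\<^sub>1 a\<^sub>2 x" "factors_through N b\<^sub>1 b\<^sub>2 y" "a\<^sub>1 * b\<^sub>2 - a\<^sub>2 * b\<^sub>1 \<noteq> 0"
    and K: "Ck_at k 0 K" "(K has_derivative (\<lambda>v. v)) (at 0)" "K 0 = 0" "\<And>t. N t = K (N\<^sub>0 t)"
    and N\<^sub>0: "isCont N\<^sub>0 0" "N\<^sub>0 0 = 0"
  shows "Ck_equivalent k S N\<^sub>0"
proof -
  obtain A where A: "Ck_at \<infinity> 0 A" "(A has_derivative (\<lambda>v. a\<^sub>1 * v $ 1 + a\<^sub>2 * v $ 2)) (at 0)"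
    "\<forall>\<^sub>F t in nhds 0. x t = A (N t)"
    using xy(1) unfolding factors_through_def by blast
  obtain B where B: "Ck_at \<infinity> 0 B" "(B has_derivative (\<lambda>v. b\<^sub>1 * v $ 1 + b\<^sub>2 * v $ 2)) (at 0)"
    "\<forall>\<^sub>F t in nhds 0. y t = B (N t)"
    using xy(2) unfolding factors_through_def by blast
  define \<Psi> where "\<Psi> v = S\<^sub>0 + A (K v) *\<^sub>R e\<^sub>1 + B (K v) *\<^sub>R e\<^sub>2" for v
  define P where "P v = (a\<^sub>1 * v $ 1 + a\<^sub>2 * v $ 2) *\<^sub>R e\<^sub>1 + (b\<^sub>1 * v $ 1 + b\<^sub>2 * v $ 2) *\<^sub>R e\<^sub>2" for v :: "real^2"
  have AK: "Ck_at k 0 (\<lambda>v. A (K v))" "Ck_at k 0 (\<lambda>v. B (K v))"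
    using Ck_at_compose[OF _ K(1), of A] Ck_at_compose[OF _ K(1), of B] Ck_at_mono[OF A(1)] Ck_at_mono[OF B(1)] K(3)
    by simp_all
  have dAK: "((\<lambda>v. A (K v)) has_derivative (\<lambda>v. a\<^sub>1 * v $ 1 + a\<^sub>2 * v $ 2)) (at 0)"
      "((\<lambda>v. B (K v)) has_derivative (\<lambda>v. b\<^sub>1 * v $ 1 + b\<^sub>2 * v $ 2)) (at 0)"
    using has_derivative_compose[OF K(2), of A] has_derivative_compose[OF K(2), of B] A(2) B(2) K(3) by simp_all
  have d\<Psi>: "(\<Psi> has_derivative P) (at 0)"
    unfolding \<Psi>_def[abs_def] P_def[abs_def]
    by (rule derivative_eq_intros dAK refl)+ simp
  have C\<Psi>: "Ck_at k 0 \<Psi>"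
    unfolding \<Psi>_def[abs_def] by (intro Ck_at_add Ck_at_scaleR Ck_at_const AK)
  have det: "P (axis 1 1) $ 1 * P (axis 2 1) $ 2 - P (axis 1 1) $ 2 * P (axis 2 1) $ 1
      = (a\<^sub>1 * b\<^sub>2 - a\<^sub>2 * b\<^sub>1) * (e\<^sub>1 $ 1 * e\<^sub>2 $ 2 - e\<^sub>1 $ 2 * e\<^sub>2 $ 1)"
    by (simp add: P_def axis_def algebra_simps)
  have eq: "\<forall>\<^sub>F t in nhds 0. S (\<tau> t) = \<Psi> (N\<^sub>0 t)"
    using S A(3) B(3) by eventually_elim (simp add: \<Psi>_def K(4))
  have C\<tau>: "Ck_at k 0 \<tau>"
    using \<tau>(1) unfolding smooth_germ_iff_Ck_at by (rule Ck_at_mono) simp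
  show ?thesis
    by (rule Ck_equivalentI[OF k C\<tau> \<tau>(2-4) N\<^sub>0 C\<Psi> d\<Psi> _ eq]) (use e xy(3) det in simp)
qed

text \<open>\<open>(X, Y) \<mapsto> (X, Y + \<epsilon> Y\<^bsup>7/5\<^esup>)\<close> is of class C^1 and maps \<open>(t\<^sup>4, t\<^sup>5)\<close> to \<open>(t\<^sup>4, t\<^sup>5 + \<epsilon> t\<^sup>7)\<close>.\<close>

lemma C1_shear_5_4:
  fixes \<epsilon> :: real
  obtains K :: "real^2 \<Rightarrow> real^2" where "Ck_at 1 0 K" "(K has_derivative (\<lambda>v. v)) (at 0)" "K 0 = 0"
    "\<And>t. K (vector [t ^ 4, t ^ 5]) = vector [t ^ 4, t ^ 5 + \<epsilon> * t ^ 7]"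
proof -
  \<comment> \<open>This is \<open>z^(7/5)\<close> for both signs of \<open>z\<close>: the root of
    the square is \<open>\<bar>z\<bar>^(2/5)\<close>. The same continuous factor reappears in the
    derivative, which gives class C^1.\<close>
  define r where "r z = z * root 5 (z\<^sup>2)" for z :: real
  have r: "(r has_real_derivative 7 / 5 * root 5 (z\<^sup>2)) (at z)" for z
  proof (cases "z = 0")
    case True
    have "((\<lambda>h. root 5 (h\<^sup>2)) \<longlongrightarrow> root 5 (0\<^sup>2)) (at (0::real))"
      by (intro tendsto_intros)
    then have "((\<lambda>h. root 5 (h\<^sup>2)) \<longlongrightarrow> 0) (at (0::real))"
      by simp
    then have "((\<lambda>h. r h / h) \<longlongrightarrow> 0) (at 0)"
      by (rule Lim_transform_eventually) (simp add: eventually_at_filter r_def)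
    then show ?thesis
      using True by (simp add: DERIV_def r_def)
  next
    case False
    define q where "q = root 5 (z\<^sup>2)"
    have q: "q > 0" "q ^ 5 = z\<^sup>2" using False by (simp_all add: q_def)
    have "(r has_real_derivative 1 * root 5 (z\<^sup>2) + (inverse (real 5 * root 5 (z\<^sup>2) ^ (5 - Suc 0)) * (2 * z)) * z) (at z)"
      unfolding r_def[abs_def]
      by (rule DERIV_mult[OF DERIV_ident DERIV_chain2[OF DERIV_real_root]])
        (use False in \<open>auto intro!: derivative_eq_intros\<close>)
    also have "1 * root 5 (z\<^sup>2) + (inverse (real 5 * root 5 (z\<^sup>2) ^ (5 - Suc 0)) * (2 * z)) * z = q + 2 * (q ^ 5) / (5 * q ^ 4)"
      unfolding q(2) unfolding q_def[symmetric] by (simp add: field_simps power2_eq_square)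
    also have "\<dots> = 7 / 5 * q"
      using q(1) by (simp add: field_simps eval_nat_numeral)
    finally show ?thesis by (simp add: q_def)
  qed
  have "higher_differentiable_on UNIV r (Suc 0)"
    by (rule higher_differentiable_on_real_SucI[OF open_UNIV r]) (auto intro!: continuous_intros)
  moreover have "higher_differentiable_on UNIV r 0"
    using r by (auto intro!: continuous_at_imp_continuous_on DERIV_isCont)
  moreover have "n = 0 \<or> n = Suc 0" if "enat n \<le> 1" for n
    using that by (auto simp: one_enat_def)
  ultimately have "Ck_on 1 UNIV r"
    unfolding Ck_on_def by blast
  then have Cr: "Ck_at 1 z r" for z by (rule Ck_atI[rotated 2]) auto
  define K :: "real^2 \<Rightarrow> real^2" where "K v = vector [v $ 1, v $ 2 + \<epsilon> * r (v $ 2)]" for v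
  have "Ck_at 1 0 K"
    unfolding K_def[abs_def]
    by (intro Ck_at_vector_2 Ck_at_add Ck_at_mult Ck_at_const Ck_at_vec_nth Ck_at_id
        Ck_at_compose[where f = "\<lambda>v. v $ 2" and g = r] Cr)
  moreover have "(K has_derivative (\<lambda>v. v)) (at 0)"
  proof -
    have "(r has_derivative (\<lambda>h. 0)) (at ((0 :: real^2) $ 2))"
      using r[of 0] by (simp add: has_field_derivative_def lambda_zero)
    from has_derivative_compose[OF has_derivative_coordinate this]
    have "((\<lambda>v::real^2. r (v $ 2)) has_derivative (\<lambda>v. 0)) (at 0)" .
    then have "((\<lambda>v::real^2. v + (\<epsilon> * r (v $ 2)) *\<^sub>R axis 2 1) has_derivative (\<lambda>v. v + (\<epsilon> * 0) *\<^sub>R axis 2 1)) (at 0)"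
      by (intro derivative_intros has_derivative_mult_right)
    moreover have "K = (\<lambda>v. v + (\<epsilon> * r (v $ 2)) *\<^sub>R axis 2 1)"
      by (rule ext) (simp add: K_def vec_eq_iff forall_2 axis_def)
    ultimately show ?thesis by simp
  qed
  moreover have "K 0 = 0" by (simp add: K_def r_def vec_eq_iff forall_2)
  moreover have "K (vector [t ^ 4, t ^ 5]) = vector [t ^ 4, t ^ 5 + \<epsilon> * t ^ 7]" for t
  proof -
    have "root 5 ((t ^ 5)\<^sup>2) = root 5 ((t\<^sup>2) ^ 5)" by (simp add: power_mult[symmetric])
    also have "\<dots> = t\<^sup>2" by (rule real_root_power_cancel) auto
    finally have "r (t ^ 5) = t ^ 7" by (simp add: r_def power_add[symmetric])
    then show ?thesis by (simp add: K_def)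
  qed
  ultimately show thesis using that by blast
qed

subsection \<open>Jets under polynomial reparametrisations\<close>

lemma taylor_coeff_cos_sin:
  "taylor_coeff cos 0 = 1" "taylor_coeff cos (Suc 0) = 0" "taylor_coeff cos (Suc (Suc 0)) = - (1 / 2)"
  "taylor_coeff sin 0 = 0" "taylor_coeff sin (Suc 0) = 1" "taylor_coeff sin (Suc (Suc 0)) = 0"
  "taylor_coeff sin (Suc (Suc (Suc 0))) = - (1 / 6)"
proof -
  have d: "deriv sin = (cos :: real \<Rightarrow> real)" "deriv cos = (\<lambda>x::real. - sin x)"
    "deriv (\<lambda>x::real. - sin x) = (\<lambda>x. - cos x)"
    by (auto intro!: ext DERIV_imp_deriv derivative_eq_intros)
  show "taylor_coeff cos 0 = 1" "taylor_coeff cos (Suc 0) = 0" "taylor_coeff cos (Suc (Suc 0)) = - (1 / 2)"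
    "taylor_coeff sin 0 = 0" "taylor_coeff sin (Suc 0) = 1" "taylor_coeff sin (Suc (Suc 0)) = 0"
    "taylor_coeff sin (Suc (Suc (Suc 0))) = - (1 / 6)"
    by (simp_all add: taylor_coeff_def d)
qed

lemma smooth_germ_id: "smooth_germ (\<lambda>t::real. t)"
  unfolding smooth_germ_iff_Ck_at by (rule Ck_at_id)

lemma taylor_coeff_id: "taylor_coeff (\<lambda>t. t) k = (if k = 1 then 1 else 0)"
  using taylor_coeff_power[of 1 k] by simp

lemma isCont_vector_2: "isCont (\<lambda>t. vector [f t, g t] :: real^2) a" if "isCont f a" "isCont g a" for f g :: "real \<Rightarrow> real"
proof -
  have "vector [f t, g t] = f t *\<^sub>R axis 1 1 + g t *\<^sub>R (axis 2 1 :: real^2)" for t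
    by (simp add: vec_eq_iff forall_2 axis_def)
  then show ?thesis using that by (simp add: continuous_intros)
qed


lemma smooth_germ_power: "smooth_germ (\<lambda>t::real. t ^ n)"
  unfolding smooth_germ_iff_Ck_at by (intro Ck_at_intros)

lemmas smooth_germ_polynomial = smooth_germ_add smooth_germ_cmult smooth_germ_mult smooth_germ_const
  smooth_germ_power smooth_germ_id

lemma sum_lessThan_6: "(\<Sum>j<6. g j) = g 0 + g 1 + g 2 + g 3 + g 4 + g 5" for g :: "nat \<Rightarrow> real"
  by (simp add: eval_nat_numeral)

lemma sum_lessThan_8: "(\<Sum>j<8. g j) = g 0 + g 1 + g 2 + g 3 + g 4 + g 5 + g 6 + g 7" for g :: "nat \<Rightarrow> real"
  by (simp add: eval_nat_numeral)

lemma sum_lessThan_12: "(\<Sum>j<12. g j) = g 0 + g 1 + g 2 + g 3 + g 4 + g 5 + g 6 + g 7 + g 8 + g 9 + g 10 + g 11"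
  for g :: "nat \<Rightarrow> real"
  by (simp add: eval_nat_numeral)

text \<open>Up to degree 5, the last gap for the exponents 3 and 4, one has
  \<open>p^3 = t^3 + 3\<alpha> t^4 + (3\<beta> + 3\<alpha>^2) t^5\<close> and
  \<open>p^4 = t^4 + 4\<alpha> t^5\<close>; the lists in \<open>c\<close> are these rows.\<close>

lemma taylor_coeff_compose_cubic:
  fixes \<alpha> \<beta> :: real
  assumes f: "smooth_germ f" "taylor_coeff f 0 = 0" "taylor_coeff f 1 = 0" "taylor_coeff f 2 = 0"
    and p: "p = (\<lambda>t. t + \<alpha> * t ^ 2 + \<beta> * t ^ 3)"
  shows "taylor_coeff (\<lambda>t. f (p t)) 1 = 0" "taylor_coeff (\<lambda>t. f (p t)) 2 = 0"
    "taylor_coeff (\<lambda>t. f (p t)) 3 = taylor_coeff f 3"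
    "taylor_coeff (\<lambda>t. f (p t)) 4 = taylor_coeff f 4 + 3 * \<alpha> * taylor_coeff f 3"
    "taylor_coeff (\<lambda>t. f (p t)) 5 = taylor_coeff f 5 + 4 * \<alpha> * taylor_coeff f 4
      + (3 * \<beta> + 3 * \<alpha>\<^sup>2) * taylor_coeff f 3"
proof -
  define c :: "nat \<Rightarrow> nat \<Rightarrow> real" where
    "c k = (!) (if k = 3 then [0, 0, 0, 1, 3 * \<alpha>, 3 * \<beta> + 3 * \<alpha>\<^sup>2]
      else if k = 4 then [0, 0, 0, 0, 1, 4 * \<alpha>] else [0, 0, 0, 0, 0, 1])" for k
  have *: "taylor_coeff (\<lambda>t. f (p t)) j = (\<Sum>k<6. taylor_coeff f k * c k j)" if "j < 6" for j
  proof (rule taylor_coeff_compose_jet[OF f(1) _ _ that])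
    show "smooth_germ p" unfolding p by (intro smooth_germ_polynomial)
    show "p 0 = 0" by (simp add: p)
    fix k :: nat assume "k < 6" "taylor_coeff f k \<noteq> 0"
    then have "k < 6" "k \<noteq> 0" "k \<noteq> 1" "k \<noteq> 2" using f(2-4) by metis+
    then have "k = 3 \<or> k = 4 \<or> k = 5" by linarith
    then consider "k = 3" | "k = 4" | "k = 5" by blast
    then show "\<exists>R. isCont R 0 \<and> (\<forall>t. p t ^ k = (\<Sum>j<6. c k j * t ^ j) + t ^ 6 * R t)"
    proof cases
      \<comment> \<open>With \<open>v = \<alpha> + \<beta> t\<close> one has
        \<open>p = t + t^2 v\<close>. The remainder collects what the binomial expansion leaves in
        degrees above 5, divided by \<open>t^6\<close>; likewise for the other powers.\<close>
      case 1
      have "isCont (\<lambda>t. 3 * (2 * \<alpha> * \<beta> + \<beta>\<^sup>2 * t) + (\<alpha> + \<beta> * t) ^ 3) 0" by (intro continuous_intros)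
      moreover have "p t ^ 3 = (\<Sum>j<6. c 3 j * t ^ j) + t ^ 6 * (3 * (2 * \<alpha> * \<beta> + \<beta>\<^sup>2 * t) + (\<alpha> + \<beta> * t) ^ 3)" for t
        by (simp add: p sum_lessThan_6 c_def) algebra
      ultimately show ?thesis using 1 by blast
    next
      case 2
      have "isCont (\<lambda>t. 4 * \<beta> + 6 * (\<alpha> + \<beta> * t)\<^sup>2 + 4 * t * (\<alpha> + \<beta> * t) ^ 3 + t\<^sup>2 * (\<alpha> + \<beta> * t) ^ 4) 0"
        by (intro continuous_intros)
      moreover have "p t ^ 4 = (\<Sum>j<6. c 4 j * t ^ j)
          + t ^ 6 * (4 * \<beta> + 6 * (\<alpha> + \<beta> * t)\<^sup>2 + 4 * t * (\<alpha> + \<beta> * t) ^ 3 + t\<^sup>2 * (\<alpha> + \<beta> * t) ^ 4)" for t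
        by (simp add: p sum_lessThan_6 c_def) algebra
      ultimately show ?thesis using 2 by blast
    next
      case 3
      define v where "v t = \<alpha> + \<beta> * t" for t
      have "isCont (\<lambda>t. 5 * v t + 10 * t * v t ^ 2 + 10 * t\<^sup>2 * v t ^ 3 + 5 * t ^ 3 * v t ^ 4 + t ^ 4 * v t ^ 5) 0"
        unfolding v_def by (intro continuous_intros)
      moreover have "p t ^ 5 = (\<Sum>j<6. c 5 j * t ^ j)
          + t ^ 6 * (5 * v t + 10 * t * v t ^ 2 + 10 * t\<^sup>2 * v t ^ 3 + 5 * t ^ 3 * v t ^ 4 + t ^ 4 * v t ^ 5)" for t
      proof -
        have pv: "p t = t + t\<^sup>2 * v t" by (simp add: p v_def algebra_simps eval_nat_numeral)
        show ?thesis unfolding pv by (simp add: sum_lessThan_6 c_def) algebra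
      qed
      ultimately show ?thesis using 3 by blast
    qed
  qed
  show "taylor_coeff (\<lambda>t. f (p t)) 1 = 0" "taylor_coeff (\<lambda>t. f (p t)) 2 = 0"
    "taylor_coeff (\<lambda>t. f (p t)) 3 = taylor_coeff f 3"
    "taylor_coeff (\<lambda>t. f (p t)) 4 = taylor_coeff f 4 + 3 * \<alpha> * taylor_coeff f 3"
    "taylor_coeff (\<lambda>t. f (p t)) 5 = taylor_coeff f 5 + 4 * \<alpha> * taylor_coeff f 4
      + (3 * \<beta> + 3 * \<alpha>\<^sup>2) * taylor_coeff f 3"
    using f(2-4) by (simp_all add: * sum_lessThan_6 c_def del: One_nat_def)
qed

text \<open>Degrees are followed up to 7, where \<open>\<gamma>\<close> enters for the first time,
  and there only through the coefficient of degree 4.\<close>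

lemma taylor_coeff_compose_quartic:
  fixes \<alpha> \<beta> \<gamma> :: real
  assumes f: "smooth_germ f" "\<forall>k<4. taylor_coeff f k = 0"
    and p: "p = (\<lambda>t. t + \<alpha> * t ^ 2 + \<beta> * t ^ 3 + \<gamma> * t ^ 4)"
  shows "k < 4 \<Longrightarrow> taylor_coeff (\<lambda>t. f (p t)) k = 0"
    "taylor_coeff (\<lambda>t. f (p t)) 4 = taylor_coeff f 4"
    "taylor_coeff (\<lambda>t. f (p t)) 5 = taylor_coeff f 5 + 4 * \<alpha> * taylor_coeff f 4"
    "taylor_coeff (\<lambda>t. f (p t)) 6 = taylor_coeff f 6 + 5 * \<alpha> * taylor_coeff f 5
      + (4 * \<beta> + 6 * \<alpha>\<^sup>2) * taylor_coeff f 4"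
    "taylor_coeff (\<lambda>t. f (p t)) 7 = taylor_coeff f 7 + 6 * \<alpha> * taylor_coeff f 6
      + (5 * \<beta> + 10 * \<alpha>\<^sup>2) * taylor_coeff f 5 + (4 * \<gamma> + 12 * \<alpha> * \<beta> + 4 * \<alpha> ^ 3) * taylor_coeff f 4"
proof -
  define c :: "nat \<Rightarrow> nat \<Rightarrow> real" where
    "c k = (!) (if k = 4 then [0, 0, 0, 0, 1, 4 * \<alpha>, 4 * \<beta> + 6 * \<alpha>\<^sup>2, 4 * \<gamma> + 12 * \<alpha> * \<beta> + 4 * \<alpha> ^ 3]
      else if k = 5 then [0, 0, 0, 0, 0, 1, 5 * \<alpha>, 5 * \<beta> + 10 * \<alpha>\<^sup>2]
      else if k = 6 then [0, 0, 0, 0, 0, 0, 1, 6 * \<alpha>] else [0, 0, 0, 0, 0, 0, 0, 1])" for k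
  \<comment> \<open>Nested form \<open>p = t + t^2 (\<alpha> + t (\<beta> + \<gamma> t))\<close>:
    expanding it to different depths peels off the terms below degree 8 and leaves polynomial
    remainders.\<close>
  define w where "w t = \<beta> + \<gamma> * t" for t
  define v where "v t = \<alpha> + t * w t" for t
  have pv: "p t = t + t\<^sup>2 * v t" for t by (simp add: p v_def w_def algebra_simps eval_nat_numeral)
  have *: "taylor_coeff (\<lambda>t. f (p t)) j = (\<Sum>k<8. taylor_coeff f k * c k j)" if "j < 8" for j
  proof (rule taylor_coeff_compose_jet[OF f(1) _ _ that])
    show "smooth_germ p" unfolding p by (intro smooth_germ_polynomial)
    show "p 0 = 0" by (simp add: p)
    fix k :: nat assume "k < 8" "taylor_coeff f k \<noteq> 0"
    then have "k < 8" "\<not> k < 4" using f(2) by blast+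
    then have "k \<in> {4, 5, 6, 7}" by force
    then consider "k = 4" | "k = 5" | "k = 6" | "k = 7" by blast
    then show "\<exists>R. isCont R 0 \<and> (\<forall>t. p t ^ k = (\<Sum>j<8. c k j * t ^ j) + t ^ 8 * R t)"
    proof cases
      case 1
      let ?R = "\<lambda>t. 12 * \<alpha> * \<gamma> + 6 * w t ^ 2 + 4 * (3 * \<alpha>\<^sup>2 * w t + 3 * \<alpha> * t * w t ^ 2 + t\<^sup>2 * w t ^ 3) + v t ^ 4"
      have "isCont ?R 0" unfolding v_def w_def by (intro continuous_intros)
      moreover have "p t ^ 4 = (\<Sum>j<8. c 4 j * t ^ j) + t ^ 8 * ?R t" for t
        unfolding pv v_def by (simp add: sum_lessThan_8 c_def w_def) algebra
      ultimately show ?thesis using 1 by (intro exI[of _ ?R]) simp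
    next
      case 2
      let ?R = "\<lambda>t. 5 * \<gamma> + 10 * (2 * \<alpha> * w t + t * w t ^ 2) + 10 * v t ^ 3 + 5 * t * v t ^ 4 + t\<^sup>2 * v t ^ 5"
      have "isCont ?R 0" unfolding v_def w_def by (intro continuous_intros)
      moreover have "p t ^ 5 = (\<Sum>j<8. c 5 j * t ^ j) + t ^ 8 * ?R t" for t
      proof -
        have "p t ^ 5 = t ^ 5 + (5 * t ^ 6 * v t + 10 * t ^ 7 * v t ^ 2) + t ^ 8 * (10 * v t ^ 3 + 5 * t * v t ^ 4 + t\<^sup>2 * v t ^ 5)"
          unfolding pv by algebra
        also have "5 * t ^ 6 * v t + 10 * t ^ 7 * v t ^ 2 = 5 * \<alpha> * t ^ 6 + (5 * \<beta> + 10 * \<alpha>\<^sup>2) * t ^ 7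
            + t ^ 8 * (5 * \<gamma> + 10 * (2 * \<alpha> * w t + t * w t ^ 2))"
          unfolding v_def w_def by algebra
        finally show ?thesis by (simp add: sum_lessThan_8 c_def algebra_simps)
      qed
      ultimately show ?thesis using 2 by (intro exI[of _ ?R]) simp
    next
      case 3
      let ?R = "\<lambda>t. 6 * w t + 15 * v t ^ 2 + 20 * t * v t ^ 3 + 15 * t\<^sup>2 * v t ^ 4 + 6 * t ^ 3 * v t ^ 5 + t ^ 4 * v t ^ 6"
      have "isCont ?R 0" unfolding v_def w_def by (intro continuous_intros)
      moreover have "p t ^ 6 = (\<Sum>j<8. c 6 j * t ^ j) + t ^ 8 * ?R t" for t
      proof -
        have "p t ^ 6 = t ^ 6 + 6 * t ^ 7 * v t
            + t ^ 8 * (15 * v t ^ 2 + 20 * t * v t ^ 3 + 15 * t\<^sup>2 * v t ^ 4 + 6 * t ^ 3 * v t ^ 5 + t ^ 4 * v t ^ 6)"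
          unfolding pv by algebra
        also have "6 * t ^ 7 * v t = 6 * \<alpha> * t ^ 7 + t ^ 8 * (6 * w t)"
          unfolding v_def by algebra
        finally show ?thesis by (simp add: sum_lessThan_8 c_def algebra_simps)
      qed
      ultimately show ?thesis using 3 by (intro exI[of _ ?R]) simp
    next
      case 4
      let ?R = "\<lambda>t. 7 * v t + 21 * t * v t ^ 2 + 35 * t\<^sup>2 * v t ^ 3 + 35 * t ^ 3 * v t ^ 4 + 21 * t ^ 4 * v t ^ 5
          + 7 * t ^ 5 * v t ^ 6 + t ^ 6 * v t ^ 7"
      have "isCont ?R 0" unfolding v_def w_def by (intro continuous_intros)
      moreover have "p t ^ 7 = (\<Sum>j<8. c 7 j * t ^ j) + t ^ 8 * ?R t" for t
        unfolding pv by (simp add: sum_lessThan_8 c_def) algebra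
      ultimately show ?thesis using 4 by (intro exI[of _ ?R]) simp
    qed
  qed
  have f0: "taylor_coeff f 0 = 0" "taylor_coeff f 1 = 0" "taylor_coeff f 2 = 0" "taylor_coeff f 3 = 0"
    using f(2) by simp_all
  show "taylor_coeff (\<lambda>t. f (p t)) k = 0" if "k < 4"
  proof -
    have "k \<in> {0, 1, 2, 3}" using that by force
    then show ?thesis using f0 by (auto simp: * sum_lessThan_8 c_def simp del: One_nat_def)
  qed
  show "taylor_coeff (\<lambda>t. f (p t)) 4 = taylor_coeff f 4"
    "taylor_coeff (\<lambda>t. f (p t)) 5 = taylor_coeff f 5 + 4 * \<alpha> * taylor_coeff f 4"
    "taylor_coeff (\<lambda>t. f (p t)) 6 = taylor_coeff f 6 + 5 * \<alpha> * taylor_coeff f 5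
      + (4 * \<beta> + 6 * \<alpha>\<^sup>2) * taylor_coeff f 4"
    "taylor_coeff (\<lambda>t. f (p t)) 7 = taylor_coeff f 7 + 6 * \<alpha> * taylor_coeff f 6
      + (5 * \<beta> + 10 * \<alpha>\<^sup>2) * taylor_coeff f 5 + (4 * \<gamma> + 12 * \<alpha> * \<beta> + 4 * \<alpha> ^ 3) * taylor_coeff f 4"
    using f0 by (simp_all add: * sum_lessThan_8 c_def del: One_nat_def)
qed

text \<open>The corrections start in degree 7 so as to preserve the relations already achieved: on a
  germ of order 4 they are first felt in degree 10, which is no gap for the exponents 4 and 5, and
  then in degree 11, the last gap. The factor \<open>l\<close> only rescales the lower
  coefficients.\<close>

lemma taylor_coeff_compose_octic:
  fixes l \<delta> \<kappa> :: real
  assumes f: "smooth_germ f" "\<forall>k<4. taylor_coeff f k = 0"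
    and q: "q = (\<lambda>t. l * t + \<delta> * t ^ 7 + \<kappa> * t ^ 8)"
  shows "k < 10 \<Longrightarrow> taylor_coeff (\<lambda>t. f (q t)) k = l ^ k * taylor_coeff f k"
    "taylor_coeff (\<lambda>t. f (q t)) 11 = l ^ 11 * taylor_coeff f 11 + 4 * l ^ 3 * \<kappa> * taylor_coeff f 4
      + 5 * l ^ 4 * \<delta> * taylor_coeff f 5"
proof -
  define c :: "nat \<Rightarrow> nat \<Rightarrow> real" where
    "c k j = (if j = k then l ^ k else if k = 4 \<and> j = 10 then 4 * l ^ 3 * \<delta>
      else if k = 4 \<and> j = 11 then 4 * l ^ 3 * \<kappa> else if k = 5 \<and> j = 11 then 5 * l ^ 4 * \<delta> else 0)" for k j
  define v where "v t = \<delta> + \<kappa> * t" for t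
  have qv: "q t = l * t + t ^ 7 * v t" for t by (simp add: q v_def algebra_simps eval_nat_numeral)
  have *: "taylor_coeff (\<lambda>t. f (q t)) j = (\<Sum>k<12. taylor_coeff f k * c k j)" if "j < 12" for j
  proof (rule taylor_coeff_compose_jet[OF f(1) _ _ that])
    show "smooth_germ q" unfolding q by (intro smooth_germ_polynomial)
    show "q 0 = 0" by (simp add: q)
    fix k :: nat assume "k < 12" "taylor_coeff f k \<noteq> 0"
    then have "k < 12" "\<not> k < 4" using f(2) by blast+
    then have "k = 4 \<or> k = 5 \<or> (6 \<le> k \<and> k < 12)" by linarith
    then consider "k = 4" | "k = 5" | "6 \<le> k" "k < 12" by blast
    then show "\<exists>R. isCont R 0 \<and> (\<forall>t. q t ^ k = (\<Sum>j<12. c k j * t ^ j) + t ^ 12 * R t)"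
    proof cases
      case 1
      let ?R = "\<lambda>t. 6 * l\<^sup>2 * t ^ 4 * v t ^ 2 + 4 * l * t ^ 10 * v t ^ 3 + t ^ 16 * v t ^ 4"
      have "isCont ?R 0" unfolding v_def by (intro continuous_intros)
      moreover have "q t ^ 4 = (\<Sum>j<12. c 4 j * t ^ j) + t ^ 12 * ?R t" for t
      proof -
        have "q t ^ 4 = l ^ 4 * t ^ 4 + 4 * l ^ 3 * t ^ 10 * v t + t ^ 12 * ?R t"
          unfolding qv by algebra
        also have "4 * l ^ 3 * t ^ 10 * v t = 4 * l ^ 3 * \<delta> * t ^ 10 + 4 * l ^ 3 * \<kappa> * t ^ 11"
          unfolding v_def by algebra
        finally show ?thesis by (simp add: sum_lessThan_12 c_def)
      qed
      ultimately show ?thesis using 1 by (intro exI[of _ ?R]) simp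
    next
      case 2
      let ?R = "\<lambda>t. 5 * l ^ 4 * \<kappa> + (10 * l ^ 3 * t ^ 5 * v t ^ 2 + 10 * l\<^sup>2 * t ^ 11 * v t ^ 3 + 5 * l * t ^ 17 * v t ^ 4
          + t ^ 23 * v t ^ 5)"
      have "isCont ?R 0" unfolding v_def by (intro continuous_intros)
      moreover have "q t ^ 5 = (\<Sum>j<12. c 5 j * t ^ j) + t ^ 12 * ?R t" for t
      proof -
        have "q t ^ 5 = l ^ 5 * t ^ 5 + 5 * l ^ 4 * t ^ 11 * v t + t ^ 12 * (10 * l ^ 3 * t ^ 5 * v t ^ 2
            + 10 * l\<^sup>2 * t ^ 11 * v t ^ 3 + 5 * l * t ^ 17 * v t ^ 4 + t ^ 23 * v t ^ 5)"
          unfolding qv by algebra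
        also have "5 * l ^ 4 * t ^ 11 * v t = 5 * l ^ 4 * \<delta> * t ^ 11 + t ^ 12 * (5 * l ^ 4 * \<kappa>)"
          unfolding v_def by algebra
        finally show ?thesis by (simp add: sum_lessThan_12 c_def algebra_simps)
      qed
      ultimately show ?thesis using 2 by (intro exI[of _ ?R]) simp
    next
      case 3
      \<comment> \<open>For \<open>k \<ge> 6\<close> the correction contributes from degree
        \<open>k + 6 \<ge> 12\<close> on; factoring a difference of k-th powers exhibits the factor
        \<open>t^6\<close> for all these \<open>k\<close> simultaneously.\<close>
      let ?X = "\<lambda>t. l + t ^ 6 * v t"
      let ?R = "\<lambda>t. t ^ (k - 6) * v t * (\<Sum>i<k. l ^ (k - Suc i) * ?X t ^ i)"
      have "isCont ?R 0" unfolding v_def by (intro continuous_intros)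
      moreover have "q t ^ k = (\<Sum>j<12. c k j * t ^ j) + t ^ 12 * ?R t" for t
      proof -
        have "q t = t * ?X t" unfolding qv by (simp add: algebra_simps eval_nat_numeral)
        then have "q t ^ k = t ^ k * ?X t ^ k"
          by (simp only: power_mult_distrib)
        then have "q t ^ k = l ^ k * t ^ k + t ^ k * (?X t ^ k - l ^ k)"
          by (simp add: right_diff_distrib mult.commute)
        also have "?X t ^ k - l ^ k = t ^ 6 * (v t * (\<Sum>i<k. l ^ (k - Suc i) * ?X t ^ i))"
          by (subst power_diff_sumr2) simp
        also have "t ^ k * (t ^ 6 * (v t * (\<Sum>i<k. l ^ (k - Suc i) * ?X t ^ i))) = t ^ 12 * ?R t"
        proof -
          have "t ^ k * t ^ 6 = t ^ 12 * t ^ (k - 6)" using 3(1) by (simp add: power_add[symmetric] add.commute)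
          then show ?thesis by (simp only: mult.assoc[symmetric])
        qed
        also have "l ^ k * t ^ k = (\<Sum>j<12. c k j * t ^ j)"
        proof -
          have "(\<Sum>j<12. c k j * t ^ j) = (\<Sum>j<12. if j = k then l ^ k * t ^ k else 0)"
            by (rule sum.cong) (use 3(1) in \<open>auto simp: c_def\<close>)
          then show ?thesis using 3(2) by simp
        qed
        finally show ?thesis .
      qed
      ultimately show ?thesis by (intro exI[of _ ?R]) simp
    qed
  qed
  have f0: "taylor_coeff f 0 = 0" "taylor_coeff f 1 = 0" "taylor_coeff f 2 = 0" "taylor_coeff f 3 = 0"
    using f(2) by simp_all
  show "taylor_coeff (\<lambda>t. f (q t)) k = l ^ k * taylor_coeff f k" if "k < 10"
  proof -
    have "taylor_coeff (\<lambda>t. f (q t)) k = (\<Sum>i<12. if i = k then l ^ k * taylor_coeff f k else 0)"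
      unfolding *[of k, OF less_trans[OF that, of 12, simplified]]
      by (rule sum.cong) (use that in \<open>auto simp: c_def\<close>)
    then show ?thesis using that by simp
  qed
  show "taylor_coeff (\<lambda>t. f (q t)) 11 = l ^ 11 * taylor_coeff f 11 + 4 * l ^ 3 * \<kappa> * taylor_coeff f 4
      + 5 * l ^ 4 * \<delta> * taylor_coeff f 5"
    using f0 by (simp add: * sum_lessThan_12 c_def del: One_nat_def)
qed

subsection \<open>Curves parametrised by the angle of their velocity\<close>

text \<open>What remains of the geometry once the angle of the velocity is the parameter: the curve
  in a rotated orthonormal frame is determined by the signed speed \<open>\<sigma>\<close>, and
  \<open>w\<close> leads back to the original parameter, with derivative \<open>w'\<close> at 0.
  Normal forms and orders are derived from \<open>\<sigma>\<close> alone.\<close>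

locale angular_curve =
  fixes S :: "real \<Rightarrow> real^2" and w x y \<sigma> :: "real \<Rightarrow> real" and w' c s :: real
  assumes smooth: "smooth_germ w" "smooth_germ x" "smooth_germ y" "smooth_germ \<sigma>"
    and w: "w 0 = 0" "(w has_real_derivative w') (at 0)" "w' \<noteq> 0"
    and frame: "c\<^sup>2 + s\<^sup>2 = 1"
    and curve: "\<forall>\<^sub>F \<phi> in nhds 0. S (w \<phi>) = S 0 + x \<phi> *\<^sub>R vector [c, s] + y \<phi> *\<^sub>R vector [- s, c]"
    and at_0: "x 0 = 0" "y 0 = 0"
    and deriv: "\<forall>\<^sub>F \<phi> in nhds 0. (x has_real_derivative \<sigma> \<phi> * cos \<phi>) (at \<phi>)"
      "\<forall>\<^sub>F \<phi> in nhds 0. (y has_real_derivative \<sigma> \<phi> * sin \<phi>) (at \<phi>)"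
begin

lemma reparametrised_equivalence:
  assumes k: "1 \<le> k" and p: "smooth_germ p" "p 0 = 0" "taylor_coeff p 1 \<noteq> 0"
    and xy: "factors_through N a\<^sub>1 a\<^sub>2 (\<lambda>t. x (p t))" "factors_through N b\<^sub>1 b\<^sub>2 (\<lambda>t. y (p t))"
      "a\<^sub>1 * b\<^sub>2 - a\<^sub>2 * b\<^sub>1 \<noteq> 0"
    and K: "Ck_at k 0 K" "(K has_derivative (\<lambda>v. v)) (at 0)" "K 0 = 0" "\<And>t. N t = K (N\<^sub>0 t)"
    and N\<^sub>0: "isCont N\<^sub>0 0" "N\<^sub>0 0 = 0"
  shows "Ck_equivalent k S N\<^sub>0"
proof (rule Ck_equivalent_of_factors_through[OF k, where N = N and K = K and \<tau> = "\<lambda>t. w (p t)" and d = "w' * taylor_coeff p 1"])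
  have dp: "(p has_real_derivative taylor_coeff p 1) (at 0)"
    using eventually_nhds_x_imp_x[OF smooth_germ_deriv(2)[OF p(1)]] by (simp add: taylor_coeff_def)
  show "smooth_germ (\<lambda>t. w (p t))" by (rule smooth_germ_compose[OF smooth(1) p(1,2)])
  show "w (p 0) = 0" by (simp add: p w)
  show "((\<lambda>t. w (p t)) has_real_derivative w' * taylor_coeff p 1) (at 0)"
    by (rule DERIV_chain2[OF _ dp]) (simp add: p(2) w(2))
  show "w' * taylor_coeff p 1 \<noteq> 0" using w(3) p(3) by simp
  from eventually_compose_filterlim[OF curve smooth_germ_filterlim[OF p(1,2)]]
  show "\<forall>\<^sub>F t in nhds 0. S (w (p t)) = S 0 + x (p t) *\<^sub>R vector [c, s] + y (p t) *\<^sub>R vector [- s, c]" .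
  show "(vector [c, s] :: real^2) $ 1 * (vector [- s, c] :: real^2) $ 2 - (vector [c, s] :: real^2) $ 2 * (vector [- s, c] :: real^2) $ 1 \<noteq> 0"
    using frame by (simp add: power2_eq_square)
qed (use xy K N\<^sub>0 in auto)

lemma reparametrised_A_equivalence:
  assumes p: "smooth_germ p" "p 0 = 0" "taylor_coeff p 1 \<noteq> 0"
    and xy: "factors_through N a\<^sub>1 a\<^sub>2 (\<lambda>t. x (p t))" "factors_through N b\<^sub>1 b\<^sub>2 (\<lambda>t. y (p t))"
      "a\<^sub>1 * b\<^sub>2 - a\<^sub>2 * b\<^sub>1 \<noteq> 0"
    and N: "isCont N 0" "N 0 = 0"
  shows "A_equivalent S N"
  by (rule reparametrised_equivalence[OF _ p xy, where K = "\<lambda>v. v"]) (use N in \<open>simp_all add: Ck_at_id has_derivative_ident\<close>)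

text \<open>The components are primitives of \<open>\<sigma> cos\<close> and
  \<open>\<sigma> sin\<close>; the sums are Cauchy products.\<close>

lemma taylor_coeff_xy:
  "taylor_coeff x (Suc n) = (\<Sum>i\<le>n. taylor_coeff \<sigma> i * taylor_coeff cos (n - i)) / real (Suc n)"
  "taylor_coeff y (Suc n) = (\<Sum>i\<le>n. taylor_coeff \<sigma> i * taylor_coeff sin (n - i)) / real (Suc n)"
proof -
  have sc: "smooth_germ (cos :: real \<Rightarrow> real)" "smooth_germ (sin :: real \<Rightarrow> real)"
    unfolding smooth_germ_iff_Ck_at by (rule Ck_at_infty_sin_cos)+
  have "taylor_coeff (deriv x) n = taylor_coeff (\<lambda>\<phi>. \<sigma> \<phi> * cos \<phi>) n"
    by (rule taylor_coeff_cong) (use deriv(1) in \<open>auto elim!: eventually_mono intro: DERIV_imp_deriv\<close>)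
  then show "taylor_coeff x (Suc n) = (\<Sum>i\<le>n. taylor_coeff \<sigma> i * taylor_coeff cos (n - i)) / real (Suc n)"
    unfolding taylor_coeff_deriv taylor_coeff_mult[OF smooth(4) sc(1)] by (simp add: field_simps)
  have "taylor_coeff (deriv y) n = taylor_coeff (\<lambda>\<phi>. \<sigma> \<phi> * sin \<phi>) n"
    by (rule taylor_coeff_cong) (use deriv(2) in \<open>auto elim!: eventually_mono intro: DERIV_imp_deriv\<close>)
  then show "taylor_coeff y (Suc n) = (\<Sum>i\<le>n. taylor_coeff \<sigma> i * taylor_coeff sin (n - i)) / real (Suc n)"
    unfolding taylor_coeff_deriv taylor_coeff_mult[OF smooth(4) sc(2)] by (simp add: field_simps)
qed

text \<open>In the only gap, degree 1, both coefficients are already 0, so the angle itself serves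
  as parameter. The Jacobian of the factor map is half of \<open>taylor_coeff \<sigma> 1\<close>
  times a third of it.\<close>

lemma cusp_3_2:
  assumes "taylor_coeff \<sigma> 0 = 0" "taylor_coeff \<sigma> 1 \<noteq> 0"
  shows "cusp_3_2 S"
proof -
  note t = taylor_coeff_xy[of 0] taylor_coeff_xy[of 1] taylor_coeff_xy(2)[of 2]
  have "taylor_coeff x 1 = 0" "taylor_coeff y 1 = 0" "taylor_coeff x 2 = taylor_coeff \<sigma> 1 / 2"
    "taylor_coeff y 2 = 0" "taylor_coeff y 3 = taylor_coeff \<sigma> 1 / 3"
    using t assms by (simp_all add: taylor_coeff_cos_sin eval_nat_numeral)
  note t = this
  have "A_equivalent S (\<lambda>t. vector [t ^ 2, t ^ 3])"
    by (rule reparametrised_A_equivalence[OF smooth_germ_id refl _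
          factors_through_cusp_3_2[OF smooth(2) t(1)] factors_through_cusp_3_2[OF smooth(3) t(2)]])
      (use assms in \<open>simp_all add: t taylor_coeff_id isCont_vector_2 vec_eq_iff forall_2\<close>)
  then show ?thesis by (simp add: cusp_3_2_def)
qed

lemma cusp_4_3:
  assumes "taylor_coeff \<sigma> 0 = 0" "taylor_coeff \<sigma> 1 = 0" "taylor_coeff \<sigma> 2 \<noteq> 0"
  shows "cusp_4_3 S"
proof -
  note t = taylor_coeff_xy[of 0] taylor_coeff_xy[of 1] taylor_coeff_xy[of 2] taylor_coeff_xy(2)[of 3] taylor_coeff_xy(2)[of 4]
  have "taylor_coeff x 1 = 0" "taylor_coeff y 1 = 0" "taylor_coeff x 2 = 0" "taylor_coeff y 2 = 0"
    "taylor_coeff x 3 = taylor_coeff \<sigma> 2 / 3" "taylor_coeff y 3 = 0" "taylor_coeff y 4 = taylor_coeff \<sigma> 2 / 4"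
    using t assms by (simp_all add: taylor_coeff_cos_sin eval_nat_numeral)
  note t = this
  have 0: "taylor_coeff x 0 = 0" "taylor_coeff y 0 = 0" by (simp_all add: taylor_coeff_0 at_0)
  \<comment> \<open>Degree 5 is the gap to be emptied. As \<open>y\<close> has order 4, its
    coefficient there changes by \<open>4 * \<alpha> * taylor_coeff y 4\<close>, which fixes
    \<open>\<alpha>\<close>; then \<open>\<beta>\<close>, with the factor
    \<open>3 * taylor_coeff x 3\<close>, takes care of \<open>x\<close>.\<close>
  define \<alpha> where "\<alpha> = - taylor_coeff y 5 / (4 * taylor_coeff y 4)"
  define \<beta> where "\<beta> = - (taylor_coeff x 5 + 4 * \<alpha> * taylor_coeff x 4) / (3 * taylor_coeff x 3) - \<alpha>\<^sup>2"
  define p where "p = (\<lambda>t. t + \<alpha> * t ^ 2 + \<beta> * t ^ 3)"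
  have p: "smooth_germ p" "p 0 = 0" unfolding p_def by (intro smooth_germ_polynomial) simp
  have p1: "taylor_coeff p 1 = 1"
    unfolding p_def by (simp add: taylor_coeff_add smooth_germ_polynomial taylor_coeff_id taylor_coeff_monomial)
  note X = taylor_coeff_compose_cubic[OF smooth(2) 0(1) t(1,3) p_def]
  note Y = taylor_coeff_compose_cubic[OF smooth(3) 0(2) t(2,4) p_def]
  have X5: "taylor_coeff (\<lambda>t. x (p t)) 5 = 0"
    unfolding X \<beta>_def using assms(3) by (simp add: t(5) field_simps)
  have Y5: "taylor_coeff (\<lambda>t. y (p t)) 5 = 0"
    unfolding Y \<alpha>_def t(6) using assms(3) by (simp add: t(7))
  have "A_equivalent S (\<lambda>t. vector [t ^ 3, t ^ 4])"
  proof (rule reparametrised_A_equivalence[OF p])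
    show "factors_through (\<lambda>t. vector [t ^ 3, t ^ 4]) (taylor_coeff (\<lambda>t. x (p t)) 3)
        (taylor_coeff (\<lambda>t. x (p t)) 4) (\<lambda>t. x (p t))"
      by (rule factors_through_cusp_4_3[OF smooth_germ_compose[OF smooth(2) p] X(1,2) X5])
    show "factors_through (\<lambda>t. vector [t ^ 3, t ^ 4]) (taylor_coeff (\<lambda>t. y (p t)) 3)
        (taylor_coeff (\<lambda>t. y (p t)) 4) (\<lambda>t. y (p t))"
      by (rule factors_through_cusp_4_3[OF smooth_germ_compose[OF smooth(3) p] Y(1,2) Y5])
    show "taylor_coeff (\<lambda>t. x (p t)) 3 * taylor_coeff (\<lambda>t. y (p t)) 4
        - taylor_coeff (\<lambda>t. x (p t)) 4 * taylor_coeff (\<lambda>t. y (p t)) 3 \<noteq> 0"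
      unfolding X Y using assms(3) by (simp add: t)
  qed (simp_all add: p1[simplified] isCont_vector_2 vec_eq_iff forall_2)
  then show ?thesis by (simp add: cusp_4_3_def)
qed

text \<open>
  The numbers \<open>\<alpha>\<close>, \<open>\<beta>\<close>, \<open>\<gamma>\<close> below are determined by the conditions in degree 6 for both components and
  in degree 7 for the first one. The condition in degree 7 for the second one then determines \<open>E\<close>, which
  can only be rescaled, whereas \<open>\<delta>\<close>, \<open>\<kappa>\<close> settle degree 11.
\<close>

lemma cusp_5_4_general:
  defines "a \<equiv> taylor_coeff \<sigma> 4 / taylor_coeff \<sigma> 3" and "b \<equiv> taylor_coeff \<sigma> 5 / taylor_coeff \<sigma> 3"
  assumes \<sigma>: "taylor_coeff \<sigma> 0 = 0" "taylor_coeff \<sigma> 1 = 0" "taylor_coeff \<sigma> 2 = 0" "taylor_coeff \<sigma> 3 \<noteq> 0"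
    and l: "l \<noteq> 0" "\<epsilon> = 5 * (a\<^sup>2 / 72 - b / 42 + 5 / 84) * l\<^sup>2"
    and k: "1 \<le> k"
    and K: "Ck_at k 0 K" "(K has_derivative (\<lambda>v. v)) (at 0)" "K 0 = 0"
      "\<And>t. vector [t ^ 4, t ^ 5 + \<epsilon> * t ^ 7] = K (N\<^sub>0 t)"
    and N\<^sub>0: "isCont N\<^sub>0 0" "N\<^sub>0 0 = 0"
  shows "Ck_equivalent k S N\<^sub>0"
proof -
  note t = taylor_coeff_xy[of 0] taylor_coeff_xy[of 1] taylor_coeff_xy[of 2] taylor_coeff_xy[of 3]
    taylor_coeff_xy[of 4] taylor_coeff_xy[of 5] taylor_coeff_xy(2)[of 6]
  define s3 where "s3 = taylor_coeff \<sigma> 3"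
  have s3: "s3 \<noteq> 0" "taylor_coeff \<sigma> 3 = s3" "taylor_coeff \<sigma> 4 = a * s3" "taylor_coeff \<sigma> 5 = b * s3"
    using \<sigma>(4) by (simp_all add: s3_def a_def b_def)
  have "taylor_coeff x 1 = 0" "taylor_coeff y 1 = 0" "taylor_coeff x 2 = 0" "taylor_coeff y 2 = 0"
    "taylor_coeff x 3 = 0" "taylor_coeff y 3 = 0" "taylor_coeff x 4 = s3 / 4" "taylor_coeff y 4 = 0"
    "taylor_coeff x 5 = a * s3 / 5" "taylor_coeff y 5 = s3 / 5"
    "taylor_coeff x 6 = (b - 1 / 2) * s3 / 6" "taylor_coeff y 6 = a * s3 / 6"
    "taylor_coeff y 7 = (b - 1 / 6) * s3 / 7"
    using t \<sigma>(1-3) s3 by (simp_all add: taylor_coeff_cos_sin eval_nat_numeral algebra_simps)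
  note t = this
  have 0: "taylor_coeff x 0 = 0" "taylor_coeff y 0 = 0" by (simp_all add: taylor_coeff_0 at_0)
  have "taylor_coeff x k = 0 \<and> taylor_coeff y k = 0" if "k < 4" for k
  proof -
    have "k \<in> {0, 1, 2, 3}" using that by force
    then show ?thesis using 0 t by auto
  qed
  then have x0: "\<forall>k<4. taylor_coeff x k = 0" "\<forall>k<4. taylor_coeff y k = 0" by blast+
  \<comment> \<open>The ratio of the coefficients of \<open>Y\<close> in degrees 7 and 5. A term of
    degree 4 in the reparametrisation would enter degree 7 only with the coefficient of degree 4,
    which is 0 for \<open>y\<close>; so \<open>E\<close> cannot be influenced by it.\<close>
  define E where "E = 5 * (a\<^sup>2 / 72 - b / 42 + 5 / 84)"
  \<comment> \<open>Degree 6 of \<open>y\<close> demands \<open>a / 6 + \<alpha> = 0\<close>, degree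
    6 of \<open>x\<close> demands
    \<open>(b - 1/2) / 6 + a \<alpha> + \<beta> + (3/2) \<alpha>^2 = 0\<close>. Then
    \<open>\<gamma>\<close> is solved from the relation that the coefficients of \<open>X\<close> in
    degrees 7 and 5 also have the ratio \<open>E\<close>.\<close>
  define \<alpha> where "\<alpha> = - a / 6"
  define \<beta> where "\<beta> = a\<^sup>2 / 8 - b / 6 + 1 / 12"
  define \<gamma> where "\<gamma> = (E * (a / 5 + \<alpha>) - (taylor_coeff x 7 / s3 + 6 * \<alpha> * (b - 1 / 2) / 6
      + (5 * \<beta> + 10 * \<alpha>\<^sup>2) * a / 5)) - 3 * \<alpha> * \<beta> - \<alpha> ^ 3"
  define p where "p = (\<lambda>t. t + \<alpha> * t ^ 2 + \<beta> * t ^ 3 + \<gamma> * t ^ 4)"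
  have p: "smooth_germ p" "p 0 = 0" unfolding p_def by (intro smooth_germ_polynomial) simp
  define X where "X t = x (p t)" for t
  define Y where "Y t = y (p t)" for t
  have XY: "X = (\<lambda>t. x (p t))" "Y = (\<lambda>t. y (p t))"
    by (simp_all add: X_def Y_def fun_eq_iff)
  have sXY: "smooth_germ X" "smooth_germ Y"
    unfolding X_def Y_def using smooth_germ_compose[OF smooth(2) p] smooth_germ_compose[OF smooth(3) p] by blast+
  note cX = taylor_coeff_compose_quartic[OF smooth(2) x0(1) p_def]
  note cY = taylor_coeff_compose_quartic[OF smooth(3) x0(2) p_def]
  have X4: "taylor_coeff X 4 = s3 / 4" and Y4: "taylor_coeff Y 4 = 0" and Y5: "taylor_coeff Y 5 = s3 / 5"
    unfolding XY cX cY t by simp_all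
  have X6: "taylor_coeff X 6 = 0" and Y6: "taylor_coeff Y 6 = 0"
    unfolding XY cX cY t \<alpha>_def \<beta>_def by (simp_all add: field_simps power2_eq_square)
  have Y7: "taylor_coeff Y 7 = E * taylor_coeff Y 5"
    unfolding XY cY t \<alpha>_def \<beta>_def E_def by (simp add: field_simps power2_eq_square)
  have X7: "taylor_coeff X 7 = E * taylor_coeff X 5"
    unfolding XY cX t \<gamma>_def using s3(1) by (simp add: field_simps)
  \<comment> \<open>A triangular system: \<open>Y\<close> has no coefficient of degree 4, so in
    degree 11 only \<open>\<delta>\<close> acts on it; with \<open>\<delta>\<close> fixed,
    \<open>\<kappa>\<close> settles \<open>X\<close>.\<close>
  define \<delta> where "\<delta> = (\<epsilon> * l ^ 9 * taylor_coeff Y 9 - l ^ 11 * taylor_coeff Y 11) / (5 * l ^ 4 * taylor_coeff Y 5)"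
  define \<kappa> where "\<kappa> = (\<epsilon> * l ^ 9 * taylor_coeff X 9 - l ^ 11 * taylor_coeff X 11 - 5 * l ^ 4 * \<delta> * taylor_coeff X 5)
      / (4 * l ^ 3 * taylor_coeff X 4)"
  define q where "q = (\<lambda>t. l * t + \<delta> * t ^ 7 + \<kappa> * t ^ 8)"
  have q: "smooth_germ q" "q 0 = 0" unfolding q_def by (intro smooth_germ_polynomial) simp
  have p1: "taylor_coeff p 1 = 1" "taylor_coeff p 0 = 0"
    unfolding p_def by (simp_all add: taylor_coeff_add smooth_germ_polynomial taylor_coeff_id taylor_coeff_monomial)
  have dp: "(p has_real_derivative 1) (at (q 0))"
    using eventually_nhds_x_imp_x[OF smooth_germ_deriv(2)[OF p(1)]] p1 q(2) by (simp add: taylor_coeff_def)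
  have dq: "(q has_real_derivative l) (at 0)"
    unfolding q_def by (auto intro!: derivative_eq_intros)
  have pq: "smooth_germ (\<lambda>t. p (q t))" "p (q 0) = 0" "taylor_coeff (\<lambda>t. p (q t)) 1 \<noteq> 0"
    using smooth_germ_compose[OF p(1) q] p(2) q(2) DERIV_imp_deriv[OF DERIV_chain2[OF dp dq]] l(1)
    by (simp_all add: taylor_coeff_def)
  have 4: "\<forall>k<4. taylor_coeff X k = 0" "\<forall>k<4. taylor_coeff Y k = 0"
    unfolding XY using cX(1) cY(1) by blast+
  note dX = taylor_coeff_compose_octic[OF sXY(1) 4(1) q_def]
  note dY = taylor_coeff_compose_octic[OF sXY(2) 4(2) q_def]
  have nz: "taylor_coeff X 4 \<noteq> 0" "taylor_coeff Y 5 \<noteq> 0" using X4 Y5 s3(1) by simp_all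
  have X11: "l ^ 11 * taylor_coeff X 11 + 4 * l ^ 3 * \<kappa> * taylor_coeff X 4 + 5 * l ^ 4 * \<delta> * taylor_coeff X 5
      = \<epsilon> * (l ^ 9 * taylor_coeff X 9)"
  proof -
    have "4 * l ^ 3 * \<kappa> * taylor_coeff X 4
        = \<epsilon> * l ^ 9 * taylor_coeff X 9 - l ^ 11 * taylor_coeff X 11 - 5 * l ^ 4 * \<delta> * taylor_coeff X 5"
      unfolding \<kappa>_def using nz l(1) by simp
    then show ?thesis by (simp add: mult.assoc)
  qed
  have Y11: "l ^ 11 * taylor_coeff Y 11 + 4 * l ^ 3 * \<kappa> * taylor_coeff Y 4 + 5 * l ^ 4 * \<delta> * taylor_coeff Y 5
      = \<epsilon> * (l ^ 9 * taylor_coeff Y 9)"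
  proof -
    have "5 * l ^ 4 * \<delta> * taylor_coeff Y 5 = \<epsilon> * l ^ 9 * taylor_coeff Y 9 - l ^ 11 * taylor_coeff Y 11"
      unfolding \<delta>_def using nz l(1) by simp
    then show ?thesis by (simp add: Y4 mult.assoc)
  qed
  \<comment> \<open>Substituting \<open>l t\<close> multiplies the ratio of the coefficients in
    degrees 7 and 5 by \<open>l^2\<close>; this is where the relation between
    \<open>\<epsilon>\<close> and \<open>l\<close> is used.\<close>
  have l7: "l ^ 7 * (E * z) = \<epsilon> * (l ^ 5 * z)" for z
    unfolding l(2) E_def[symmetric] by (simp add: eval_nat_numeral)
  have fX: "factors_through (\<lambda>t. vector [t ^ 4, t ^ 5 + \<epsilon> * t ^ 7]) (taylor_coeff (\<lambda>t. X (q t)) 4)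
      (taylor_coeff (\<lambda>t. X (q t)) 5) (\<lambda>t. X (q t))"
    by (rule factors_through_cusp_5_4[OF smooth_germ_compose[OF sXY(1) q]])
      (simp_all add: dX 4 X6 X7 X11 l7)
  have fY: "factors_through (\<lambda>t. vector [t ^ 4, t ^ 5 + \<epsilon> * t ^ 7]) (taylor_coeff (\<lambda>t. Y (q t)) 4)
      (taylor_coeff (\<lambda>t. Y (q t)) 5) (\<lambda>t. Y (q t))"
    by (rule factors_through_cusp_5_4[OF smooth_germ_compose[OF sXY(2) q]])
      (simp_all add: dY 4 Y6 Y7 Y11 l7)
  show ?thesis
    by (rule reparametrised_equivalence[OF k pq fX[unfolded X_def[abs_def]] fY[unfolded Y_def[abs_def]] _ K N\<^sub>0])
      (use l(1) nz Y4 in \<open>simp add: dX[unfolded X_def[abs_def]] dY[unfolded Y_def[abs_def]] X_def[abs_def] Y_def[abs_def]\<close>)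
qed

end

subsection \<open>The order of a curve is an invariant\<close>

lemma differentiable_imp_linear_bound:
  assumes "f differentiable (at p)"
  obtains C where "C > 0" "\<forall>\<^sub>F x in nhds p. norm (f x - f p) \<le> C * norm (x - p)"
proof -
  obtain f' where f': "(f has_derivative f') (at p)"
    using assms unfolding differentiable_def by blast
  then have bl: "bounded_linear f'" by (rule has_derivative_bounded_linear)
  obtain K where K: "K > 0" "\<And>x. norm (f' x) \<le> norm x * K"
    using bounded_linear.pos_bounded[OF bl] by blast
  obtain d where d: "d > 0" "\<And>y. norm (y - p) < d \<Longrightarrow> norm (f y - f p - f' (y - p)) \<le> 1 * norm (y - p)"
    using f' unfolding has_derivative_at_alt by (metis zero_less_one)
  have "norm (f x - f p) \<le> (1 + K) * norm (x - p)" if "dist x p < d" for x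
    using norm_triangle_ineq[of "f x - f p - f' (x - p)" "f' (x - p)"] d(2)[of x] K(2)[of "x - p"] that
    by (simp add: dist_norm algebra_simps)
  then show thesis
    using that[of "1 + K"] K(1) d(1) unfolding eventually_nhds_metric by force
qed

text \<open>Differentiability of the map and of its inverse at a single point bounds the distortion
  of distances from that point in both directions.\<close>

lemma diffeo_germ_bilipschitz_at:
  assumes "diffeo_germ k p \<Phi>" "1 \<le> k"
  obtains C where "C > 0" "\<forall>\<^sub>F x in nhds p. norm (\<Phi> x - \<Phi> p) \<le> C * norm (x - p)"
    "\<forall>\<^sub>F x in nhds p. norm (x - p) \<le> C * norm (\<Phi> x - \<Phi> p)"
proof -
  obtain U V \<psi> where *: "open U" "open V" "p \<in> U" "homeomorphism U V \<Phi> \<psi>" "Ck_on k U \<Phi>" "Ck_on k V \<psi>"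
    using assms(1) unfolding diffeo_germ_def by blast
  have p': "\<Phi> p \<in> V" using *(3,4) by (auto simp: homeomorphism_def)
  have d: "\<Phi> differentiable (at p)" "\<psi> differentiable (at (\<Phi> p))"
    using eventually_nhds_x_imp_x[OF Ck_at_differentiable[OF Ck_atI[OF *(1,3,5)] assms(2)]]
      eventually_nhds_x_imp_x[OF Ck_at_differentiable[OF Ck_atI[OF *(2) p' *(6)] assms(2)]] by blast+
  obtain A where A: "A > 0" "\<forall>\<^sub>F x in nhds p. norm (\<Phi> x - \<Phi> p) \<le> A * norm (x - p)"
    using differentiable_imp_linear_bound[OF d(1)] .
  obtain B where B: "B > 0" "\<forall>\<^sub>F x in nhds (\<Phi> p). norm (\<psi> x - \<psi> (\<Phi> p)) \<le> B * norm (x - \<Phi> p)"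
    using differentiable_imp_linear_bound[OF d(2)] .
  have "(\<Phi> \<longlongrightarrow> \<Phi> p) (nhds p)"
    using differentiable_imp_continuous_within[OF d(1)] unfolding isCont_def tendsto_at_iff_tendsto_nhds .
  from eventually_compose_filterlim[OF B(2) this] eventually_nhds_in_open[OF *(1,3)]
  have "\<forall>\<^sub>F x in nhds p. norm (x - p) \<le> B * norm (\<Phi> x - \<Phi> p)"
    by eventually_elim (use *(3,4) in \<open>simp add: homeomorphism_def\<close>)
  then have "\<forall>\<^sub>F x in nhds p. norm (x - p) \<le> max A B * norm (\<Phi> x - \<Phi> p)"
    by eventually_elim (meson max.cobounded2 mult_right_mono norm_ge_zero order_trans)
  moreover from A(2) have "\<forall>\<^sub>F x in nhds p. norm (\<Phi> x - \<Phi> p) \<le> max A B * norm (x - p)"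
    by eventually_elim (meson max.cobounded1 mult_right_mono norm_ge_zero order_trans)
  ultimately show thesis
    using that[of "max A B"] A(1) by simp
qed

context angular_curve
begin

lemma diffeo_germ_w: "diffeo_germ \<infinity> 0 w"
proof -
  have "Ck_at \<infinity> 0 w" using smooth(1) unfolding smooth_germ_iff_Ck_at .
  from Ck_at_local_inverse_real[OF this _ w(2,3)] show ?thesis
    unfolding diffeo_germ_def by (metis enat_ord_code(3))
qed

lemma norm_curve: "\<forall>\<^sub>F \<phi> in nhds 0. norm (S (w \<phi>) - S 0) = sqrt ((x \<phi>)\<^sup>2 + (y \<phi>)\<^sup>2)"
  using curve
proof eventually_elim
  case (elim \<phi>)
  have "(norm (S (w \<phi>) - S 0))\<^sup>2 = (x \<phi> * c - y \<phi> * s)\<^sup>2 + (x \<phi> * s + y \<phi> * c)\<^sup>2"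
    unfolding power2_norm_eq_inner elim by (simp add: inner_vec_def sum_2 power2_eq_square)
  also have "\<dots> = (c\<^sup>2 + s\<^sup>2) * ((x \<phi>)\<^sup>2 + (y \<phi>)\<^sup>2)"
    by (simp add: power2_eq_square algebra_simps)
  finally show ?case
    by (simp add: frame real_sqrt_unique)
qed

text \<open>The two estimates on the distance \<open>n\<close> to \<open>S 0\<close> are used
  differently. The upper one passes to \<open>x\<close>; differentiation, legitimate for smooth
  germs, lowers the order by one, and \<open>cos\<close> is bounded away from 0, which gives the
  bound on \<open>\<sigma>\<close>. For sharpness both components count: if \<open>\<sigma>\<close>
  were one order smaller, so would be \<open>x\<close> and \<open>y\<close>, hence \<open>n\<close>,
  against the lower estimate.\<close>

lemma order_of_curve:
  assumes eq: "A_equivalent S N" and N: "N 0 = 0"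
    and m: "c\<^sub>1 > 0" "\<forall>\<^sub>F t in nhds 0. c\<^sub>1 * \<bar>t\<bar> ^ Suc m \<le> norm (N t)"
      "\<forall>\<^sub>F t in nhds 0. norm (N t) \<le> c\<^sub>2 * \<bar>t\<bar> ^ Suc m"
  shows "\<sigma> \<in> O[nhds 0](\<lambda>\<phi>. \<phi> ^ m)" "\<sigma> \<notin> O[nhds 0](\<lambda>\<phi>. \<phi> ^ Suc m)"
proof -
  define n where "n \<phi> = norm (S (w \<phi>) - S 0)" for \<phi>
  obtain g \<Phi> where g: "diffeo_germ \<infinity> 0 g" "g 0 = 0" and \<Phi>: "diffeo_germ \<infinity> (S 0) \<Phi>"
    and gN: "\<forall>\<^sub>F t in nhds 0. \<Phi> (S t) = N (g t)"
    using eq unfolding Ck_equivalent_def by blast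
  have \<Phi>0: "\<Phi> (S 0) = 0" using eventually_nhds_x_imp_x[OF gN] g(2) N by simp
  obtain A where A: "A > 0" "\<forall>\<^sub>F x in nhds 0. \<bar>w x\<bar> \<le> A * \<bar>x\<bar>" "\<forall>\<^sub>F x in nhds 0. \<bar>x\<bar> \<le> A * \<bar>w x\<bar>"
    using diffeo_germ_bilipschitz_at[OF diffeo_germ_w] w(1) by auto
  obtain B where B: "B > 0" "\<forall>\<^sub>F x in nhds 0. \<bar>g x\<bar> \<le> B * \<bar>x\<bar>" "\<forall>\<^sub>F x in nhds 0. \<bar>x\<bar> \<le> B * \<bar>g x\<bar>"
    using diffeo_germ_bilipschitz_at[OF g(1)] g(2) by auto
  obtain D where D: "D > 0" "\<forall>\<^sub>F z in nhds (S 0). norm (\<Phi> z) \<le> D * norm (z - S 0)"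
    "\<forall>\<^sub>F z in nhds (S 0). norm (z - S 0) \<le> D * norm (\<Phi> z)"
    using diffeo_germ_bilipschitz_at[OF \<Phi>] \<Phi>0 by auto
  note lw = smooth_germ_filterlim[OF smooth(1) w(1)]
  have "((\<lambda>u::real. B * \<bar>u\<bar>) \<longlongrightarrow> 0) (nhds 0)"
    by (auto intro!: tendsto_eq_intros filterlim_ident)
  then have "(g \<longlongrightarrow> 0) (nhds 0)"
    by (rule Lim_null_comparison[rotated]) (use B(2) in simp)
  then have lg: "filterlim (\<lambda>\<phi>. g (w \<phi>)) (nhds 0) (nhds 0)"
    using lw by (rule filterlim_compose)
  have "((\<lambda>\<phi>. sqrt ((x \<phi>)\<^sup>2 + (y \<phi>)\<^sup>2)) \<longlongrightarrow> sqrt ((x 0)\<^sup>2 + (y 0)\<^sup>2)) (nhds 0)"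
    using smooth_germ_isCont[OF smooth(2)] smooth_germ_isCont[OF smooth(3)]
    unfolding isCont_def tendsto_at_iff_tendsto_nhds by (intro tendsto_intros)
  then have "((\<lambda>\<phi>. sqrt ((x \<phi>)\<^sup>2 + (y \<phi>)\<^sup>2)) \<longlongrightarrow> 0) (nhds 0)"
    by (simp add: at_0)
  then have "((\<lambda>\<phi>. norm (S (w \<phi>) - S 0)) \<longlongrightarrow> 0) (nhds 0)"
    by (rule Lim_transform_eventually) (use norm_curve in \<open>auto elim: eventually_mono\<close>)
  then have lS: "filterlim (\<lambda>\<phi>. S (w \<phi>)) (nhds (S 0)) (nhds 0)"
    by (simp add: tendsto_norm_zero_iff LIM_zero_cancel)
  note ev = A(2,3) eventually_compose_filterlim[OF B(2) lw] eventually_compose_filterlim[OF B(3) lw]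
    eventually_compose_filterlim[OF D(2) lS] eventually_compose_filterlim[OF D(3) lS]
    eventually_compose_filterlim[OF gN lw]
    eventually_compose_filterlim[OF m(2) lg] eventually_compose_filterlim[OF m(3) lg]
  have up: "\<forall>\<^sub>F \<phi> in nhds 0. n \<phi> \<le> D * (\<bar>c\<^sub>2\<bar> * (B * A) ^ Suc m) * \<bar>\<phi> ^ Suc m\<bar>"
    using ev(1,3,6,7,9)
  proof eventually_elim
    case (elim \<phi>)
    have "\<bar>g (w \<phi>)\<bar> \<le> B * (A * \<bar>\<phi>\<bar>)"
      using elim(1,2) B(1) by (meson mult_left_mono order_trans less_imp_le)
    then have "\<bar>g (w \<phi>)\<bar> ^ Suc m \<le> (B * (A * \<bar>\<phi>\<bar>)) ^ Suc m"
      by (intro power_mono) auto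
    then have "\<bar>c\<^sub>2\<bar> * \<bar>g (w \<phi>)\<bar> ^ Suc m \<le> \<bar>c\<^sub>2\<bar> * (B * (A * \<bar>\<phi>\<bar>)) ^ Suc m"
      by (intro mult_left_mono) auto
    moreover have "c\<^sub>2 * \<bar>g (w \<phi>)\<bar> ^ Suc m \<le> \<bar>c\<^sub>2\<bar> * \<bar>g (w \<phi>)\<bar> ^ Suc m"
      by (intro mult_right_mono) auto
    ultimately have "norm (N (g (w \<phi>))) \<le> \<bar>c\<^sub>2\<bar> * (B * (A * \<bar>\<phi>\<bar>)) ^ Suc m"
      using elim(5) by linarith
    then have "D * norm (N (g (w \<phi>))) \<le> D * (\<bar>c\<^sub>2\<bar> * (B * (A * \<bar>\<phi>\<bar>)) ^ Suc m)"
      by (rule mult_left_mono) (use D(1) in simp)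
    moreover have "n \<phi> \<le> D * norm (N (g (w \<phi>)))"
      using elim(3,4) unfolding n_def by simp
    ultimately have "n \<phi> \<le> D * (\<bar>c\<^sub>2\<bar> * (B * (A * \<bar>\<phi>\<bar>)) ^ Suc m)"
      by linarith
    then show ?case by (simp add: power_mult_distrib power_abs abs_mult mult_ac)
  qed
  have low: "\<forall>\<^sub>F \<phi> in nhds 0. \<bar>\<phi> ^ Suc m\<bar> \<le> ((A * B) ^ Suc m * (D / c\<^sub>1)) * n \<phi>"
    using ev(2,4,5,7,8)
  proof eventually_elim
    case (elim \<phi>)
    have "\<bar>\<phi>\<bar> \<le> A * (B * \<bar>g (w \<phi>)\<bar>)"
      using elim(1,2) A(1) by (meson mult_left_mono order_trans less_imp_le)
    then have "\<bar>\<phi>\<bar> ^ Suc m \<le> (A * (B * \<bar>g (w \<phi>)\<bar>)) ^ Suc m"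
      by (intro power_mono) auto
    also have "\<dots> = (A * B) ^ Suc m * \<bar>g (w \<phi>)\<bar> ^ Suc m"
      by (simp add: power_mult_distrib mult_ac)
    also have "\<dots> \<le> (A * B) ^ Suc m * (norm (N (g (w \<phi>))) / c\<^sub>1)"
      using elim(5) m(1) A(1) B(1) by (intro mult_left_mono) (simp_all add: field_simps)
    also have "\<dots> \<le> (A * B) ^ Suc m * (D * n \<phi> / c\<^sub>1)"
      using elim(3,4) m(1) A(1) B(1) unfolding n_def by (intro mult_left_mono divide_right_mono) simp_all
    finally show ?case by (simp add: power_abs mult.assoc del: power_Suc)
  qed
  have nO: "n \<in> O[nhds 0](\<lambda>\<phi>. \<phi> ^ Suc m)"
    by (rule bigoI[of _ "D * (\<bar>c\<^sub>2\<bar> * (B * A) ^ Suc m)"])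
      (use up in \<open>auto elim!: eventually_mono simp: n_def simp del: power_Suc\<close>)
  have On: "(\<lambda>\<phi>. \<phi> ^ Suc m) \<in> O[nhds 0](n)"
    by (rule bigoI[of _ "(A * B) ^ Suc m * (D / c\<^sub>1)"])
      (use low in \<open>auto elim!: eventually_mono simp: n_def simp del: power_Suc\<close>)
  have xn: "x \<in> O[nhds 0](n)"
    by (rule bigoI[of _ 1]) (use norm_curve in \<open>auto elim!: eventually_mono simp: n_def real_le_rsqrt\<close>)
  have nxy: "n \<in> O[nhds 0](\<lambda>\<phi>. \<bar>x \<phi>\<bar> + \<bar>y \<phi>\<bar>)"
    by (rule bigoI[of _ 1]) (use norm_curve in \<open>auto elim!: eventually_mono simp: n_def sqrt_sum_squares_le_sum_abs\<close>)
  have dx: "\<forall>\<^sub>F \<phi> in nhds 0. deriv x \<phi> = \<sigma> \<phi> * cos \<phi>"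
    by (rule eventually_mono[OF deriv(1)]) (rule DERIV_imp_deriv)
  have dy: "\<forall>\<^sub>F \<phi> in nhds 0. deriv y \<phi> = \<sigma> \<phi> * sin \<phi>"
    by (rule eventually_mono[OF deriv(2)]) (rule DERIV_imp_deriv)
  have sc: "isCont (cos :: real \<Rightarrow> real) 0" "isCont (sin :: real \<Rightarrow> real) 0" by (intro continuous_intros)+
  have "deriv x \<in> O[nhds 0](\<lambda>\<phi>. \<phi> ^ m)"
    using landau_o.big_trans[OF xn nO] smooth_germ_bigo_Suc_iff[OF smooth(2)] by blast
  moreover have "\<sigma> \<in> O[nhds 0](deriv x)"
  proof (rule bigoI[of _ 2])
    have "(cos \<longlongrightarrow> cos 0) (nhds (0::real))"
      using sc(1) unfolding isCont_def tendsto_at_iff_tendsto_nhds .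
    then have "\<forall>\<^sub>F \<phi> in nhds (0::real). 1 / 2 < cos \<phi>"
      by (rule order_tendstoD(1)) simp
    with dx show "\<forall>\<^sub>F \<phi> in nhds 0. norm (\<sigma> \<phi>) \<le> 2 * norm (deriv x \<phi>)"
    proof eventually_elim
      case (elim \<phi>)
      have "\<bar>\<sigma> \<phi>\<bar> * (1 / 2) \<le> \<bar>\<sigma> \<phi>\<bar> * \<bar>cos \<phi>\<bar>"
        by (rule mult_left_mono) (use elim(2) in auto)
      then show ?case by (simp add: elim(1) abs_mult)
    qed
  qed
  ultimately show "\<sigma> \<in> O[nhds 0](\<lambda>\<phi>. \<phi> ^ m)"
    using landau_o.big_trans by blast
  show "\<sigma> \<notin> O[nhds 0](\<lambda>\<phi>. \<phi> ^ Suc m)"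
  proof
    assume \<sigma>: "\<sigma> \<in> O[nhds 0](\<lambda>\<phi>. \<phi> ^ Suc m)"
    have "(\<lambda>\<phi>. \<sigma> \<phi> * cos \<phi>) \<in> O[nhds 0](\<lambda>\<phi>. \<phi> ^ Suc m)" "(\<lambda>\<phi>. \<sigma> \<phi> * sin \<phi>) \<in> O[nhds 0](\<lambda>\<phi>. \<phi> ^ Suc m)"
      using landau_o.big.mult[OF \<sigma> isCont_imp_bigo_1[OF sc(1)]] landau_o.big.mult[OF \<sigma> isCont_imp_bigo_1[OF sc(2)]]
      by (simp_all only: mult_1_right)
    then have "deriv x \<in> O[nhds 0](\<lambda>\<phi>. \<phi> ^ Suc m)" "deriv y \<in> O[nhds 0](\<lambda>\<phi>. \<phi> ^ Suc m)"
      using landau_o.big.in_cong[OF dx] landau_o.big.in_cong[OF dy] by blast+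
    then have "x \<in> O[nhds 0](\<lambda>\<phi>. \<phi> ^ Suc (Suc m))" "y \<in> O[nhds 0](\<lambda>\<phi>. \<phi> ^ Suc (Suc m))"
      using smooth_germ_bigo_Suc_iff[OF smooth(2)] smooth_germ_bigo_Suc_iff[OF smooth(3)] at_0 by blast+
    then have "(\<lambda>\<phi>. \<bar>x \<phi>\<bar> + \<bar>y \<phi>\<bar>) \<in> O[nhds 0](\<lambda>\<phi>. \<phi> ^ Suc (Suc m))"
      by (intro sum_in_bigo) (simp_all only: landau_o.big.abs_in_iff)
    from landau_o.big_trans[OF On landau_o.big_trans[OF nxy this]]
    have "(\<lambda>\<phi>::real. \<phi> ^ Suc m) \<in> O[nhds 0](\<lambda>\<phi>. \<phi> ^ Suc (Suc m))" .
    then have "taylor_coeff (\<lambda>\<phi>. \<phi> ^ Suc m) (Suc m) = 0"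
      unfolding smooth_germ_bigo_iff[OF smooth_germ_power] by blast
    then show False by (simp add: taylor_coeff_power del: power_Suc)
  qed
qed

lemma not_bigo_taylor_coeff:
  assumes "\<sigma> \<in> O[nhds 0](\<lambda>\<phi>. \<phi> ^ m)" "\<sigma> \<notin> O[nhds 0](\<lambda>\<phi>. \<phi> ^ Suc m)"
  shows "\<forall>k<m. taylor_coeff \<sigma> k = 0" "taylor_coeff \<sigma> m \<noteq> 0"
  using assms unfolding smooth_germ_bigo_iff[OF smooth(4)] by (auto simp: less_Suc_eq)

lemma norm_cusp_bounds:
  "\<forall>\<^sub>F t in nhds 0. 1 * \<bar>t\<bar> ^ n \<le> norm (vector [t ^ n, t ^ Suc n] :: real^2)"
  "\<forall>\<^sub>F t in nhds 0. norm (vector [t ^ n, t ^ Suc n] :: real^2) \<le> 2 * \<bar>t\<bar> ^ n"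
proof -
  have nv: "norm (vector [a, b] :: real^2) = sqrt (a\<^sup>2 + b\<^sup>2)" for a b :: real
    by (simp add: norm_vec_def L2_set_def sum_2)
  show "\<forall>\<^sub>F t in nhds 0. 1 * \<bar>t\<bar> ^ n \<le> norm (vector [t ^ n, t ^ Suc n] :: real^2)"
    unfolding nv by (intro always_eventually allI real_le_rsqrt) (simp add: power_abs[symmetric])
  have "\<forall>\<^sub>F t in nhds (0::real). \<bar>t\<bar> < 1"
    unfolding eventually_nhds_metric by (auto simp: dist_norm intro!: exI[of _ 1])
  then show "\<forall>\<^sub>F t in nhds 0. norm (vector [t ^ n, t ^ Suc n] :: real^2) \<le> 2 * \<bar>t\<bar> ^ n"
  proof eventually_elim
    case (elim t)
    have "sqrt ((t ^ n)\<^sup>2 + (t ^ Suc n)\<^sup>2) \<le> \<bar>t ^ n\<bar> + \<bar>t ^ Suc n\<bar>" by (rule sqrt_sum_squares_le_sum_abs)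
    also have "\<bar>t ^ Suc n\<bar> \<le> \<bar>t ^ n\<bar>"
      using elim by (simp add: abs_mult mult_left_le_one_le)
    finally show ?case unfolding nv by (simp add: power_abs)
  qed
qed

text \<open>\<open>m\<close> is the order of vanishing of \<open>\<sigma>\<close>, one less than the
  order of the curve; hence the successors in the exponents.\<close>

lemma cusp_order:
  assumes "A_equivalent S (\<lambda>t. vector [t ^ Suc m, t ^ Suc (Suc m)])"
  shows "\<forall>k<m. taylor_coeff \<sigma> k = 0" "taylor_coeff \<sigma> m \<noteq> 0"
proof -
  have 0: "vector [0 ^ Suc m, 0 ^ Suc (Suc m)] = (0 :: real^2)" by (simp add: vec_eq_iff forall_2)
  note * = order_of_curve[OF assms 0 zero_less_one norm_cusp_bounds[of "Suc m"]]
  show "\<forall>k<m. taylor_coeff \<sigma> k = 0" "taylor_coeff \<sigma> m \<noteq> 0"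
    using not_bigo_taylor_coeff[OF *] by blast+
qed

lemma cusp_3_2_iff: "cusp_3_2 S \<longleftrightarrow> taylor_coeff \<sigma> 0 = 0 \<and> taylor_coeff \<sigma> 1 \<noteq> 0"
proof
  assume "cusp_3_2 S"
  then show "taylor_coeff \<sigma> 0 = 0 \<and> taylor_coeff \<sigma> 1 \<noteq> 0"
    using cusp_order[of 1] by (simp add: cusp_3_2_def eval_nat_numeral)
qed (use cusp_3_2 in blast)

lemma cusp_4_3_iff:
  "cusp_4_3 S \<longleftrightarrow> taylor_coeff \<sigma> 0 = 0 \<and> taylor_coeff \<sigma> 1 = 0 \<and> taylor_coeff \<sigma> 2 \<noteq> 0"
proof
  assume "cusp_4_3 S"
  then show "taylor_coeff \<sigma> 0 = 0 \<and> taylor_coeff \<sigma> 1 = 0 \<and> taylor_coeff \<sigma> 2 \<noteq> 0"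
    using cusp_order[of 2] by (simp add: cusp_4_3_def eval_nat_numeral)
qed (use cusp_4_3 in blast)

end

subsection \<open>Critical points of maps into the projective line\<close>

lemma vector_in_proj_point_iff:
  "vector [a, b] \<in> proj_point x y \<longleftrightarrow> (\<exists>k. a = k * x \<and> b = k * y)"
  unfolding proj_point_def span_singleton by (auto simp: vec_eq_iff forall_2)

text \<open>In the charts the map reads \<open>q / p\<close> or \<open>p / q\<close>, with
  derivatives \<open>(p q' - q p') / p^2\<close> and \<open>(q p' - p q') / q^2\<close>. Both charts
  thus test the same determinant up to sign.\<close>

lemma RP1_critical_point_iff:
  assumes p: "(p has_real_derivative p') (at u)" and q: "(q has_real_derivative q') (at u)"
    and nz: "p u \<noteq> 0 \<or> q u \<noteq> 0"
  shows "RP1_critical_point (\<lambda>t. proj_point (p t) (q t)) u \<longleftrightarrow> p u * q' - q u * p' = 0"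
proof -
  have in1: "proj_point x y \<in> RP1 - {proj_point 0 1} \<longleftrightarrow> x \<noteq> 0" if "x \<noteq> 0 \<or> y \<noteq> 0" for x y
  proof -
    have "proj_point x y = proj_point 0 1 \<longleftrightarrow> x = 0"
    proof
      assume "proj_point x y = proj_point 0 1"
      then have "vector [x, y] \<in> proj_point 0 1"
        using vector_in_proj_point_iff[of x y x y] by (metis mult_1)
      then show "x = 0" by (auto simp: vector_in_proj_point_iff)
    next
      assume x: "x = 0"
      have "vector [v $ 1, v $ 2] = v" for v :: "real^2" by (simp add: vec_eq_iff forall_2)
      moreover have "vector [a, b] \<in> proj_point x y \<longleftrightarrow> vector [a, b] \<in> proj_point 0 1" for a b
        using that x by (auto simp: vector_in_proj_point_iff intro: exI[of _ "b / y"])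
      ultimately have "v \<in> proj_point x y \<longleftrightarrow> v \<in> proj_point 0 1" for v
        using \<open>\<And>v. vector [v $ 1, v $ 2] = v\<close>[of v] by metis
      then show "proj_point x y = proj_point 0 1" by blast
    qed
    then show ?thesis using that by (auto simp: RP1_def)
  qed
  have in2: "proj_point x y \<in> RP1 - {proj_point 1 0} \<longleftrightarrow> y \<noteq> 0" if "x \<noteq> 0 \<or> y \<noteq> 0" for x y
  proof -
    have "proj_point x y = proj_point 1 0 \<longleftrightarrow> y = 0"
    proof
      assume "proj_point x y = proj_point 1 0"
      then have "vector [x, y] \<in> proj_point 1 0"
        using vector_in_proj_point_iff[of x y x y] by (metis mult_1)
      then show "y = 0" by (auto simp: vector_in_proj_point_iff)
    next
      assume y: "y = 0"
      have "vector [v $ 1, v $ 2] = v" for v :: "real^2" by (simp add: vec_eq_iff forall_2)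
      moreover have "vector [a, b] \<in> proj_point x y \<longleftrightarrow> vector [a, b] \<in> proj_point 1 0" for a b
        using that y by (auto simp: vector_in_proj_point_iff intro: exI[of _ "a / x"])
      ultimately have "v \<in> proj_point x y \<longleftrightarrow> v \<in> proj_point 1 0" for v
        using \<open>\<And>v. vector [v $ 1, v $ 2] = v\<close>[of v] by metis
      then show "proj_point x y = proj_point 1 0" by blast
    qed
    then show ?thesis using that by (auto simp: RP1_def)
  qed
  have ev: "\<forall>\<^sub>F t in nhds u. f t \<noteq> 0" if "(f has_real_derivative f') (at u)" "f u \<noteq> 0" for f f'
  proof -
    have "(f \<longlongrightarrow> f u) (nhds u)"
      using DERIV_isCont[OF that(1)] unfolding isCont_def tendsto_at_iff_tendsto_nhds .
    then show ?thesis using that(2) by (rule tendsto_imp_eventually_ne)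
  qed
  have th1: "(THE t. vector [1, t] \<in> proj_point x y) = y / x" if "x \<noteq> 0" for x y
    by (rule the_equality) (use that in \<open>auto simp: vector_in_proj_point_iff field_simps intro: exI[of _ "1 / x"]\<close>)
  have th2: "(THE t. vector [t, 1] \<in> proj_point x y) = x / y" if "y \<noteq> 0" for x y
    by (rule the_equality) (use that in \<open>auto simp: vector_in_proj_point_iff field_simps intro: exI[of _ "1 / y"]\<close>)
  have 1: "((\<lambda>t. THE s. vector [1, s] \<in> proj_point (p t) (q t)) has_real_derivative
      (q' * p u - q u * p') / (p u * p u)) (at u)" if "p u \<noteq> 0"
  proof -
    have e: "\<forall>\<^sub>F t in nhds u. (THE s. vector [1, s] \<in> proj_point (p t) (q t)) = q t / p t"
      using ev[OF p that] by eventually_elim (rule th1)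
    show ?thesis
      unfolding DERIV_cong_ev[OF refl e refl] by (rule DERIV_divide[OF q p that])
  qed
  have 2: "((\<lambda>t. THE s. vector [s, 1] \<in> proj_point (p t) (q t)) has_real_derivative
      (p' * q u - p u * q') / (q u * q u)) (at u)" if "q u \<noteq> 0"
  proof -
    have e: "\<forall>\<^sub>F t in nhds u. (THE s. vector [s, 1] \<in> proj_point (p t) (q t)) = p t / q t"
      using ev[OF q that] by eventually_elim (rule th2)
    show ?thesis
      unfolding DERIV_cong_ev[OF refl e refl] by (rule DERIV_divide[OF p q that])
  qed
  have "RP1_critical_point (\<lambda>t. proj_point (p t) (q t)) u \<longleftrightarrow>
      (p u \<noteq> 0 \<and> ((\<lambda>t. THE s. vector [1, s] \<in> proj_point (p t) (q t)) has_real_derivative 0) (at u)) \<or>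
      (q u \<noteq> 0 \<and> ((\<lambda>t. THE s. vector [s, 1] \<in> proj_point (p t) (q t)) has_real_derivative 0) (at u))"
    unfolding RP1_critical_point_def RP1_charts_def by (simp add: in1[OF nz] in2[OF nz] del: Diff_iff)
  also have "\<dots> \<longleftrightarrow> (p u \<noteq> 0 \<and> q' * p u - q u * p' = 0) \<or> (q u \<noteq> 0 \<and> p' * q u - p u * q' = 0)"
  proof (intro disj_cong conj_cong refl)
    show "((\<lambda>t. THE s. vector [1, s] \<in> proj_point (p t) (q t)) has_real_derivative 0) (at u)
        \<longleftrightarrow> q' * p u - q u * p' = 0" if "p u \<noteq> 0"
      using 1[OF that] DERIV_unique[OF 1[OF that], of 0] that by (cases "q' * p u - q u * p' = 0") auto
    show "((\<lambda>t. THE s. vector [s, 1] \<in> proj_point (p t) (q t)) has_real_derivative 0) (at u)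
        \<longleftrightarrow> p' * q u - p u * q' = 0" if "q u \<noteq> 0"
      using 2[OF that] DERIV_unique[OF 2[OF that], of 0] that by (cases "p' * q u - p u * q' = 0") auto
  qed
  also have "\<dots> \<longleftrightarrow> p u * q' - q u * p' = 0"
    using nz by (auto simp: algebra_simps)
  finally show ?thesis .
qed

subsection \<open>The chord of a parallel pair\<close>

lemma det2_eq: "det2 v w = v $ 1 * w $ 2 - v $ 2 * w $ 1"
  by (simp add: det2_def det_2)

lemma unit_dir_nth: "unit_dir a $ 1 = cos a" "unit_dir a $ 2 = sin a"
  by (simp_all add: unit_dir_def)

lemma norm_plane: "(norm v)\<^sup>2 = (v $ 1)\<^sup>2 + (v $ 2)\<^sup>2" for v :: "real^2"
  by (simp add: norm_vec_def L2_set_def sum_2)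

lemma Ck_at_eventually:
  fixes f :: "real \<Rightarrow> real"
  assumes "Ck_at \<infinity> 0 f" "open A" "f 0 \<in> A"
  shows "\<forall>\<^sub>F u in nhds 0. f u \<in> A"
proof -
  have "(f \<longlongrightarrow> f 0) (nhds 0)"
    using smooth_germ_isCont assms(1)
    unfolding smooth_germ_iff_Ck_at[symmetric] isCont_def tendsto_at_iff_tendsto_nhds by blast
  then show ?thesis using assms(2,3) by (rule topological_tendstoD)
qed

locale parallel_chords =
  fixes \<gamma>p \<gamma>m :: "real \<Rightarrow> real^2" and \<rho>p \<rho>m :: "real \<Rightarrow> real" and \<theta>\<^sub>0 :: real
  assumes pair: "angular_parallel_pair \<theta>\<^sub>0 \<rho>p \<rho>m \<gamma>p \<gamma>m"
    and det0: "det2 (chord \<gamma>p \<gamma>m 0) (unit_dir (0 + \<theta>\<^sub>0)) \<noteq> 0"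
    and sum0: "radius_sum \<rho>p \<rho>m 0 \<noteq> 0"
begin

abbreviation "S \<equiv> css \<rho>p \<rho>m \<gamma>p \<gamma>m"
abbreviation "\<Delta> \<equiv> chord \<gamma>p \<gamma>m"
abbreviation "R \<equiv> radius_sum \<rho>p \<rho>m"
abbreviation "J \<equiv> radius_jac \<rho>p \<rho>m"
abbreviation "e u \<equiv> unit_dir (u + \<theta>\<^sub>0)"

text \<open>The angular velocity of the chord; its reciprocal is the factor in front of
  \<open>deriv\<close> in \<open>D_phi\<close>.\<close>

definition "\<kappa> u = R u * det2 (\<Delta> u) (e u) / (norm (\<Delta> u))\<^sup>2"
definition "c = \<Delta> 0 $ 1 / norm (\<Delta> 0)"
definition "s = \<Delta> 0 $ 2 / norm (\<Delta> 0)"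
definition "\<xi> u = c * \<Delta> u $ 1 + s * \<Delta> u $ 2"
definition "\<eta> u = c * \<Delta> u $ 2 - s * \<Delta> u $ 1"
text \<open>The chord angle relative to the chord at 0. The coordinate \<open>\<xi>\<close> along
  the initial chord is positive near 0, so the principal value of \<open>arctan\<close> is the angle
  and no branch has to be chosen.\<close>

definition "angle u = arctan (\<eta> u / \<xi> u)"

lemma smooth_data: "smooth_germ \<rho>p" "smooth_germ \<rho>m"
    "Ck_at \<infinity> 0 (\<lambda>u. \<gamma>p u $ i)" "Ck_at \<infinity> 0 (\<lambda>u. \<gamma>m u $ i)"
  using pair unfolding angular_parallel_pair_def tangent_lift_def cooriented_frontal_def smooth_germ_iff_Ck_at
  by (auto intro: Ck_at_vec_nth)

lemma ev_derivative_\<gamma>: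
  "\<forall>\<^sub>F u in nhds 0. (\<gamma>p has_vector_derivative \<rho>p u *\<^sub>R e u) (at u)"
  "\<forall>\<^sub>F u in nhds 0. (\<gamma>m has_vector_derivative \<rho>m u *\<^sub>R (- e u)) (at u)"
  using pair unfolding angular_parallel_pair_def tangent_lift_def by (auto elim: eventually_mono)

lemma smooth_\<rho>: "Ck_at \<infinity> 0 \<rho>p" "Ck_at \<infinity> 0 \<rho>m" "Ck_at \<infinity> 0 R" "Ck_at \<infinity> 0 J"
proof -
  show 1: "Ck_at \<infinity> 0 \<rho>p" "Ck_at \<infinity> 0 \<rho>m"
    using smooth_data by (simp_all add: smooth_germ_iff_Ck_at)
  show "Ck_at \<infinity> 0 R"
    unfolding radius_sum_def[abs_def] by (intro Ck_at_add 1)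
  show "Ck_at \<infinity> 0 J"
    unfolding radius_jac_def[abs_def]
    by (intro Ck_at_diff Ck_at_mult 1 smooth_germ_deriv(1)[unfolded smooth_germ_iff_Ck_at])
qed

lemma smooth_chord: "Ck_at \<infinity> 0 (\<lambda>u. \<Delta> u $ i)"
  unfolding chord_def by (simp add: Ck_at_diff smooth_data)

lemma smooth_det: "Ck_at \<infinity> 0 (\<lambda>u. det2 (\<Delta> u) (e u))"
proof -
  have "Ck_at \<infinity> 0 (\<lambda>u. u + \<theta>\<^sub>0)" by (intro Ck_at_add Ck_at_id Ck_at_const)
  from Ck_at_compose[OF Ck_at_infty_sin_cos(1) this] Ck_at_compose[OF Ck_at_infty_sin_cos(2) this]
  show ?thesis
    unfolding det2_eq unit_dir_nth by (intro Ck_at_diff Ck_at_mult smooth_chord)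
qed

lemma chord_0: "norm (\<Delta> 0) > 0"
  using det0 by (auto simp: det2_eq)

lemma frame: "c\<^sup>2 + s\<^sup>2 = 1"
proof -
  have "c\<^sup>2 + s\<^sup>2 = (norm (\<Delta> 0))\<^sup>2 / (norm (\<Delta> 0))\<^sup>2"
    unfolding c_def s_def power_divide add_divide_distrib[symmetric] norm_plane[symmetric] ..
  then show ?thesis using chord_0 by simp
qed

lemma \<xi>_\<eta>_0: "\<xi> 0 = norm (\<Delta> 0)" "\<eta> 0 = 0"
proof -
  have "\<xi> 0 * norm (\<Delta> 0) = (norm (\<Delta> 0))\<^sup>2"
    unfolding norm_plane using chord_0 by (simp add: \<xi>_def c_def s_def power2_eq_square field_simps)
  then show "\<xi> 0 = norm (\<Delta> 0)" using chord_0 by (simp add: power2_eq_square)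
  show "\<eta> 0 = 0" using chord_0 by (simp add: \<eta>_def c_def s_def)
qed

lemma \<xi>_\<eta>_norm: "(\<xi> u)\<^sup>2 + (\<eta> u)\<^sup>2 = (norm (\<Delta> u))\<^sup>2"
proof -
  have "(\<xi> u)\<^sup>2 + (\<eta> u)\<^sup>2 = (c\<^sup>2 + s\<^sup>2) * ((\<Delta> u $ 1)\<^sup>2 + (\<Delta> u $ 2)\<^sup>2)"
    by (simp add: \<xi>_def \<eta>_def power2_eq_square algebra_simps)
  then show ?thesis by (simp add: frame norm_plane)
qed

lemma smooth_\<xi>_\<eta>: "Ck_at \<infinity> 0 \<xi>" "Ck_at \<infinity> 0 \<eta>"
  unfolding \<xi>_def[abs_def] \<eta>_def[abs_def]
  by (intro Ck_at_add Ck_at_diff Ck_at_mult Ck_at_const smooth_chord)+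

lemma smooth_angle: "Ck_at \<infinity> 0 angle"
proof -
  have "Ck_at \<infinity> 0 (\<lambda>u. \<eta> u / \<xi> u)"
    using chord_0 by (intro Ck_at_divide smooth_\<xi>_\<eta>) (simp add: \<xi>_\<eta>_0)
  from Ck_at_compose[OF Ck_at_infty_arctan this] show ?thesis
    unfolding angle_def[abs_def] .
qed

lemma angle_0: "angle 0 = 0"
  by (simp add: angle_def \<xi>_\<eta>_0)

lemma ev_nonzero: "\<forall>\<^sub>F u in nhds 0. R u \<noteq> 0" "\<forall>\<^sub>F u in nhds 0. det2 (\<Delta> u) (e u) \<noteq> 0"
    "\<forall>\<^sub>F u in nhds 0. \<xi> u > 0"
  using Ck_at_eventually[OF smooth_\<rho>(3), of "- {0}"] Ck_at_eventually[OF smooth_det, of "- {0}"]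
    Ck_at_eventually[OF smooth_\<xi>_\<eta>(1), of "{0<..}"] sum0 det0 chord_0
  by (simp_all add: \<xi>_\<eta>_0 open_Compl)

lemma polar:
  assumes "\<xi> u > 0"
  shows "\<xi> u = norm (\<Delta> u) * cos (angle u)" "\<eta> u = norm (\<Delta> u) * sin (angle u)" "norm (\<Delta> u) > 0"
proof -
  have "norm (\<Delta> u) \<noteq> 0" using \<xi>_\<eta>_norm[of u] assms by (auto simp: sum_power2_eq_zero_iff)
  then show n: "norm (\<Delta> u) > 0" by simp
  have "1 + (\<eta> u / \<xi> u)\<^sup>2 = (norm (\<Delta> u) / \<xi> u)\<^sup>2"
    unfolding power_divide \<xi>_\<eta>_norm[symmetric] using assms by (simp add: field_simps)
  then have "sqrt (1 + (\<eta> u / \<xi> u)\<^sup>2) = norm (\<Delta> u) / \<xi> u"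
    using assms n by (simp only: real_sqrt_abs) simp
  then show "\<xi> u = norm (\<Delta> u) * cos (angle u)" "\<eta> u = norm (\<Delta> u) * sin (angle u)"
    unfolding angle_def cos_arctan sin_arctan using assms n by simp_all
qed

text \<open>Near 0 the norm is the quotient \<open>\<xi> / cos (angle)\<close> of smooth germs,
  which avoids differentiating a square root.\<close>

lemma smooth_norm_chord: "Ck_at \<infinity> 0 (\<lambda>u. norm (\<Delta> u))"
proof (rule Ck_at_cong)
  show "Ck_at \<infinity> 0 (\<lambda>u. \<xi> u / cos (angle u))"
    by (intro Ck_at_divide smooth_\<xi>_\<eta> Ck_at_compose[OF Ck_at_infty_sin_cos(2) smooth_angle])
      (simp add: angle_0)
  show "\<forall>\<^sub>F u in nhds 0. \<xi> u / cos (angle u) = norm (\<Delta> u)"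
    using ev_nonzero(3)
  proof eventually_elim
    case (elim u)
    then have "cos (angle u) \<noteq> 0" using polar[of u] by auto
    then show ?case using polar(1)[OF elim] by simp
  qed
qed

lemma ev_derivative_chord: "\<forall>\<^sub>F u in nhds 0. \<forall>i. ((\<lambda>u. \<Delta> u $ i) has_real_derivative R u * e u $ i) (at u)"
  using ev_derivative_\<gamma>
proof eventually_elim
  case (elim u)
  have "(\<Delta> has_vector_derivative \<rho>p u *\<^sub>R e u - \<rho>m u *\<^sub>R (- e u)) (at u)"
    unfolding chord_def[abs_def] by (rule has_vector_derivative_diff[OF elim])
  from bounded_linear.has_vector_derivative[OF bounded_linear_vec_nth this]
  show ?case
    by (simp add: has_real_derivative_iff_has_vector_derivative radius_sum_def algebra_simps)
qed

text \<open>The derivative of a polar angle is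
  \<open>(\<xi> \<eta>' - \<eta> \<xi>') / (\<xi>^2 + \<eta>^2)\<close>, and the chord has velocity
  \<open>R e\<close>. The numerator is invariant under the rotation of the frame, so it equals
  \<open>R\<close> times the determinant of chord and \<open>e\<close>.\<close>

lemma ev_derivative_angle: "\<forall>\<^sub>F u in nhds 0. (angle has_real_derivative \<kappa> u) (at u)"
  using ev_derivative_chord ev_nonzero(3)
proof eventually_elim
  case (elim u)
  let ?\<xi>' = "c * (R u * e u $ 1) + s * (R u * e u $ 2)" and ?\<eta>' = "c * (R u * e u $ 2) - s * (R u * e u $ 1)"
  have d: "(\<xi> has_real_derivative ?\<xi>') (at u)" "(\<eta> has_real_derivative ?\<eta>') (at u)"
    unfolding \<xi>_def[abs_def] \<eta>_def[abs_def]
    by (intro DERIV_add DERIV_diff DERIV_cmult elim(1)[rule_format])+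
  have "((\<lambda>u. arctan (\<eta> u / \<xi> u)) has_real_derivative
      inverse (1 + (\<eta> u / \<xi> u)\<^sup>2) * ((?\<eta>' * \<xi> u - \<eta> u * ?\<xi>') / (\<xi> u * \<xi> u))) (at u)"
    by (rule DERIV_chain2[OF DERIV_arctan DERIV_divide[OF d(2,1)]]) (use elim(2) in simp)
  moreover have "inverse (1 + (\<eta> u / \<xi> u)\<^sup>2) * ((?\<eta>' * \<xi> u - \<eta> u * ?\<xi>') / (\<xi> u * \<xi> u)) = \<kappa> u"
  proof -
    have "?\<eta>' * \<xi> u - \<eta> u * ?\<xi>' = R u * det2 (\<Delta> u) (e u) * (c\<^sup>2 + s\<^sup>2)"
      by (simp add: \<xi>_def \<eta>_def det2_eq power2_eq_square algebra_simps)
    moreover have "1 + (\<eta> u / \<xi> u)\<^sup>2 = (norm (\<Delta> u))\<^sup>2 / (\<xi> u * \<xi> u)"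
      unfolding power_divide \<xi>_\<eta>_norm[symmetric] using elim(2) by (simp add: field_simps power2_eq_square)
    ultimately show ?thesis
      using elim(2) by (simp add: \<kappa>_def frame)
  qed
  ultimately show ?case unfolding angle_def[abs_def] by simp
qed

lemma ev_\<kappa>: "\<forall>\<^sub>F u in nhds 0. \<kappa> u \<noteq> 0"
  using ev_nonzero
  by eventually_elim (auto simp: \<kappa>_def dest: polar(3))

text \<open>The weight \<open>\<rho>m / R\<close> is such that the contributions along
  \<open>e\<close> cancel: the velocity of \<open>\<gamma>m\<close> is compensated by the weighted
  velocity of the chord. What remains is the derivative of the weight times the chord.\<close>

lemma ev_derivative_css: "\<forall>\<^sub>F u in nhds 0. (S has_vector_derivative (J u / (R u)\<^sup>2) *\<^sub>R \<Delta> u) (at u)"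
  using ev_derivative_\<gamma> ev_nonzero(1) smooth_germ_deriv(2)[OF smooth_data(1)] smooth_germ_deriv(2)[OF smooth_data(2)]
proof eventually_elim
  case (elim u)
  have dR: "(R has_real_derivative deriv \<rho>p u + deriv \<rho>m u) (at u)"
    unfolding radius_sum_def[abs_def] by (rule DERIV_add[OF elim(4,5)])
  have "((\<lambda>u. \<rho>m u / R u) has_real_derivative
      (deriv \<rho>m u * R u - \<rho>m u * (deriv \<rho>p u + deriv \<rho>m u)) / (R u * R u)) (at u)"
    by (rule DERIV_divide[OF elim(5) dR elim(3)])
  also have "(deriv \<rho>m u * R u - \<rho>m u * (deriv \<rho>p u + deriv \<rho>m u)) / (R u * R u) = J u / (R u)\<^sup>2"
    by (simp add: radius_sum_def radius_jac_def power2_eq_square algebra_simps)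
  finally have q: "((\<lambda>u. \<rho>m u / R u) has_real_derivative J u / (R u)\<^sup>2) (at u)" .
  have "(\<Delta> has_vector_derivative \<rho>p u *\<^sub>R e u - \<rho>m u *\<^sub>R (- e u)) (at u)"
    unfolding chord_def[abs_def] by (rule has_vector_derivative_diff[OF elim(1,2)])
  then have d\<Delta>: "(\<Delta> has_vector_derivative R u *\<^sub>R e u) (at u)"
    by (simp add: radius_sum_def algebra_simps)
  have "(S has_vector_derivative \<rho>m u *\<^sub>R (- e u) + ((\<rho>m u / R u) *\<^sub>R (R u *\<^sub>R e u) + (J u / (R u)\<^sup>2) *\<^sub>R \<Delta> u)) (at u)"
    unfolding css_def[abs_def]
    by (rule has_vector_derivative_add[OF elim(2) has_vector_derivative_scaleR[OF q d\<Delta>]])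
  then show ?case using elim(3) by simp
qed

text \<open>The inverse germ of the chord angle, inverse only near 0. It is fixed by choice so that
  \<open>\<sigma>\<close>, \<open>x\<close> and \<open>y\<close> can be defined from it and the
  locale of angular curves can be instantiated.\<close>

definition w where
  "w = (SOME w. smooth_germ w \<and> w 0 = 0 \<and> (\<forall>\<^sub>F u in nhds 0. w (angle u) = u) \<and> (\<forall>\<^sub>F \<phi> in nhds 0. angle (w \<phi>) = \<phi>))"

lemma inverse_angle: "smooth_germ w" "w 0 = 0" "\<forall>\<^sub>F u in nhds 0. w (angle u) = u" "\<forall>\<^sub>F \<phi> in nhds 0. angle (w \<phi>) = \<phi>"
proof -
  have "(angle has_real_derivative \<kappa> 0) (at 0)" "\<kappa> 0 \<noteq> 0"
    using eventually_nhds_x_imp_x[OF ev_derivative_angle] eventually_nhds_x_imp_x[OF ev_\<kappa>] by auto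
  then obtain U V v where *: "open U" "open V" "0 \<in> U" "homeomorphism U V angle v" "Ck_on \<infinity> V v"
    using Ck_at_local_inverse_real[OF smooth_angle] by (metis enat_ord_code(3))
  have 0: "0 \<in> V" "v 0 = 0"
    using *(3,4) angle_0 by (force simp: homeomorphism_def)+
  have "smooth_germ v"
    unfolding smooth_germ_def using *(2,5) 0(1) by blast
  moreover have "\<forall>\<^sub>F u in nhds 0. v (angle u) = u"
    using eventually_nhds_in_open[OF *(1,3)] by eventually_elim (use *(4) in \<open>simp add: homeomorphism_def\<close>)
  moreover have "\<forall>\<^sub>F \<phi> in nhds 0. angle (v \<phi>) = \<phi>"
    using eventually_nhds_in_open[OF *(2) 0(1)] by eventually_elim (use *(4) in \<open>simp add: homeomorphism_def\<close>)
  ultimately have "\<exists>w. smooth_germ w \<and> w 0 = 0 \<and> (\<forall>\<^sub>F u in nhds 0. w (angle u) = u) \<and> (\<forall>\<^sub>F \<phi> in nhds 0. angle (w \<phi>) = \<phi>)"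
    using 0(2) by blast
  note * = someI_ex[OF this, folded w_def]
  show "smooth_germ w" "w 0 = 0" "\<forall>\<^sub>F u in nhds 0. w (angle u) = u" "\<forall>\<^sub>F \<phi> in nhds 0. angle (w \<phi>) = \<phi>"
    by (rule *[THEN conjunct1] *[THEN conjunct2, THEN conjunct1] *[THEN conjunct2, THEN conjunct2, THEN conjunct1]
        *[THEN conjunct2, THEN conjunct2, THEN conjunct2])+
qed

lemma eventually_w:
  assumes "\<forall>\<^sub>F u in nhds 0. P u"
  shows "\<forall>\<^sub>F \<phi> in nhds 0. P (w \<phi>)"
  by (rule eventually_compose_filterlim[OF assms smooth_germ_filterlim[OF inverse_angle(1,2)]])

text \<open>Differentiating \<open>angle (w \<phi>) = \<phi>\<close> at the points near 0 calls for
  the identity near each of these points, hence the doubly eventual statement in the proof.\<close>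

lemma ev_derivative_w: "\<forall>\<^sub>F \<phi> in nhds 0. (w has_real_derivative 1 / \<kappa> (w \<phi>)) (at \<phi>)"
proof -
  have "\<forall>\<^sub>F \<phi> in nhds 0. \<forall>\<^sub>F y in nhds \<phi>. angle (w y) = y"
    using inverse_angle(4) by (simp add: eventually_eventually)
  with eventually_w[OF ev_derivative_angle] eventually_w[OF ev_\<kappa>] smooth_germ_deriv(2)[OF inverse_angle(1)]
  show ?thesis
  proof eventually_elim
    case (elim \<phi>)
    have "((\<lambda>y. angle (w y)) has_real_derivative \<kappa> (w \<phi>) * deriv w \<phi>) (at \<phi>)"
      by (rule DERIV_chain2[OF elim(1,3)])
    moreover have "((\<lambda>y. angle (w y)) has_real_derivative 1) (at \<phi>)"
      unfolding DERIV_cong_ev[OF refl elim(4) refl] by (rule DERIV_ident)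
    ultimately have "\<kappa> (w \<phi>) * deriv w \<phi> = 1" by (rule DERIV_unique)
    then have "deriv w \<phi> = 1 / \<kappa> (w \<phi>)" using elim(2) by (simp add: field_simps)
    then show ?case using elim(3) by simp
  qed
qed

section \<open>The branch as a curve in the chord angle\<close>

abbreviation "speed \<equiv> css_speed \<theta>\<^sub>0 \<rho>p \<rho>m \<gamma>p \<gamma>m"

definition "\<sigma> \<phi> = speed (w \<phi>)"
definition "x \<phi> = c * (S (w \<phi>) $ 1 - S 0 $ 1) + s * (S (w \<phi>) $ 2 - S 0 $ 2)"
definition "y \<phi> = c * (S (w \<phi>) $ 2 - S 0 $ 2) - s * (S (w \<phi>) $ 1 - S 0 $ 1)"

lemma smooth_speed: "smooth_germ speed"
  unfolding smooth_germ_iff_Ck_at css_speed_def[abs_def]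
  by (intro Ck_at_divide Ck_at_mult Ck_at_power smooth_\<rho> smooth_norm_chord smooth_det) (use det0 sum0 in simp)

lemma smooth_\<sigma>: "smooth_germ \<sigma>"
  unfolding \<sigma>_def[abs_def] by (rule smooth_germ_compose[OF smooth_speed inverse_angle(1,2)])

lemma smooth_css: "smooth_germ (\<lambda>u. S u $ i)"
  unfolding smooth_germ_iff_Ck_at css_def vector_add_component vector_scaleR_component
  by (intro Ck_at_add Ck_at_scaleR Ck_at_divide smooth_data smooth_\<rho> smooth_chord sum0)

lemma ev_derivative_css_w:
  "\<forall>\<^sub>F \<phi> in nhds 0. \<forall>i. ((\<lambda>\<phi>. S (w \<phi>) $ i) has_real_derivative
    J (w \<phi>) / (R (w \<phi>))\<^sup>2 * \<Delta> (w \<phi>) $ i * (1 / \<kappa> (w \<phi>))) (at \<phi>)"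
  using eventually_w[OF ev_derivative_css] ev_derivative_w
proof eventually_elim
  case (elim \<phi>)
  show ?case
  proof
    fix i
    have "((\<lambda>u. S u $ i) has_real_derivative J (w \<phi>) / (R (w \<phi>))\<^sup>2 * \<Delta> (w \<phi>) $ i) (at (w \<phi>))"
      using bounded_linear.has_vector_derivative[OF bounded_linear_vec_nth elim(1), of i]
      by (simp add: has_real_derivative_iff_has_vector_derivative)
    then show "((\<lambda>\<phi>. S (w \<phi>) $ i) has_real_derivative
        J (w \<phi>) / (R (w \<phi>))\<^sup>2 * \<Delta> (w \<phi>) $ i * (1 / \<kappa> (w \<phi>))) (at \<phi>)"
      by (rule DERIV_chain2[OF _ elim(2)])
  qed
qed

lemma ev_derivative_xy:
  "\<forall>\<^sub>F \<phi> in nhds 0. (x has_real_derivative \<sigma> \<phi> * cos \<phi>) (at \<phi>)"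
  "\<forall>\<^sub>F \<phi> in nhds 0. (y has_real_derivative \<sigma> \<phi> * sin \<phi>) (at \<phi>)"
proof -
  have "\<forall>\<^sub>F \<phi> in nhds 0. (x has_real_derivative \<sigma> \<phi> * cos \<phi>) (at \<phi>) \<and> (y has_real_derivative \<sigma> \<phi> * sin \<phi>) (at \<phi>)"
    using ev_derivative_css_w inverse_angle(4) eventually_w[OF ev_nonzero(1)] eventually_w[OF ev_nonzero(2)]
      eventually_w[OF ev_nonzero(3)]
  proof eventually_elim
    case (elim \<phi>)
    let ?u = "w \<phi>"
    let ?k = "J ?u / (R ?u)\<^sup>2 * (1 / \<kappa> ?u)"
    \<comment> \<open>The factor \<open>1 / \<kappa>\<close> brings in the squared chord length over
      \<open>R\<close> times the determinant; the signed length of the derivative of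
      \<open>S\<close> in the angle is then exactly \<open>css_speed\<close>.\<close>
    have k: "?k * norm (\<Delta> ?u) = \<sigma> \<phi>"
      using elim(3,4) polar(3)[OF elim(5)]
      by (simp add: \<sigma>_def css_speed_def \<kappa>_def power2_eq_square power3_eq_cube)
    have "(x has_real_derivative c * (J ?u / (R ?u)\<^sup>2 * \<Delta> ?u $ 1 * (1 / \<kappa> ?u) - 0)
        + s * (J ?u / (R ?u)\<^sup>2 * \<Delta> ?u $ 2 * (1 / \<kappa> ?u) - 0)) (at \<phi>)"
      unfolding x_def[abs_def]
      by (intro DERIV_add DERIV_cmult DERIV_diff DERIV_const elim(1)[rule_format])
    also have "c * (J ?u / (R ?u)\<^sup>2 * \<Delta> ?u $ 1 * (1 / \<kappa> ?u) - 0)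
        + s * (J ?u / (R ?u)\<^sup>2 * \<Delta> ?u $ 2 * (1 / \<kappa> ?u) - 0) = ?k * \<xi> ?u"
      unfolding \<xi>_def by (simp add: algebra_simps add_divide_distrib)
    also have "\<dots> = \<sigma> \<phi> * cos \<phi>"
      unfolding polar(1)[OF elim(5)] elim(2) k[symmetric] by simp
    finally have dx: "(x has_real_derivative \<sigma> \<phi> * cos \<phi>) (at \<phi>)" .
    have "(y has_real_derivative c * (J ?u / (R ?u)\<^sup>2 * \<Delta> ?u $ 2 * (1 / \<kappa> ?u) - 0)
        - s * (J ?u / (R ?u)\<^sup>2 * \<Delta> ?u $ 1 * (1 / \<kappa> ?u) - 0)) (at \<phi>)"
      unfolding y_def[abs_def]
      by (intro DERIV_diff DERIV_cmult DERIV_const elim(1)[rule_format])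
    also have "c * (J ?u / (R ?u)\<^sup>2 * \<Delta> ?u $ 2 * (1 / \<kappa> ?u) - 0)
        - s * (J ?u / (R ?u)\<^sup>2 * \<Delta> ?u $ 1 * (1 / \<kappa> ?u) - 0) = ?k * \<eta> ?u"
      unfolding \<eta>_def by (simp add: algebra_simps diff_divide_distrib)
    also have "\<dots> = \<sigma> \<phi> * sin \<phi>"
      unfolding polar(2)[OF elim(5)] elim(2) k[symmetric] by simp
    finally show ?case using dx by blast
  qed
  then show "\<forall>\<^sub>F \<phi> in nhds 0. (x has_real_derivative \<sigma> \<phi> * cos \<phi>) (at \<phi>)"
    "\<forall>\<^sub>F \<phi> in nhds 0. (y has_real_derivative \<sigma> \<phi> * sin \<phi>) (at \<phi>)"
    by (auto elim: eventually_mono)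
qed

sublocale angular_curve S w x y \<sigma> "1 / \<kappa> 0" c s
proof
  have cw: "smooth_germ (\<lambda>\<phi>. S (w \<phi>) $ i)" for i
    by (rule smooth_germ_compose[OF smooth_css inverse_angle(1,2)])
  show "smooth_germ x" "smooth_germ y"
    using cw unfolding x_def[abs_def] y_def[abs_def] smooth_germ_iff_Ck_at
    by (intro Ck_at_add Ck_at_diff Ck_at_mult Ck_at_const; blast)+
  show "(w has_real_derivative 1 / \<kappa> 0) (at 0)"
    using eventually_nhds_x_imp_x[OF ev_derivative_w] by (simp add: inverse_angle(2))
  show "1 / \<kappa> 0 \<noteq> 0" using eventually_nhds_x_imp_x[OF ev_\<kappa>] by simp
  show "\<forall>\<^sub>F \<phi> in nhds 0. S (w \<phi>) = S 0 + x \<phi> *\<^sub>R vector [c, s] + y \<phi> *\<^sub>R vector [- s, c]"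
  proof (intro always_eventually allI)
    fix \<phi>
    let ?d = "\<lambda>i. S (w \<phi>) $ i - S 0 $ i"
    have "x \<phi> * c - y \<phi> * s = (c\<^sup>2 + s\<^sup>2) * ?d 1" "x \<phi> * s + y \<phi> * c = (c\<^sup>2 + s\<^sup>2) * ?d 2"
      unfolding x_def y_def by (simp_all add: power2_eq_square algebra_simps)
    then show "S (w \<phi>) = S 0 + x \<phi> *\<^sub>R vector [c, s] + y \<phi> *\<^sub>R vector [- s, c]"
      by (simp add: vec_eq_iff forall_2 frame)
  qed
  show "x 0 = 0" "y 0 = 0" by (simp_all add: x_def y_def inverse_angle(2))
qed (rule inverse_angle(1,2) smooth_\<sigma> frame ev_derivative_xy)+

text \<open>\<open>speed\<close> is \<open>J\<close> times a germ \<open>M\<close> with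
  \<open>M 0 \<noteq> 0\<close>, and \<open>\<sigma>\<close> is \<open>speed\<close> after the
  change of parameter \<open>w\<close>; both operations and their inverses preserve orders. Orders
  are compared because individual Taylor coefficients of \<open>J\<close> and
  \<open>\<sigma>\<close> do not correspond.\<close>

lemma jac_bigo_iff: "J \<in> O[nhds 0](\<lambda>u. u ^ n) \<longleftrightarrow> \<sigma> \<in> O[nhds 0](\<lambda>\<phi>. \<phi> ^ n)"
proof -
  define M where "M u = norm (\<Delta> u) ^ 3 / (R u ^ 3 * det2 (\<Delta> u) (e u))" for u
  have M: "smooth_germ M" "M 0 \<noteq> 0"
  proof -
    show "smooth_germ M"
      unfolding smooth_germ_iff_Ck_at M_def[abs_def]
      by (intro Ck_at_divide Ck_at_mult Ck_at_power smooth_\<rho> smooth_norm_chord smooth_det)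
        (use det0 sum0 in simp)
    show "M 0 \<noteq> 0" using det0 sum0 chord_0 by (simp add: M_def)
  qed
  have iM: "smooth_germ (\<lambda>u. 1 / M u)"
    using M unfolding smooth_germ_iff_Ck_at by (intro Ck_at_divide Ck_at_const)
  have sp: "speed u = J u * M u" for u by (simp add: css_speed_def M_def)
  show ?thesis
  proof
    assume "J \<in> O[nhds 0](\<lambda>u. u ^ n)"
    from landau_o.big.mult[OF this isCont_imp_bigo_1[OF smooth_germ_isCont[OF M(1)]]]
    have "speed \<in> O[nhds 0](\<lambda>u. u ^ n)"
      unfolding ext[of speed, OF sp] by (simp only: mult_1_right)
    from bigo_compose_germ[OF this inverse_angle(1,2)] show "\<sigma> \<in> O[nhds 0](\<lambda>\<phi>. \<phi> ^ n)"
      by (simp add: \<sigma>_def[abs_def])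
  next
    assume "\<sigma> \<in> O[nhds 0](\<lambda>\<phi>. \<phi> ^ n)"
    from bigo_compose_germ[OF this smooth_angle[folded smooth_germ_iff_Ck_at] angle_0]
    have "(\<lambda>u. \<sigma> (angle u)) \<in> O[nhds 0](\<lambda>u. u ^ n)" .
    from landau_o.big.mult[OF this isCont_imp_bigo_1[OF smooth_germ_isCont[OF iM]]]
    have a: "(\<lambda>u. \<sigma> (angle u) * (1 / M u)) \<in> O[nhds 0](\<lambda>u. u ^ n)" by (simp only: mult_1_right)
    have b: "\<forall>\<^sub>F u in nhds 0. \<sigma> (angle u) * (1 / M u) = J u"
      using inverse_angle(3) Ck_at_eventually[of M "- {0}"] M by (auto simp: smooth_germ_iff_Ck_at open_Compl \<sigma>_def sp elim: eventually_elim2)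
    show "J \<in> O[nhds 0](\<lambda>u. u ^ n)"
      by (rule landau_o.big.in_cong[OF b, THEN iffD1, OF a])
  qed
qed

lemma jac_jet_iff: "(\<forall>k<n. taylor_coeff J k = 0) \<longleftrightarrow> (\<forall>k<n. taylor_coeff \<sigma> k = 0)"
  using jac_bigo_iff[of n] smooth_\<rho>(4) smooth_germ_bigo_iff[OF smooth_\<sigma>] smooth_germ_bigo_iff[of J]
  by (simp add: smooth_germ_iff_Ck_at)

text \<open>Under \<open>w\<close> the operator \<open>D_phi\<close> becomes differentiation in
  \<open>\<phi>\<close>, since both its factor and the derivative of \<open>w\<close> are the
  reciprocal of \<open>\<kappa>\<close>.\<close>

lemma css_sigma_eq: "css_sigma \<theta>\<^sub>0 \<rho>p \<rho>m \<gamma>p \<gamma>m j = fact j * taylor_coeff \<sigma> j"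
proof -
  let ?D = "D_phi \<theta>\<^sub>0 \<rho>p \<rho>m \<gamma>p \<gamma>m"
  \<comment> \<open>The identity must hold near 0, not just at 0, to survive the next
    differentiation; smoothness is included for the chain rule.\<close>
  have "smooth_germ ((?D ^^ j) speed) \<and> (\<forall>\<^sub>F \<phi> in nhds 0. (deriv ^^ j) \<sigma> \<phi> = (?D ^^ j) speed (w \<phi>))"
  proof (induction j)
    case 0
    then show ?case by (simp add: smooth_speed \<sigma>_def)
  next
    case (Suc j)
    let ?G = "(?D ^^ j) speed"
    have G: "smooth_germ ?G" using Suc by blast
    have "?D ?G = (\<lambda>u. (norm (\<Delta> u))\<^sup>2 / (R u * det2 (\<Delta> u) (e u)) * deriv ?G u)"
      by (rule ext) (rule D_phi_def)
    then have "smooth_germ (?D ?G)"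
      unfolding smooth_germ_iff_Ck_at
    proof (elim ssubst)
      show "Ck_at \<infinity> 0 (\<lambda>u. (norm (\<Delta> u))\<^sup>2 / (R u * det2 (\<Delta> u) (e u)) * deriv ?G u)"
        by (intro Ck_at_divide Ck_at_mult Ck_at_power smooth_\<rho> smooth_norm_chord smooth_det
            smooth_germ_deriv(1)[OF G, unfolded smooth_germ_iff_Ck_at]) (use det0 sum0 in simp)
    qed
    moreover have "\<forall>\<^sub>F \<phi> in nhds 0. deriv ((deriv ^^ j) \<sigma>) \<phi> = ?D ?G (w \<phi>)"
    proof -
      have "\<forall>\<^sub>F \<phi> in nhds 0. deriv ((deriv ^^ j) \<sigma>) \<phi> = deriv (\<lambda>\<phi>. ?G (w \<phi>)) \<phi>"
        using Suc by (intro eventually_deriv_eq) blast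
      with eventually_w[OF smooth_germ_deriv(2)[OF G]] ev_derivative_w show ?thesis
      proof eventually_elim
        case (elim \<phi>)
        have "deriv (\<lambda>\<phi>. ?G (w \<phi>)) \<phi> = deriv ?G (w \<phi>) * (1 / \<kappa> (w \<phi>))"
          by (rule DERIV_imp_deriv[OF DERIV_chain2[OF elim(1,2)]])
        then show ?case
          unfolding elim(3) by (simp add: D_phi_def \<kappa>_def)
      qed
    qed
    ultimately show ?case by simp
  qed
  then have "(deriv ^^ j) \<sigma> 0 = (?D ^^ j) speed (w 0)"
    using eventually_nhds_x_imp_x by blast
  then show ?thesis
    by (simp add: css_sigma_def taylor_coeff_def inverse_angle(2))
qed

text \<open>With \<open>s_j\<close> the Taylor coefficients of \<open>\<sigma>\<close>, the
  factorials turn \<open>Q_S\<close> into \<open>20160 s_4^2 - 34560 s_3 s_5 + 86400 s_3^2\<close>.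
  Dividing by \<open>290304 s_3^2\<close> gives the forced coefficient of \<open>t^7\<close>; the
  weights 35, 48 and 2400 are thus those of the normal form, cleared of denominators.\<close>

lemma Q_S_eq:
  assumes "taylor_coeff \<sigma> 3 \<noteq> 0"
  shows "Q_S \<theta>\<^sub>0 \<rho>p \<rho>m \<gamma>p \<gamma>m = 290304 * (taylor_coeff \<sigma> 3)\<^sup>2 *
    (5 * ((taylor_coeff \<sigma> 4 / taylor_coeff \<sigma> 3)\<^sup>2 / 72 - taylor_coeff \<sigma> 5 / taylor_coeff \<sigma> 3 / 42 + 5 / 84))"
proof -
  have f: "fact 3 = (6 :: real)" "fact 4 = (24 :: real)" "fact 5 = (120 :: real)"
    by (simp_all add: eval_nat_numeral)
  show ?thesis
    unfolding Q_S_def Let_def css_sigma_eq f using assms by (simp add: field_simps power2_eq_square)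
qed

section \<open>Conditions on the Jacobian and the resulting normal forms\<close>

lemma jac_derivs:
  "J 0 = taylor_coeff J 0" "deriv J 0 = taylor_coeff J 1"
  "(deriv ^^ 2) J 0 = 2 * taylor_coeff J 2" "(deriv ^^ 3) J 0 = 6 * taylor_coeff J 3"
  by (simp_all add: taylor_coeff_def eval_nat_numeral)

text \<open>An order is pinned down by the vanishing of one jet and the non-vanishing of the next
  longer one, and the equivalence of vanishing jets transfers both.\<close>

lemma jac_order:
  "J 0 = 0 \<and> deriv J 0 \<noteq> 0 \<longleftrightarrow> taylor_coeff \<sigma> 0 = 0 \<and> taylor_coeff \<sigma> 1 \<noteq> 0"
  "J 0 = 0 \<and> deriv J 0 = 0 \<and> (deriv ^^ 2) J 0 \<noteq> 0 \<longleftrightarrow>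
    taylor_coeff \<sigma> 0 = 0 \<and> taylor_coeff \<sigma> 1 = 0 \<and> taylor_coeff \<sigma> 2 \<noteq> 0"
  "J 0 = 0 \<and> deriv J 0 = 0 \<and> (deriv ^^ 2) J 0 = 0 \<and> (deriv ^^ 3) J 0 \<noteq> 0 \<longleftrightarrow>
    taylor_coeff \<sigma> 0 = 0 \<and> taylor_coeff \<sigma> 1 = 0 \<and> taylor_coeff \<sigma> 2 = 0 \<and> taylor_coeff \<sigma> 3 \<noteq> 0"
proof -
  have l: "(\<forall>k<1. P k) \<longleftrightarrow> P 0" "(\<forall>k<2. P k) \<longleftrightarrow> P 0 \<and> P 1" "(\<forall>k<3. P k) \<longleftrightarrow> P 0 \<and> P 1 \<and> P 2"
    "(\<forall>k<4. P k) \<longleftrightarrow> P 0 \<and> P 1 \<and> P 2 \<and> P 3" for P :: "nat \<Rightarrow> bool"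
    by (auto simp: eval_nat_numeral less_Suc_eq)
  note j = jac_jet_iff[of 1] jac_jet_iff[of 2] jac_jet_iff[of 3] jac_jet_iff[of 4]
  show "J 0 = 0 \<and> deriv J 0 \<noteq> 0 \<longleftrightarrow> taylor_coeff \<sigma> 0 = 0 \<and> taylor_coeff \<sigma> 1 \<noteq> 0"
    "J 0 = 0 \<and> deriv J 0 = 0 \<and> (deriv ^^ 2) J 0 \<noteq> 0 \<longleftrightarrow>
    taylor_coeff \<sigma> 0 = 0 \<and> taylor_coeff \<sigma> 1 = 0 \<and> taylor_coeff \<sigma> 2 \<noteq> 0"
    "J 0 = 0 \<and> deriv J 0 = 0 \<and> (deriv ^^ 2) J 0 = 0 \<and> (deriv ^^ 3) J 0 \<noteq> 0 \<longleftrightarrow>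
    taylor_coeff \<sigma> 0 = 0 \<and> taylor_coeff \<sigma> 1 = 0 \<and> taylor_coeff \<sigma> 2 = 0 \<and> taylor_coeff \<sigma> 3 \<noteq> 0"
    using j unfolding l jac_derivs by simp_all blast+
qed

lemma regular_iff: "regular_at S 0 \<longleftrightarrow> J 0 \<noteq> 0"
proof -
  have d: "(S has_vector_derivative (J 0 / (R 0)\<^sup>2) *\<^sub>R \<Delta> 0) (at 0)"
    by (rule eventually_nhds_x_imp_x[OF ev_derivative_css])
  have "(J 0 / (R 0)\<^sup>2) *\<^sub>R \<Delta> 0 \<noteq> 0 \<longleftrightarrow> J 0 \<noteq> 0" using chord_0 sum0 by simp
  then show ?thesis
    unfolding regular_at_def using d vector_derivative_unique_at[OF d] by metis
qed

text \<open>Both properties amount to \<open>J u = 0\<close>: the derivative of \<open>S\<close> is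
  \<open>J / R^2\<close> times a chord that is nonzero near 0, and \<open>J\<close> is the
  determinant tested by the charts of the projective line.\<close>

lemma singular_iff_critical:
  "\<forall>\<^sub>F u in nhds 0. \<rho>p u \<noteq> 0 \<or> \<rho>m u \<noteq> 0 \<longrightarrow>
    (singular_at S u \<longleftrightarrow> RP1_critical_point (\<lambda>t. proj_point (\<rho>p t) (\<rho>m t)) u)"
  using ev_derivative_css ev_nonzero(1,3) smooth_germ_deriv(2)[OF smooth_data(1)] smooth_germ_deriv(2)[OF smooth_data(2)]
proof eventually_elim
  case (elim u)
  have "singular_at S u \<longleftrightarrow> J u = 0"
  proof
    assume "singular_at S u"
    then have "(J u / (R u)\<^sup>2) *\<^sub>R \<Delta> u = 0"
      unfolding singular_at_def by (rule vector_derivative_unique_at[OF elim(1)])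
    then show "J u = 0" using elim(2) polar(3)[OF elim(3)] by simp
  next
    assume "J u = 0"
    then show "singular_at S u" using elim(1) by (simp add: singular_at_def)
  qed
  then show ?case
    using RP1_critical_point_iff[OF elim(4,5)] by (simp add: radius_jac_def)
qed

lemma cusp_5_4_cases:
  assumes \<sigma>: "taylor_coeff \<sigma> 0 = 0" "taylor_coeff \<sigma> 1 = 0" "taylor_coeff \<sigma> 2 = 0" "taylor_coeff \<sigma> 3 \<noteq> 0"
  shows "C1_cusp_5_4 S"
    and "Q_S \<theta>\<^sub>0 \<rho>p \<rho>m \<gamma>p \<gamma>m = 0 \<Longrightarrow> cusp_5_4 S"
    and "Q_S \<theta>\<^sub>0 \<rho>p \<rho>m \<gamma>p \<gamma>m > 0 \<Longrightarrow> cusp_5_4_plus_7 S"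
    and "Q_S \<theta>\<^sub>0 \<rho>p \<rho>m \<gamma>p \<gamma>m < 0 \<Longrightarrow> cusp_5_4_minus_7 S"
proof -
  define E where "E = 5 * ((taylor_coeff \<sigma> 4 / taylor_coeff \<sigma> 3)\<^sup>2 / 72 - taylor_coeff \<sigma> 5 / taylor_coeff \<sigma> 3 / 42 + 5 / 84)"
  have Q: "Q_S \<theta>\<^sub>0 \<rho>p \<rho>m \<gamma>p \<gamma>m = 290304 * (taylor_coeff \<sigma> 3)\<^sup>2 * E"
    unfolding Q_S_eq[OF \<sigma>(4)] E_def ..
  have s3: "290304 * (taylor_coeff \<sigma> 3)\<^sup>2 > 0" using \<sigma>(4) by simp
  have c: "isCont (\<lambda>t::real. vector [t ^ 4, t ^ 5 + \<epsilon> * t ^ 7] :: real^2) 0" for \<epsilon>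
    by (intro isCont_vector_2 continuous_intros)
  \<comment> \<open>Rescaling by \<open>l\<close> multiplies the forced coefficient \<open>E\<close>
    by \<open>l^2\<close>, so only its sign survives; \<open>l = 1 / sqrt \<bar>E\<bar>\<close>
    brings it to 1 or -1.\<close>
  have A: "A_equivalent S (\<lambda>t. vector [t ^ 4, t ^ 5 + \<epsilon> * t ^ 7])" if "l \<noteq> 0" "\<epsilon> = E * l\<^sup>2" for \<epsilon> l
    by (rule cusp_5_4_general[OF \<sigma> that(1) that(2)[unfolded E_def] _ Ck_at_id has_derivative_ident refl refl c])
      (simp_all add: vec_eq_iff forall_2)
  show "C1_cusp_5_4 S"
  proof -
    obtain K :: "real^2 \<Rightarrow> real^2" where K: "Ck_at 1 0 K" "(K has_derivative (\<lambda>v. v)) (at 0)" "K 0 = 0"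
      "\<And>t. K (vector [t ^ 4, t ^ 5]) = vector [t ^ 4, t ^ 5 + E * t ^ 7]"
      using C1_shear_5_4 by blast
    \<comment> \<open>Here \<open>l = 1\<close>, and the shear \<open>K\<close> carries
      \<open>(t^4, t^5)\<close> to the model with coefficient \<open>E\<close>, whatever its
      sign.\<close>
    have "Ck_equivalent 1 S (\<lambda>t. vector [t ^ 4, t ^ 5])"
      by (rule cusp_5_4_general[OF \<sigma> one_neq_zero _ order_refl K(1-3) K(4)[symmetric]])
        (use c[of 0] in \<open>simp_all add: E_def vec_eq_iff forall_2\<close>)
    then show ?thesis by (simp add: C1_cusp_5_4_def)
  qed
  show "cusp_5_4 S" if "Q_S \<theta>\<^sub>0 \<rho>p \<rho>m \<gamma>p \<gamma>m = 0"
  proof -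
    have "E = 0" using that s3 unfolding Q by simp
    then show ?thesis using A[of 1 0] by (simp add: cusp_5_4_def)
  qed
  show "cusp_5_4_plus_7 S" if "Q_S \<theta>\<^sub>0 \<rho>p \<rho>m \<gamma>p \<gamma>m > 0"
  proof -
    have "E > 0" using that s3 unfolding Q by (simp add: zero_less_mult_iff)
    then show ?thesis using A[of "1 / sqrt E" 1] by (simp add: cusp_5_4_plus_7_def power_divide)
  qed
  show "cusp_5_4_minus_7 S" if "Q_S \<theta>\<^sub>0 \<rho>p \<rho>m \<gamma>p \<gamma>m < 0"
  proof -
    have "E < 0" using that s3 unfolding Q by (simp add: mult_less_0_iff)
    then show ?thesis using A[of "1 / sqrt (- E)" "-1"] by (simp add: cusp_5_4_minus_7_def power_divide)
  qed
qed

end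

theorem theorem3p9:
  fixes \<gamma>p \<gamma>m :: "real \<Rightarrow> real^2" and \<rho>p \<rho>m :: "real \<Rightarrow> real" and \<theta>\<^sub>0 :: real
  assumes "angular_parallel_pair \<theta>\<^sub>0 \<rho>p \<rho>m \<gamma>p \<gamma>m"
    and "det2 (chord \<gamma>p \<gamma>m 0) (unit_dir (0 + \<theta>\<^sub>0)) \<noteq> 0"
    and "radius_sum \<rho>p \<rho>m 0 \<noteq> 0"
  shows
    "(regular_at (css \<rho>p \<rho>m \<gamma>p \<gamma>m) 0 \<longleftrightarrow> radius_jac \<rho>p \<rho>m 0 \<noteq> 0)
   \<and> (cusp_3_2 (css \<rho>p \<rho>m \<gamma>p \<gamma>m) \<longleftrightarrow>
        radius_jac \<rho>p \<rho>m 0 = 0 \<and> deriv (radius_jac \<rho>p \<rho>m) 0 \<noteq> 0)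
   \<and> (cusp_4_3 (css \<rho>p \<rho>m \<gamma>p \<gamma>m) \<longleftrightarrow>
        radius_jac \<rho>p \<rho>m 0 = 0 \<and> deriv (radius_jac \<rho>p \<rho>m) 0 = 0 \<and>
        (deriv ^^ 2) (radius_jac \<rho>p \<rho>m) 0 \<noteq> 0)
   \<and> (radius_jac \<rho>p \<rho>m 0 = 0 \<and> deriv (radius_jac \<rho>p \<rho>m) 0 = 0 \<and>
        (deriv ^^ 2) (radius_jac \<rho>p \<rho>m) 0 = 0 \<and> (deriv ^^ 3) (radius_jac \<rho>p \<rho>m) 0 \<noteq> 0 \<longrightarrow>
        C1_cusp_5_4 (css \<rho>p \<rho>m \<gamma>p \<gamma>m)
      \<and> (Q_S \<theta>\<^sub>0 \<rho>p \<rho>m \<gamma>p \<gamma>m = 0 \<longrightarrow> cusp_5_4 (css \<rho>p \<rho>m \<gamma>p \<gamma>m))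
      \<and> (Q_S \<theta>\<^sub>0 \<rho>p \<rho>m \<gamma>p \<gamma>m > 0 \<longrightarrow> cusp_5_4_plus_7 (css \<rho>p \<rho>m \<gamma>p \<gamma>m))
      \<and> (Q_S \<theta>\<^sub>0 \<rho>p \<rho>m \<gamma>p \<gamma>m < 0 \<longrightarrow> cusp_5_4_minus_7 (css \<rho>p \<rho>m \<gamma>p \<gamma>m)))
   \<and> (\<forall>\<^sub>F u in nhds 0. \<rho>p u \<noteq> 0 \<or> \<rho>m u \<noteq> 0 \<longrightarrow>
        (singular_at (css \<rho>p \<rho>m \<gamma>p \<gamma>m) u \<longleftrightarrow>
         RP1_critical_point (\<lambda>t. proj_point (\<rho>p t) (\<rho>m t)) u))"
proof -
  interpret parallel_chords \<gamma>p \<gamma>m \<rho>p \<rho>m \<theta>\<^sub>0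
    using assms by unfold_locales
  show ?thesis
    unfolding jac_order
    by (intro conjI impI regular_iff cusp_3_2_iff cusp_4_3_iff singular_iff_critical)
      (blast intro: cusp_5_4_cases)+
qed

end
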